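(* Let $\nu>0$, $T>0$, $u_0\in\mathcal{M}(\mathbb{R}^2)$ and $u\in L^4(0,T;L^{4/3}(\mathbb{R}^2))$. Let $u_1,u_2\in L^4(0,T;L^4(\mathbb{R}^2)\cap L^{4/3}(\mathbb{R}^2))$ with $u_1-u_2\in L^\infty(0,T;H^{-1}(\mathbb{R}^2))$, $u_1(t)-u_2(t)\in L^1(\mathbb{R}^2)$ for a.e. $t\in(0,T)$, and $$\lim_{t\downarrow0}\ \operatorname*{ess\,sup}_{s\in(0,t)}\int_{\mathbb{R}^2}(u_1(s,x)-u_2(s,x))\varphi(x)\,dx=0\quad\text{for all }\varphi\in C_0^\infty(\mathbb{R}^2),$$ be two solutions $v=u_1$, $v=u_2$ of the linear equation $$\int_0^T\!\!\int_{\mathbb{R}^2}(\varphi_t+\nu\Delta\varphi+K(u)\cdot\nabla\varphi)\,v\,dx\,dt+\int_{\mathbb{R}^2}\varphi(0,x)\,u_0(dx)=0$$ for all $C^2$ functions $\varphi$ on $[0,T]\times\mathbb{R}^2$ with compact support in $[0,T)\times\mathbb{R}^2$. Then $u_1\equiv u_2$.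
   Context: $\mathcal{M}(\mathbb{R}^2)$ is the space of finite Radon measures; $H^{-1}(\mathbb{R}^2)$ is the dual of $H^1(\mathbb{R}^2)$. The Biot–Savart kernel is $k(x)=\frac{(-x_2,x_1)}{2\pi|x|^2}$, $x\ne0$, and $K(z)=k*z$. *)

theory Defs
  imports "HOL-Analysis.Analysis" "HOL-Probability.Essential_Supremum"
begin

definition partial :: "('a::euclidean_space \<Rightarrow> real) \<Rightarrow> 'a \<Rightarrow> 'a \<Rightarrow> real" where
  "partial f d x = deriv (\<lambda>s. f (x + s *\<^sub>R d)) 0"

fun Ck :: "nat \<Rightarrow> ('a::euclidean_space \<Rightarrow> real) \<Rightarrow> bool" where
  "Ck 0 f = continuous_on UNIV f"
| "Ck (Suc k) f = ((\<forall>x. f differentiable (at x)) \<and> (\<forall>i\<in>Basis. Ck k (partial f i)))"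

definition smooth :: "('a::euclidean_space \<Rightarrow> real) \<Rightarrow> bool" where
  "smooth f \<longleftrightarrow> (\<forall>k. Ck k f)"

definition test_fun :: "(real \<times> real \<Rightarrow> real) \<Rightarrow> bool" where
  "test_fun \<phi> \<longleftrightarrow> smooth \<phi> \<and> compact (closure {x. \<phi> x \<noteq> 0})"

definition H1_norm :: "(real \<times> real \<Rightarrow> real) \<Rightarrow> real" where
  "H1_norm \<phi> = sqrt ((\<integral>x. (\<phi> x)\<^sup>2 \<partial>lborel) + (\<integral>x. (\<Sum>i\<in>Basis. (partial \<phi> i x)\<^sup>2) \<partial>lborel))"

definition biot_savart :: "real \<times> real \<Rightarrow> real \<times> real" where
  "biot_savart x = (1 / (2 * pi * (norm x)\<^sup>2)) *\<^sub>R (- snd x, fst x)"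

definition K :: "(real \<Rightarrow> real \<times> real \<Rightarrow> real) \<Rightarrow> real \<Rightarrow> real \<times> real \<Rightarrow> real \<times> real" where
  "K u t x = (\<integral>y. u t y *\<^sub>R biot_savart (x - y) \<partial>lborel)"

definition LpLq :: "real \<Rightarrow> real \<Rightarrow> real \<Rightarrow> (real \<Rightarrow> real \<times> real \<Rightarrow> real) \<Rightarrow> bool" where
  "LpLq p q T u \<longleftrightarrow>
     (\<lambda>z. u (fst z) (snd z)) \<in> borel_measurable lborel \<and>
     (AE t in lborel. t \<in> {0<..<T} \<longrightarrow> (\<integral>\<^sup>+x. ennreal (\<bar>u t x\<bar> powr q) \<partial>lborel) < \<infinity>) \<and>
     (\<integral>\<^sup>+t \<in> {0<..<T}. ennreal ((enn2real (\<integral>\<^sup>+x. ennreal (\<bar>u t x\<bar> powr q) \<partial>lborel)) powr (p / q)) \<partial>lborel) < \<infinity>"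

text \<open>w \<in> L^\<infinity>(0,T; H^{-1}(R^2)): the functionals \<phi> \<mapsto> \<integral> w(t) \<phi> are bounded
  in the H^1 norm (on the dense subspace C_0^\<infinity>), uniformly for a.e. t.\<close>
definition Linf_Hminus1 :: "real \<Rightarrow> (real \<Rightarrow> real \<times> real \<Rightarrow> real) \<Rightarrow> bool" where
  "Linf_Hminus1 T w \<longleftrightarrow>
     (\<lambda>z. w (fst z) (snd z)) \<in> borel_measurable lborel \<and>
     (\<exists>C. AE t in lborel. t \<in> {0<..<T} \<longrightarrow>
        (\<forall>\<phi>. test_fun \<phi> \<longrightarrow> \<bar>\<integral>x. w t x * \<phi> x \<partial>lborel\<bar> \<le> C * H1_norm \<phi>))"

text \<open>Admissible test functions of the weak formulation: C^2 functions (extended to all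
  of R^3) whose support within [0,T] \<times> R^2 is a compact subset of [0,T) \<times> R^2.\<close>
definition st_test :: "real \<Rightarrow> (real \<times> (real \<times> real) \<Rightarrow> real) \<Rightarrow> bool" where
  "st_test T \<phi> \<longleftrightarrow> Ck 2 \<phi> \<and>
     (\<exists>T' < T. \<exists>R. \<forall>t x. 0 \<le> t \<and> t \<le> T \<and> (T' \<le> t \<or> R \<le> norm x) \<longrightarrow> \<phi> (t, x) = 0)"

definition lap_x :: "(real \<times> (real \<times> real) \<Rightarrow> real) \<Rightarrow> real \<times> (real \<times> real) \<Rightarrow> real" where
  "lap_x \<phi> z = (\<Sum>j\<in>(Basis :: (real \<times> real) set). partial (partial \<phi> (0, j)) (0, j) z)"

text \<open>The initial datum u_0 \<in> M(R^2) (finite signed Radon measure) is given by its Jordan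
  decomposition into two finite Borel measures mp, mm.\<close>
definition weak_sol :: "real \<Rightarrow> real \<Rightarrow> (real \<Rightarrow> real \<times> real \<Rightarrow> real) \<Rightarrow>
    (real \<times> real) measure \<Rightarrow> (real \<times> real) measure \<Rightarrow> (real \<Rightarrow> real \<times> real \<Rightarrow> real) \<Rightarrow> bool" where
  "weak_sol \<nu> T u mp mm v \<longleftrightarrow>
     (\<forall>\<phi>. st_test T \<phi> \<longrightarrow>
        (LINT t:{0<..<T}|lborel. (\<integral>x. (partial \<phi> (1, 0) (t, x) + \<nu> * lap_x \<phi> (t, x)
              + (\<Sum>j\<in>Basis. (K u t x \<bullet> j) * partial \<phi> (0, j) (t, x))) * v t x \<partial>lborel))
        + ((\<integral>x. \<phi> (0, x) \<partial>mp) - (\<integral>x. \<phi> (0, x) \<partial>mm)) = 0)"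

end

theory Submission
  imports Defs
begin

text \<open>The difference \<open>w\<close> of the two solutions solves the equation with zero initial datum. By the
  Hardy-Littlewood-Sobolev inequality \<open>K u\<close> lies in \<open>L\<^sup>4\<close> of space-time, so the flux \<open>K u * w\<close> lies in
  \<open>L\<^sup>2\<close>. Mollifying in space turns the weak equation into an ordinary differential equation in time at each
  point, and the energy estimate together with the Ladyzhenskaya inequality bounds the fourth power of the
  \<open>L\<^sup>4\<close>-norm of the mollified \<open>w\<close> on \<open>(0, \<tau>)\<close> by a constant times the fourth power of the \<open>L\<^sup>2\<close>-norm of
  the flux. Removing the mollification and using the Cauchy-Schwarz inequality, if \<open>w\<close> vanishes before \<open>\<alpha>\<close> then
  \<open>\<parallel>w\<parallel>\<^sup>4 \<le> C * \<parallel>K u\<parallel>\<^sup>4 * \<parallel>w\<parallel>\<^sup>4\<close>, where the norm of \<open>w\<close> is over \<open>(0, \<tau>)\<close> and that of \<open>K u\<close> only over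
  \<open>(\<alpha>, \<tau>)\<close>. For \<open>\<tau>\<close> close to \<open>\<alpha>\<close> this forces \<open>w = 0\<close> up to \<open>\<tau>\<close>, and one continues up to time \<open>T\<close>.\<close>

subsection \<open>The Hardy-Littlewood-Sobolev inequality in the plane\<close>

text \<open>The obstacle is scaling. Under the parabolic scaling of the equation the space-time
  \<open>L^4\<close>-norm of \<open>K u\<close> is invariant, so shortening the time interval gains
  no power of its length. Smallness comes only from absolute continuity of the integral; the length
  of a continuation step depends on where \<open>K u\<close> concentrates and has no lower bound
  known beforehand, hence the argument by a supremum.

  Absorbing a term into the left side needs that side to be finite first. This is why the potential
  is truncated in the Hardy-Littlewood-Sobolev proof and why the fourth power of \<open>w\<close> is
  known to be integrable before the continuation starts.

  A priori \<open>w\<close> has neither a gradient nor a time derivative. The product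
  \<open>K u * w\<close> is therefore treated as a given square integrable source and mollified as a
  whole, so that no commutator appears and the energy estimate does not depend on the mollification
  radius.

  Test functions have class C^2, so cubes of truncated polynomials serve as profiles, both in time
  and in space.\<close>

lemma borel_measurable_fst [measurable]:
  "fst \<in> borel_measurable (borel :: ('a::second_countable_topology \<times> 'b::second_countable_topology) measure)"
  by (simp add: borel_prod[symmetric])

lemma borel_measurable_snd [measurable]:
  "snd \<in> borel_measurable (borel :: ('a::second_countable_topology \<times> 'b::second_countable_topology) measure)"
  by (simp add: borel_prod[symmetric])

lemma nn_integral_lborel_translate:
  fixes f :: "'a::euclidean_space \<Rightarrow> ennreal"
  assumes [measurable]: "f \<in> borel_measurable borel"
  shows "(\<integral>\<^sup>+x. f (x + c) \<partial>lborel) = (\<integral>\<^sup>+x. f x \<partial>lborel)"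
proof -
  have "(\<integral>\<^sup>+x. f x \<partial>lborel) = (\<integral>\<^sup>+x. f x \<partial>distr lborel borel ((+) c))"
    by (simp add: lborel_distr_plus)
  also have "\<dots> = (\<integral>\<^sup>+x. f (c + x) \<partial>lborel)"
    by (rule nn_integral_distr) auto
  finally show ?thesis by (simp add: add.commute)
qed

lemma nn_integral_lborel_reflect:
  fixes f :: "'a::euclidean_space \<Rightarrow> ennreal"
  assumes [measurable]: "f \<in> borel_measurable borel"
  shows "(\<integral>\<^sup>+x. f (c - x) \<partial>lborel) = (\<integral>\<^sup>+x. f x \<partial>lborel)"
proof -
  have "(\<integral>\<^sup>+x. f x \<partial>lborel) = (\<integral>\<^sup>+x. f x \<partial>density (distr lborel borel (\<lambda>x. c + (-1) *\<^sub>R x)) (\<lambda>_. ennreal (\<bar>-1\<bar>^DIM('a))))"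
    using arg_cong[OF lborel_affine[of "-1" c], of "\<lambda>M. integral\<^sup>N M f"] by simp
  also have "\<dots> = (\<integral>\<^sup>+x. f (c - x) \<partial>lborel)"
    by (simp add: nn_integral_density nn_integral_distr)
  finally show ?thesis by simp
qed

lemma nn_integral_even_le:
  fixes f :: "real \<Rightarrow> ennreal"
  assumes [measurable]: "f \<in> borel_measurable borel" and even: "\<And>x. f (- x) = f x"
  shows "(\<integral>\<^sup>+x. f x \<partial>lborel) \<le> 2 * (\<integral>\<^sup>+x. f x * indicator {0..} x \<partial>lborel)"
proof -
  have "(\<integral>\<^sup>+x. f x \<partial>lborel) \<le> (\<integral>\<^sup>+x. f x * indicator {0..} x + f (-x) * indicator {0..} (-x) \<partial>lborel)"
    by (intro nn_integral_mono) (auto simp: even split: split_indicator)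
  also have "\<dots> = (\<integral>\<^sup>+x. f x * indicator {0..} x \<partial>lborel) + (\<integral>\<^sup>+x. f (-x) * indicator {0..} (-x) \<partial>lborel)"
    by (rule nn_integral_add) auto
  also have "(\<integral>\<^sup>+x. f (-x) * indicator {0..} (-x) \<partial>lborel) = (\<integral>\<^sup>+x. f x * indicator {0..} x \<partial>lborel)"
    using nn_integral_lborel_reflect[of "\<lambda>x. f x * indicator {0..} x" 0] by simp
  finally show ?thesis by (simp add: mult_2)
qed

lemma nn_integral_product_real2:
  fixes f g :: "real \<Rightarrow> ennreal"
  assumes [measurable]: "f \<in> borel_measurable borel" "g \<in> borel_measurable borel"
  shows "(\<integral>\<^sup>+x. f (fst x) * g (snd x) \<partial>(lborel :: (real \<times> real) measure)) =
    (\<integral>\<^sup>+x. f x \<partial>lborel) * (\<integral>\<^sup>+x. g x \<partial>lborel)"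
proof -
  have "(\<integral>\<^sup>+x. f (fst x) * g (snd x) \<partial>(lborel :: (real \<times> real) measure)) =
    (\<integral>\<^sup>+x. f (fst x) * g (snd x) \<partial>(lborel \<Otimes>\<^sub>M lborel))"
    by (simp add: lborel_prod)
  also have "\<dots> = (\<integral>\<^sup>+x. \<integral>\<^sup>+y. f x * g y \<partial>lborel \<partial>lborel)"
    by (subst lborel.nn_integral_fst[symmetric]) auto
  also have "\<dots> = (\<integral>\<^sup>+x. f x \<partial>lborel) * (\<integral>\<^sup>+x. g x \<partial>lborel)"
    by (simp add: nn_integral_cmult nn_integral_multc)
  finally show ?thesis .
qed

section \<open>Integrals of the kernel near the origin and away from it\<close>

lemma nn_integral_inverse_sqrt:
  assumes "R > 0"
  shows "(\<integral>\<^sup>+s. ennreal (\<bar>s\<bar> powr (-1/2) * indicator {-R..R} s) \<partial>lborel) \<le> ennreal (4 * sqrt R)"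
proof -
  let ?f = "\<lambda>s. ennreal (\<bar>s\<bar> powr (-1/2) * indicator {-R..R} s)"
  have "(\<integral>\<^sup>+s. ?f s \<partial>lborel) \<le> 2 * (\<integral>\<^sup>+s. ?f s * indicator {0..} s \<partial>lborel)"
    by (rule nn_integral_even_le) (auto split: split_indicator)
  also have "(\<integral>\<^sup>+s. ?f s * indicator {0..} s \<partial>lborel) =
      (\<integral>\<^sup>+s. ennreal (if s \<in> {0..R} then s powr (-(1/2)) else 0) \<partial>lborel)"
    by (intro nn_integral_cong) (auto split: split_indicator)
  also have "\<dots> = ennreal (R powr (1/2) / (1/2))"
    using has_integral_powr_from_0[of "-1/2" R] assms
    by (intro nn_integral_has_integral_lborel) (auto simp: has_integral_restrict_UNIV[of "{0..R}", simplified])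
  finally show ?thesis
    using assms by (simp add: powr_half_sqrt ennreal_mult[symmetric] flip: ennreal_numeral)
qed

lemma nn_integral_inverse_quadratic:
  assumes "R > 0"
  shows "(\<integral>\<^sup>+s. ennreal (1 / (R\<^sup>2 + s\<^sup>2)) \<partial>lborel) \<le> ennreal (pi / R)"
proof -
  have "(\<integral>\<^sup>+s. ennreal (1 / (R\<^sup>2 + s\<^sup>2)) \<partial>lborel)
     \<le> 2 * (\<integral>\<^sup>+s. ennreal (1 / (R\<^sup>2 + s\<^sup>2)) * indicator {0..} s \<partial>lborel)"
    by (rule nn_integral_even_le) auto
  also have "(\<integral>\<^sup>+s. ennreal (1 / (R\<^sup>2 + s\<^sup>2)) * indicator {0..} s \<partial>lborel)
     = ennreal (pi / 2 / R - arctan (0 / R) / R)"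
  proof (rule nn_integral_FTC_atLeast)
    show "((\<lambda>s. arctan (s / R) / R) has_real_derivative 1 / (R\<^sup>2 + x\<^sup>2)) (at x)" for x
    proof -
      have "R\<^sup>2 + x\<^sup>2 > 0" using assms by (simp add: add_pos_nonneg)
      then show ?thesis
        using assms by (auto intro!: derivative_eq_intros simp: divide_simps) (simp add: power2_eq_square)
    qed
    have "filterlim (\<lambda>s. s / R) at_top at_top"
      using assms filterlim_tendsto_pos_mult_at_top[of "\<lambda>_. 1/R" "1/R" at_top "\<lambda>s. s"]
      by (simp add: filterlim_ident)
    then have "((\<lambda>s. arctan (s / R)) \<longlongrightarrow> pi / 2) at_top"
      using tendsto_arctan_at_top filterlim_compose by blast
    then show "((\<lambda>s. arctan (s / R) / R) \<longlongrightarrow> pi / 2 / R) at_top"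
      using assms by (intro tendsto_divide) auto
  qed auto
  finally show ?thesis
    using assms by (simp add: ennreal_mult[symmetric] flip: ennreal_numeral)
qed

text \<open>With \<open>w = (a, b)\<close>, the inequality \<open>|a| * |b| \<le> a^2 + b^2\<close>
  bounds \<open>1 / norm w\<close> by \<open>|a| powr (-1/2) * |b| powr (-1/2)\<close>, and the disc
  lies in a square. The integral is thus at most a product of two one-dimensional ones, which
  replaces polar coordinates.\<close>

lemma nn_integral_near:
  assumes "R > 0"
  shows "(\<integral>\<^sup>+w. ennreal (indicator {w. norm w < R} w / norm w) \<partial>(lborel::(real\<times>real) measure))
           \<le> ennreal (16 * R)"
proof -
  let ?g = "\<lambda>s. ennreal (\<bar>s\<bar> powr (-1/2) * indicator {-R..R} s)"
  \<comment> \<open>On the axes \<open>0 powr (-1/2)\<close> equals 0 and the pointwise bound fails;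
    they form a null set.\<close>
  have nz: "AE w in (lborel::(real\<times>real) measure). fst w \<noteq> 0 \<and> snd w \<noteq> 0"
  proof -
    have "AE w in (lborel \<Otimes>\<^sub>M lborel). fst w \<noteq> (0::real) \<and> snd w \<noteq> (0::real)"
    proof (rule lborel_pair.AE_pair_measure)
      show "AE x in lborel. AE y in lborel. fst (x, y) \<noteq> (0::real) \<and> snd (x, y) \<noteq> (0::real)"
        using AE_lborel_singleton[of "0::real"] by eventually_elim (use AE_lborel_singleton[of "0::real"] in auto)
    qed measurable
    then show ?thesis unfolding lborel_prod .
  qed
  have "(\<integral>\<^sup>+w. ennreal (indicator {w. norm w < R} w / norm w) \<partial>(lborel::(real\<times>real) measure))
     \<le> (\<integral>\<^sup>+w. ?g (fst w) * ?g (snd w) \<partial>(lborel::(real\<times>real) measure))"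
  proof (rule nn_integral_mono_AE, use nz in eventually_elim)
    case (elim w)
    obtain a b where w: "w = (a,b)" by force
    show ?case
    proof (cases "norm w < R")
      case True
      have ab: "a \<noteq> 0" "b \<noteq> 0" using elim w by auto
      have "\<bar>a\<bar> \<le> norm w" "\<bar>b\<bar> \<le> norm w"
        using w norm_fst_le[of a b] norm_snd_le[of b a] by auto
      then have *: "\<bar>a\<bar> \<le> R" "\<bar>b\<bar> \<le> R" using True by auto
      have "(norm w)\<^sup>2 = a\<^sup>2 + b\<^sup>2" using w by (simp add: norm_Pair)
      moreover have "a\<^sup>2 + b\<^sup>2 \<ge> \<bar>a\<bar> * \<bar>b\<bar>"
        using sum_squares_bound[of "\<bar>a\<bar>" "\<bar>b\<bar>"] abs_ge_zero[of "a*b"] unfolding abs_mult power2_abs by linarith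
      ultimately have "sqrt (\<bar>a\<bar> * \<bar>b\<bar>) \<le> norm w" by (simp add: real_le_lsqrt)
      moreover have "sqrt (\<bar>a\<bar> * \<bar>b\<bar>) > 0" using ab by simp
      ultimately have "1 / norm w \<le> 1 / sqrt (\<bar>a\<bar> * \<bar>b\<bar>)"
        by (simp add: frac_le)
      also have "\<dots> = \<bar>a\<bar> powr (-1/2) * \<bar>b\<bar> powr (-1/2)"
        using ab by (simp add: powr_minus_divide powr_half_sqrt real_sqrt_mult)
      finally show ?thesis
        using True * w by (auto simp: ennreal_mult[symmetric] abs_le_iff split: split_indicator intro!: ennreal_leI)
    qed auto
  qed
  also have "\<dots> = (\<integral>\<^sup>+s. ?g s \<partial>lborel) * (\<integral>\<^sup>+s. ?g s \<partial>lborel)"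
    by (rule nn_integral_product_real2) auto
  also have "\<dots> \<le> ennreal (4 * sqrt R) * ennreal (4 * sqrt R)"
    by (intro mult_mono nn_integral_inverse_sqrt assms) auto
  also have "\<dots> = ennreal (16 * R)"
    using assms by (simp add: ennreal_mult[symmetric])
  finally show ?thesis .
qed

text \<open>Outside the disc \<open>(R^2 + a^2) * (R^2 + b^2) \<le> 4 * norm w ^ 4\<close>, so the
  kernel is dominated by a multiple of a product of two Cauchy densities.\<close>

lemma nn_integral_far:
  assumes "R > 0"
  shows "(\<integral>\<^sup>+w. ennreal (indicator {w. R \<le> norm w} w / norm w ^ 4) \<partial>(lborel::(real\<times>real) measure))
           \<le> ennreal (4 * pi\<^sup>2 / R\<^sup>2)"
proof -
  let ?g = "\<lambda>s. ennreal (1 / (R\<^sup>2 + s\<^sup>2))"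
  have "(\<integral>\<^sup>+w. ennreal (indicator {w. R \<le> norm w} w / norm w ^ 4) \<partial>(lborel::(real\<times>real) measure))
     \<le> (\<integral>\<^sup>+w. 4 * (?g (fst w) * ?g (snd w)) \<partial>(lborel::(real\<times>real) measure))"
  proof (rule nn_integral_mono)
    fix w :: "real \<times> real"
    obtain a b where w: "w = (a,b)" by force
    show "ennreal (indicator {w. R \<le> norm w} w / norm w ^ 4) \<le> 4 * (?g (fst w) * ?g (snd w))"
    proof (cases "R \<le> norm w")
      case True
      have n: "(norm w)\<^sup>2 = a\<^sup>2 + b\<^sup>2" using w by (simp add: norm_Pair)
      have r: "R\<^sup>2 \<le> (norm w)\<^sup>2" using True assms by (intro power_mono) auto
      have "(R\<^sup>2 + a\<^sup>2) * (R\<^sup>2 + b\<^sup>2) \<le> (2 * (norm w)\<^sup>2) * (2 * (norm w)\<^sup>2)"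
        using r n zero_le_power2[of a] zero_le_power2[of b] by (intro mult_mono add_nonneg_nonneg) (linarith | simp)+
      also have "\<dots> = 4 * norm w ^ 4" by (simp add: power4_eq_xxxx power2_eq_square)
      finally have l: "(R\<^sup>2 + a\<^sup>2) * (R\<^sup>2 + b\<^sup>2) \<le> 4 * norm w ^ 4" .
      have p: "(R\<^sup>2 + a\<^sup>2) * (R\<^sup>2 + b\<^sup>2) > 0" using assms by (simp add: add_pos_nonneg)
      have "norm w > 0" using True assms by linarith
      then have "1 / norm w ^ 4 = 4 / (4 * norm w ^ 4)" by simp
      also have "\<dots> \<le> 4 / ((R\<^sup>2 + a\<^sup>2) * (R\<^sup>2 + b\<^sup>2))"
        by (rule divide_left_mono[OF l]) (use p \<open>norm w > 0\<close> in \<open>auto intro!: mult_pos_pos\<close>)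
      finally have "1 / norm w ^ 4 \<le> 4 * (1 / (R\<^sup>2 + a\<^sup>2) * (1 / (R\<^sup>2 + b\<^sup>2)))" by simp
      then show ?thesis
        using True w by (simp add: ennreal_mult[symmetric] ennreal_leI flip: ennreal_numeral)
    qed auto
  qed
  also have "\<dots> = 4 * ((\<integral>\<^sup>+s. ?g s \<partial>lborel) * (\<integral>\<^sup>+s. ?g s \<partial>lborel))"
    using nn_integral_product_real2[of ?g ?g] by (subst nn_integral_cmult) simp_all
  also have "\<dots> \<le> 4 * (ennreal (pi / R) * ennreal (pi / R))"
    by (intro mult_mono nn_integral_inverse_quadratic assms) auto
  also have "\<dots> = ennreal (4 * pi\<^sup>2 / R\<^sup>2)"
    using assms by (simp add: ennreal_mult[symmetric] power2_eq_square flip: ennreal_numeral)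
  finally show ?thesis .
qed

text \<open>The sum of three coefficients of \<open>\<alpha> * \<beta>\<close> in the next estimate:
  16 from the kernel near the singularity, 1 from the integral of \<open>F ^ 4\<close>, and
  \<open>4 * pi^2\<close> from the kernel far away.\<close>

definition riesz_const :: real where "riesz_const = 17 + 4 * pi\<^sup>2"

lemma riesz_const_pos: "riesz_const > 0"
  unfolding riesz_const_def by (simp add: add_pos_nonneg)

text \<open>Here the density is \<open>F\<^sup>3\<close>, so that its \<open>L\<^bsup>4/3\<^esup>\<close>-norm involves only the integer power \<open>F\<^sup>4\<close>.\<close>

lemma riesz_potential_sublevel:
  fixes F :: "real \<times> real \<Rightarrow> real"
  assumes [measurable]: "F \<in> borel_measurable borel" and F0: "\<And>y. 0 \<le> F y"
    and A: "(\<integral>\<^sup>+y. ennreal (F y ^ 4) \<partial>lborel) \<le> ennreal (\<beta>\<^sup>2)" and b: "\<beta> > 0" and a: "\<alpha> \<ge> 0"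
  shows "(\<integral>\<^sup>+y. ennreal (F y ^ 3 / norm (x - y)) * indicator {y. F y \<le> \<alpha>} y \<partial>lborel)
           \<le> ennreal (riesz_const * \<alpha> * \<beta>)"
proof (cases "\<alpha> = 0")
  case True
  then have "ennreal (F y ^ 3 / norm (x - y)) * indicator {y. F y \<le> \<alpha>} y = 0" for y
    using F0[of y] by (cases "F y = 0") auto
  then have "(\<integral>\<^sup>+y. ennreal (F y ^ 3 / norm (x - y)) * indicator {y. F y \<le> \<alpha>} y \<partial>lborel) = (\<integral>\<^sup>+y. 0 \<partial>(lborel::(real\<times>real) measure))"
    by (simp only:)
  then show ?thesis by simp
next
  case False
  with a have a: "\<alpha> > 0" by simp
  \<comment> \<open>This radius, together with the Young weight \<open>s\<close>, turns each of the
    three contributions into a multiple of \<open>\<alpha> * \<beta>\<close>. Both are meaningful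
    only for positive \<open>\<alpha>\<close>, hence the separate case above.\<close>
  define R where "R = \<beta> / \<alpha>\<^sup>2"
  define s where "s = \<alpha> / \<beta>"
  have R: "R > 0" and s: "s > 0" using a b by (auto simp: R_def s_def)
  let ?n = "\<lambda>w::real\<times>real. ennreal (indicator {w. norm w < R} w / norm w)"
  let ?f = "\<lambda>w::real\<times>real. ennreal (indicator {w. R \<le> norm w} w / norm w ^ 4)"
  have "(\<integral>\<^sup>+y. ennreal (F y ^ 3 / norm (x - y)) * indicator {y. F y \<le> \<alpha>} y \<partial>lborel)
     \<le> (\<integral>\<^sup>+y. ennreal (\<alpha>^3) * ?n (x - y) + (ennreal s * ennreal (F y ^ 4) + ennreal (1 / s^3) * ?f (x - y)) \<partial>lborel)"
  proof (rule nn_integral_mono)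
    fix y
    show "ennreal (F y ^ 3 / norm (x - y)) * indicator {y. F y \<le> \<alpha>} y
      \<le> ennreal (\<alpha>^3) * ?n (x - y) + (ennreal s * ennreal (F y ^ 4) + ennreal (1 / s^3) * ?f (x - y))"
    proof (cases "F y \<le> \<alpha>")
      case le: True
      show ?thesis
      proof (cases "norm (x - y) < R")
        case True
        have "F y ^ 3 \<le> \<alpha> ^ 3" using le F0 by (intro power_mono) auto
        then have "ennreal (F y ^ 3 / norm (x - y)) \<le> ennreal (\<alpha>^3) * ?n (x - y)"
          using True a by (auto simp: ennreal_mult[symmetric] intro!: ennreal_leI divide_right_mono)
        then show ?thesis using le by (simp add: add_increasing2)
      next
        case False
        let ?d = "norm (x - y)"
        have d: "?d > 0" using False R by linarith
        \<comment> \<open>Young's inequality with exponents 4/3 and 4: of the two quantities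
          \<open>1 / ?d\<close> and \<open>s * F y\<close>, the smaller is replaced by the
          larger.\<close>
        have "F y ^ 3 / ?d \<le> s * F y ^ 4 + 1 / s^3 * (1 / ?d ^ 4)"
        proof (cases "1 / ?d \<le> s * F y")
          case True
          have "F y ^ 3 * (1 / ?d) \<le> F y ^ 3 * (s * F y)"
            by (intro mult_left_mono True) (use F0 in auto)
          also have "\<dots> = s * F y ^ 4" by (simp add: power4_eq_xxxx power3_eq_cube)
          finally show ?thesis using s d by (simp add: add_increasing2)
        next
          case False
          then have "F y \<le> 1 / (s * ?d)" using s d by (simp add: field_simps)
          then have "F y ^ 3 \<le> (1 / (s * ?d)) ^ 3" using F0 by (intro power_mono) auto
          then have "F y ^ 3 * (1 / ?d) \<le> (1 / (s * ?d)) ^ 3 * (1 / ?d)"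
            by (intro mult_right_mono) auto
          also have "\<dots> = 1 / s^3 * (1 / ?d ^ 4)"
            using s d by (simp add: field_simps power4_eq_xxxx power3_eq_cube)
          finally show ?thesis using s F0 by (simp add: add_increasing)
        qed
        then have "ennreal (F y ^ 3 / ?d) \<le> ennreal s * ennreal (F y ^ 4) + ennreal (1 / s^3) * ?f (x - y)"
          using False s F0 by (simp add: ennreal_mult[symmetric] ennreal_plus[symmetric] ennreal_leI del: ennreal_plus)
        then show ?thesis using le by (simp add: add_increasing)
      qed
    qed auto
  qed
  also have "\<dots> = ennreal (\<alpha>^3) * (\<integral>\<^sup>+y. ?n (x - y) \<partial>lborel) + (ennreal s * (\<integral>\<^sup>+y. ennreal (F y ^ 4) \<partial>lborel)
      + ennreal (1 / s^3) * (\<integral>\<^sup>+y. ?f (x - y) \<partial>lborel))"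
    by (subst nn_integral_add; (subst nn_integral_add)?; (simp add: nn_integral_cmult)?)
  also have "\<dots> \<le> ennreal (\<alpha>^3) * ennreal (16 * R) + (ennreal s * ennreal (\<beta>\<^sup>2)
      + ennreal (1 / s^3) * ennreal (4 * pi\<^sup>2 / R\<^sup>2))"
    unfolding nn_integral_lborel_reflect[of ?n x, simplified] nn_integral_lborel_reflect[of ?f x, simplified]
    by (intro add_mono mult_left_mono nn_integral_near nn_integral_far A R) auto
  also have "\<dots> = ennreal (\<alpha>^3 * (16 * R) + (s * \<beta>\<^sup>2 + 1 / s^3 * (4 * pi\<^sup>2 / R\<^sup>2)))"
    using a b s R by (simp add: ennreal_mult[symmetric] ennreal_plus[symmetric] del: ennreal_plus)
  also have "\<alpha>^3 * (16 * R) + (s * \<beta>\<^sup>2 + 1 / s^3 * (4 * pi\<^sup>2 / R\<^sup>2)) = riesz_const * \<alpha> * \<beta>"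
  proof -
    have "\<alpha>^3 * (16 * R) = 16 * \<alpha> * \<beta>" using a by (simp add: R_def power3_eq_cube power2_eq_square)
    moreover have "s * \<beta>\<^sup>2 = \<alpha> * \<beta>" using b by (simp add: s_def power2_eq_square)
    moreover have "1 / s^3 * (4 * pi\<^sup>2 / R\<^sup>2) = 4 * pi\<^sup>2 * \<alpha> * \<beta>"
      using a b by (simp add: s_def R_def power3_eq_cube power2_eq_square field_simps)
    ultimately show ?thesis by (simp add: riesz_const_def algebra_simps)
  qed
  finally show ?thesis .
qed

text \<open>Let \<open>P\<close> be the potential. Testing against \<open>G\<^sup>3\<close>, where \<open>G\<close> is a truncation of \<open>P\<close>, the double
  integral is split according to whether \<open>F y \<le> \<mu> * G x\<close>; on either part the smaller density is
  bounded by the larger one, so that the previous lemma applies and no maximal function is needed.\<close>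

theorem hardy_littlewood_sobolev:
  fixes F :: "real \<times> real \<Rightarrow> real"
  assumes [measurable]: "F \<in> borel_measurable borel" and F0: "\<And>y. 0 \<le> F y"
    and A: "(\<integral>\<^sup>+y. ennreal (F y ^ 4) \<partial>lborel) \<le> ennreal (\<beta>\<^sup>2)" and b: "\<beta> > 0"
  shows "(\<integral>\<^sup>+x. (\<integral>\<^sup>+y. ennreal (F y ^ 3 / norm (x - y)) \<partial>lborel) ^ 4 \<partial>lborel)
           \<le> ennreal (16 * riesz_const ^ 4 * \<beta> ^ 6)"
proof -
  define P where "P = (\<lambda>x. \<integral>\<^sup>+y. ennreal (F y ^ 3 / norm (x - y)) \<partial>lborel)"
  \<comment> \<open>Truncation in height and in radius makes the integral of \<open>G n ^ 4\<close>
    finite, so that half of it can be absorbed below; the resulting bound does not depend on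
    \<open>n\<close>.\<close>
  define G where "G = (\<lambda>n x. enn2real (min (P x) (of_nat n)) * indicator (cball 0 (real n)) x)"
  let ?C = riesz_const
  have [measurable]: "P \<in> borel_measurable borel" unfolding P_def by measurable
  have [measurable]: "G n \<in> borel_measurable borel" for n unfolding G_def by (intro borel_measurable_times borel_measurable_indicator) auto
  have G0: "0 \<le> G n x" for n x by (simp add: G_def)
  have GP: "ennreal (G n x) = min (P x) (of_nat n) * indicator (cball 0 (real n)) x" for n x
  proof -
    have "min (P x) (of_nat n) < top" by (simp add: min_less_iff_disj of_nat_less_top)
    then show ?thesis by (auto simp: G_def ennreal_mult ennreal_indicator split: split_indicator)
  qed
  have Gn: "G n x \<le> real n * indicator (cball 0 (real n)) x" for n x
  proof -
    have "enn2real (min (P x) (of_nat n)) \<le> real n"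
      by (rule enn2real_leI) (auto simp: ennreal_of_nat_eq_real_of_nat)
    then show ?thesis by (auto simp: G_def split: split_indicator)
  qed
  have main: "(\<integral>\<^sup>+x. ennreal (G n x ^ 4) \<partial>lborel) \<le> ennreal (16 * ?C ^ 4 * \<beta> ^ 6)" for n
  proof -
    let ?X = "\<integral>\<^sup>+x. ennreal (G n x ^ 4) \<partial>lborel"
    have "?X \<le> (\<integral>\<^sup>+x. ennreal (real n ^ 4) * indicator (cball 0 (real n)) x \<partial>(lborel::(real\<times>real) measure))"
    proof (rule nn_integral_mono)
      fix x :: "real \<times> real"
      have "G n x ^ 4 \<le> (real n * indicator (cball 0 (real n)) x) ^ 4"
        by (intro power_mono Gn G0)
      then show "ennreal (G n x ^ 4) \<le> ennreal (real n ^ 4) * indicator (cball 0 (real n)) x"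
        by (auto split: split_indicator simp: ennreal_leI)
    qed
    also have "\<dots> = ennreal (real n ^ 4) * emeasure lborel (cball (0::real\<times>real) (real n))"
      by (subst nn_integral_cmult_indicator) auto
    also have "\<dots> < \<infinity>"
      using emeasure_lborel_cball_finite[of "0::real\<times>real" "real n"] by (simp add: ennreal_mult_less_top)
    finally have "?X < \<infinity>" .
    then obtain X where X: "?X = ennreal X" "X \<ge> 0" by (cases ?X) auto
    show ?thesis
    proof (cases "X = 0")
      case True
      then show ?thesis using X by simp
    next
      case False
      define \<xi> where "\<xi> = sqrt X"
      have xi: "\<xi> > 0" "X = \<xi>\<^sup>2" using False X by (auto simp: \<xi>_def)
      \<comment> \<open>The part with \<open>F y \<le> \<mu> * G n x\<close> contributes
        \<open>riesz_const * \<mu> * \<beta> * X\<close>, which for this \<open>\<mu>\<close> is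
        exactly \<open>X / 2\<close>.\<close>
      define \<mu> where "\<mu> = 1 / (2 * ?C * \<beta>)"
      have mu: "\<mu> > 0" using b riesz_const_pos by (simp add: \<mu>_def)
      let ?k = "\<lambda>x y. ennreal (G n x ^ 3) * ennreal (F y ^ 3 / norm (x - y))"
      let ?k1 = "\<lambda>x y. ennreal (G n x ^ 3) * (ennreal (F y ^ 3 / norm (x - y)) * indicator {y. F y \<le> \<mu> * G n x} y)"
      let ?k2 = "\<lambda>x y. ennreal (F y ^ 3) * (ennreal (G n x ^ 3 / norm (y - x)) * indicator {x. G n x \<le> F y / \<mu>} x)"
      have "?X \<le> (\<integral>\<^sup>+x. ennreal (G n x ^ 3) * P x \<partial>lborel)"
      proof (rule nn_integral_mono)
        fix x
        have "ennreal (G n x ^ 4) = ennreal (G n x ^ 3) * ennreal (G n x)"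
          using G0 by (simp add: ennreal_mult[symmetric] power4_eq_xxxx power3_eq_cube mult.assoc)
        also have "\<dots> \<le> ennreal (G n x ^ 3) * P x"
          by (intro mult_left_mono) (auto simp: GP split: split_indicator)
        finally show "ennreal (G n x ^ 4) \<le> ennreal (G n x ^ 3) * P x" .
      qed
      also have "\<dots> = (\<integral>\<^sup>+x. \<integral>\<^sup>+y. ?k x y \<partial>lborel \<partial>lborel)"
        unfolding P_def by (simp add: nn_integral_cmult)
      also have "\<dots> \<le> (\<integral>\<^sup>+x. \<integral>\<^sup>+y. ?k1 x y + ?k2 x y \<partial>lborel \<partial>lborel)"
      proof (intro nn_integral_mono)
        fix x y
        show "?k x y \<le> ?k1 x y + ?k2 x y"
        proof (cases "F y \<le> \<mu> * G n x")
          case True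
          then show ?thesis by simp
        next
          case False
          then have "G n x \<le> F y / \<mu>" using mu by (simp add: field_simps)
          moreover have "?k x y = ennreal (F y ^ 3) * ennreal (G n x ^ 3 / norm (y - x))"
            using G0 F0 by (simp add: ennreal_mult[symmetric] norm_minus_commute)
          ultimately show ?thesis by simp
        qed
      qed
      also have "\<dots> = (\<integral>\<^sup>+x. \<integral>\<^sup>+y. ?k1 x y \<partial>lborel \<partial>lborel) + (\<integral>\<^sup>+x. \<integral>\<^sup>+y. ?k2 x y \<partial>lborel \<partial>lborel)"
        by (simp add: nn_integral_add)
      also have "(\<integral>\<^sup>+x. \<integral>\<^sup>+y. ?k2 x y \<partial>lborel \<partial>lborel) = (\<integral>\<^sup>+y. \<integral>\<^sup>+x. ?k2 x y \<partial>lborel \<partial>lborel)"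
        by (rule lborel_pair.Fubini') measurable
      also have "(\<integral>\<^sup>+x. \<integral>\<^sup>+y. ?k1 x y \<partial>lborel \<partial>lborel) \<le> (\<integral>\<^sup>+x. ennreal (?C * \<mu> * \<beta>) * ennreal (G n x ^ 4) \<partial>lborel)"
      proof (intro nn_integral_mono)
        fix x
        have "(\<integral>\<^sup>+y. ?k1 x y \<partial>lborel) \<le> ennreal (G n x ^ 3) * ennreal (?C * (\<mu> * G n x) * \<beta>)"
          using riesz_potential_sublevel[OF assms(1) F0 A b, of "\<mu> * G n x" x] mu G0
          by (subst nn_integral_cmult) (auto intro!: mult_left_mono)
        also have "\<dots> = ennreal (?C * \<mu> * \<beta>) * ennreal (G n x ^ 4)"
          using G0 mu b riesz_const_pos
          by (simp add: ennreal_mult[symmetric] power4_eq_xxxx power3_eq_cube mult_ac)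
        finally show "(\<integral>\<^sup>+y. ?k1 x y \<partial>lborel) \<le> ennreal (?C * \<mu> * \<beta>) * ennreal (G n x ^ 4)" .
      qed
      \<comment> \<open>Here the roles are exchanged: for fixed \<open>y\<close> the inner integral
        is the potential of \<open>G n ^ 3\<close> over a sublevel set of \<open>G n\<close>, with
        \<open>\<xi>\<close> in the place of \<open>\<beta>\<close>.\<close>
      also have "(\<integral>\<^sup>+y. \<integral>\<^sup>+x. ?k2 x y \<partial>lborel \<partial>lborel) \<le> (\<integral>\<^sup>+y. ennreal (?C / \<mu> * \<xi>) * ennreal (F y ^ 4) \<partial>lborel)"
      proof (intro nn_integral_mono)
        fix y
        have "(\<integral>\<^sup>+x. ?k2 x y \<partial>lborel) \<le> ennreal (F y ^ 3) * ennreal (?C * (F y / \<mu>) * \<xi>)"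
          using riesz_potential_sublevel[of "G n" \<xi> "F y / \<mu>" y] mu G0 F0 X xi
          by (subst nn_integral_cmult) (auto intro!: mult_left_mono)
        also have "\<dots> = ennreal (?C / \<mu> * \<xi>) * ennreal (F y ^ 4)"
          using F0 mu xi riesz_const_pos
          by (simp add: ennreal_mult[symmetric] power4_eq_xxxx power3_eq_cube mult_ac)
        finally show "(\<integral>\<^sup>+x. ?k2 x y \<partial>lborel) \<le> ennreal (?C / \<mu> * \<xi>) * ennreal (F y ^ 4)" .
      qed
      also have "(\<integral>\<^sup>+x. ennreal (?C * \<mu> * \<beta>) * ennreal (G n x ^ 4) \<partial>lborel) + (\<integral>\<^sup>+y. ennreal (?C / \<mu> * \<xi>) * ennreal (F y ^ 4) \<partial>lborel)
          = ennreal (?C * \<mu> * \<beta>) * ennreal X + ennreal (?C / \<mu> * \<xi>) * (\<integral>\<^sup>+y. ennreal (F y ^ 4) \<partial>lborel)"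
        using X by (simp add: nn_integral_cmult)
      also have "\<dots> \<le> ennreal (?C * \<mu> * \<beta>) * ennreal X + ennreal (?C / \<mu> * \<xi>) * ennreal (\<beta>\<^sup>2)"
        by (intro add_mono mult_left_mono A) auto
      also have "\<dots> = ennreal (?C * \<mu> * \<beta> * X + ?C / \<mu> * \<xi> * \<beta>\<^sup>2)"
        using mu b X xi riesz_const_pos by (simp add: ennreal_mult[symmetric] ennreal_plus[symmetric] del: ennreal_plus)
      finally have "ennreal X \<le> ennreal (?C * \<mu> * \<beta> * X + ?C / \<mu> * \<xi> * \<beta>\<^sup>2)" using X by simp
      moreover have "0 \<le> ?C * \<mu> * \<beta> * X + ?C / \<mu> * \<xi> * \<beta>\<^sup>2"
        using mu b X xi riesz_const_pos by simp
      ultimately have "X \<le> ?C * \<mu> * \<beta> * X + ?C / \<mu> * \<xi> * \<beta>\<^sup>2"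
        by (simp add: ennreal_le_iff)
      also have "?C * \<mu> * \<beta> = 1 / 2" using b riesz_const_pos by (simp add: \<mu>_def)
      also have "?C / \<mu> * \<xi> * \<beta>\<^sup>2 = 2 * ?C\<^sup>2 * \<beta>^3 * \<xi>"
        by (simp add: \<mu>_def power2_eq_square power3_eq_cube)
      finally have "\<xi> * \<xi> \<le> (4 * ?C\<^sup>2 * \<beta>^3) * \<xi>" using xi(2) by (simp add: power2_eq_square)
      then have "\<xi> \<le> 4 * ?C\<^sup>2 * \<beta>^3" using xi(1) by (simp add: mult_le_cancel_right)
      then have "X \<le> (4 * ?C\<^sup>2 * \<beta>^3)\<^sup>2" unfolding xi(2) using xi(1) by (intro power_mono) auto
      also have "\<dots> = 16 * ?C ^ 4 * \<beta> ^ 6" by (simp add: power_mult_distrib flip: power_mult)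
      finally show ?thesis using X by (simp add: ennreal_leI)
    qed
  qed
  \<comment> \<open>Fatou's lemma passes from the truncations to \<open>P\<close>, whose fourth
    power is not known to be integrable beforehand.\<close>
  have "(\<integral>\<^sup>+x. P x ^ 4 \<partial>lborel) \<le> (\<integral>\<^sup>+x. liminf (\<lambda>n. ennreal (G n x ^ 4)) \<partial>lborel)"
  proof (rule nn_integral_mono)
    fix x
    have "(\<lambda>n. ennreal (G n x)) \<longlonglongrightarrow> P x"
    proof -
      obtain N :: nat where N: "norm x \<le> real N" using real_arch_simple by blast
      have "eventually (\<lambda>n. ennreal (G n x) = min (P x) (of_nat n)) sequentially"
        using eventually_ge_at_top[of N]
      proof eventually_elim
        case (elim n)
        then have "x \<in> cball 0 (real n)" using N by simp
        then show ?case by (simp add: GP)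
      qed
      moreover have "(\<lambda>n. min (P x) (of_nat n)) \<longlonglongrightarrow> min (P x) top"
        by (intro tendsto_min tendsto_const of_nat_tendsto_top_ennreal)
      ultimately show ?thesis by (simp add: filterlim_cong tendsto_cong)
    qed
    then have "(\<lambda>n. ennreal (G n x) ^ 4) \<longlonglongrightarrow> P x ^ 4"
      unfolding power4_eq_xxxx by (intro tendsto_intros) auto
    then show "P x ^ 4 \<le> liminf (\<lambda>n. ennreal (G n x ^ 4))"
      using G0 by (simp add: ennreal_power lim_imp_Liminf)
  qed
  also have "\<dots> \<le> liminf (\<lambda>n. \<integral>\<^sup>+x. ennreal (G n x ^ 4) \<partial>lborel)"
    by (rule nn_integral_liminf) auto
  also have "\<dots> \<le> ennreal (16 * ?C ^ 4 * \<beta> ^ 6)"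
    using main by (intro Liminf_le) auto
  finally show ?thesis unfolding P_def .
qed

subsection \<open>Convolution with compactly supported kernels\<close>

definition Cc :: "('a::euclidean_space \<Rightarrow> real) \<Rightarrow> bool" where
  "Cc \<psi> \<longleftrightarrow> continuous_on UNIV \<psi> \<and> (\<exists>R. \<forall>x. R < norm x \<longrightarrow> \<psi> x = 0)"

definition L2 :: "('a::euclidean_space \<Rightarrow> real) \<Rightarrow> bool" where
  "L2 f \<longleftrightarrow> f \<in> borel_measurable borel \<and> integrable lborel (\<lambda>x. (f x)\<^sup>2)"

text \<open>Differentiability along single lines only, so that partial derivatives of convolutions
  and of tensor products can be treated one direction at a time.\<close>

definition has_dir_deriv :: "'a::euclidean_space \<Rightarrow> ('a \<Rightarrow> real) \<Rightarrow> ('a \<Rightarrow> real) \<Rightarrow> bool" where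
  "has_dir_deriv e f f' \<longleftrightarrow> (\<forall>x. ((\<lambda>s. f (x + s *\<^sub>R e)) has_real_derivative f' x) (at 0))"

text \<open>The kernel is \<open>\<psi> (x - y)\<close> and not \<open>\<psi> (y - x)\<close>: as a function of \<open>x\<close> it is a translate of the test
  function \<open>\<psi>\<close>. Derivatives in \<open>y\<close> therefore come with a minus sign.\<close>

definition mollify :: "('a::euclidean_space \<Rightarrow> real) \<Rightarrow> ('a \<Rightarrow> real) \<Rightarrow> 'a \<Rightarrow> real" where
  "mollify \<psi> f y = (LBINT x. \<psi> (x - y) * f x)"

lemma Cc_measurable: "Cc \<psi> \<Longrightarrow> \<psi> \<in> borel_measurable borel"
  by (auto simp: Cc_def intro: borel_measurable_continuous_onI)

lemma L2_measurable: "L2 f \<Longrightarrow> f \<in> borel_measurable borel"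
  by (simp add: L2_def)

lemma L2_integrable: "L2 f \<Longrightarrow> integrable lborel (\<lambda>x. (f x)\<^sup>2)"
  by (simp add: L2_def)

lemma CcE:
  assumes "Cc \<psi>"
  obtains R M where "\<And>x. R < norm x \<Longrightarrow> \<psi> x = 0" "\<And>x. \<bar>\<psi> x\<bar> \<le> M" "R \<ge> 0" "M \<ge> 0"
proof -
  obtain R where R: "\<And>x. R < norm x \<Longrightarrow> \<psi> x = 0" and c: "continuous_on UNIV \<psi>"
    using assms by (auto simp: Cc_def)
  have "compact (\<psi> ` cball 0 R)"
    by (intro compact_continuous_image continuous_on_subset[OF c]) auto
  then obtain M where M: "\<And>x. x \<in> cball 0 R \<Longrightarrow> \<bar>\<psi> x\<bar> \<le> M"
    by (metis (no_types, lifting) bounded_iff compact_imp_bounded imageI real_norm_def)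
  show ?thesis
  proof (rule that[of "max R 0" "max M 0"])
    fix x show "\<bar>\<psi> x\<bar> \<le> max M 0"
      using M[of x] R[of x] by (cases "norm x \<le> R") auto
  qed (use R in auto)
qed

lemma Cc_integrable:
  assumes "Cc \<psi>" shows "integrable lborel \<psi>"
proof -
  obtain R M where R: "\<And>x. R < norm x \<Longrightarrow> \<psi> x = 0" using CcE[OF assms] by metis
  have "integrable lborel (\<lambda>x. indicator (cball 0 R) x *\<^sub>R \<psi> x)"
    using assms by (intro borel_integrable_compact) (auto simp: Cc_def intro: continuous_on_subset)
  also have "(\<lambda>x. indicator (cball 0 R) x *\<^sub>R \<psi> x) = \<psi>"
    using R by (force split: split_indicator)
  finally show ?thesis .
qed

lemma Cc_abs: "Cc \<psi> \<Longrightarrow> Cc (\<lambda>x. \<bar>\<psi> x\<bar>)"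
  unfolding Cc_def by (auto intro!: continuous_intros)

lemma Cc_power2: "Cc \<psi> \<Longrightarrow> Cc (\<lambda>x. (\<psi> x)\<^sup>2)"
  unfolding Cc_def by (auto intro!: continuous_intros)

lemma Cc_shift:
  assumes "Cc \<psi>" shows "Cc (\<lambda>x. \<psi> (x - y))"
proof -
  obtain R where R: "\<And>x. R < norm x \<Longrightarrow> \<psi> x = 0" and c: "continuous_on UNIV \<psi>"
    using assms by (auto simp: Cc_def)
  have "\<psi> (x - y) = 0" if "R + norm y < norm x" for x
    using norm_triangle_ineq2[of x y] that by (intro R) linarith
  moreover have "continuous_on UNIV (\<lambda>x. \<psi> (x - y))"
    by (rule continuous_on_compose2[OF c]) (auto intro!: continuous_intros)
  ultimately show ?thesis unfolding Cc_def by blast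
qed

lemma Cc_L2: "Cc \<psi> \<Longrightarrow> L2 \<psi>"
  unfolding L2_def by (simp add: Cc_measurable Cc_integrable Cc_power2)

lemma L2_mult_integrable:
  assumes "L2 f" "L2 g" shows "integrable lborel (\<lambda>x. f x * g x)"
proof (rule Bochner_Integration.integrable_bound)
  show "integrable lborel (\<lambda>x. (f x)\<^sup>2 + (g x)\<^sup>2)" using assms by (simp add: L2_def)
  show "(\<lambda>x. f x * g x) \<in> borel_measurable lborel" using assms by (auto simp: L2_def)
  have "\<bar>f x * g x\<bar> \<le> (f x)\<^sup>2 + (g x)\<^sup>2" for x
    using sum_squares_bound[of "\<bar>f x\<bar>" "\<bar>g x\<bar>"] abs_ge_zero[of "f x * g x"] unfolding abs_mult power2_abs by linarith
  then show "AE x in lborel. norm (f x * g x) \<le> norm ((f x)\<^sup>2 + (g x)\<^sup>2)" by simp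
qed

lemma L2_add:
  assumes "L2 f" "L2 g" shows "L2 (\<lambda>x. f x + g x)"
proof -
  have "integrable lborel (\<lambda>x. (f x)\<^sup>2 + (g x)\<^sup>2 + 2 * (f x * g x))"
    using assms L2_mult_integrable[OF assms] by (simp add: L2_def)
  then show ?thesis using assms by (auto simp: L2_def power2_sum mult.assoc)
qed

lemma L2_cmult: "L2 f \<Longrightarrow> L2 (\<lambda>x. c * f x)"
  by (auto simp: L2_def power_mult_distrib)

lemma L2_indicator_cball: "L2 (\<lambda>x. M * indicator (cball y r) x)"
proof -
  have "integrable lborel (\<lambda>x. M\<^sup>2 * indicator (cball y r) x)"
    using emeasure_lborel_cball_finite[of y r] by (intro integrable_mult_right integrable_real_indicator) auto
  also have "(\<lambda>x. M\<^sup>2 * indicator (cball y r) x) = (\<lambda>x. (M * indicator (cball y r) x)\<^sup>2)"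
    by (auto split: split_indicator)
  finally show ?thesis by (auto simp: L2_def intro!: borel_measurable_times borel_measurable_indicator)
qed

lemma mollify_integrable: "Cc \<psi> \<Longrightarrow> L2 f \<Longrightarrow> integrable lborel (\<lambda>x. \<psi> (x - y) * f x)"
  by (rule L2_mult_integrable[OF Cc_L2[OF Cc_shift]])

lemma nn_integral_L2: "L2 f \<Longrightarrow> (\<integral>\<^sup>+x. ennreal ((f x)\<^sup>2) \<partial>lborel) = ennreal (LBINT x. (f x)\<^sup>2)"
  by (intro nn_integral_eq_integral) (auto simp: L2_def)

lemma abs_integral_mult_le:
  assumes "L2 f" "L2 g"
  shows "\<bar>LBINT x. f x * g x\<bar> \<le> (LBINT x. (f x)\<^sup>2) + (LBINT x. (g x)\<^sup>2)"
proof -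
  have "\<bar>f x * g x\<bar> \<le> (f x)\<^sup>2 + (g x)\<^sup>2" for x
    using sum_squares_bound[of "\<bar>f x\<bar>" "\<bar>g x\<bar>"] abs_ge_zero[of "f x * g x"] unfolding abs_mult power2_abs by linarith
  then have "norm (LBINT x. f x * g x) \<le> (LBINT x. (f x)\<^sup>2 + (g x)\<^sup>2)"
    using assms L2_mult_integrable[OF assms]
    by (intro Bochner_Integration.integral_norm_bound_integral) (auto simp: L2_def)
  then show ?thesis using assms by (simp add: L2_def)
qed

lemma integral_lborel_translate:
  fixes f :: "'a::euclidean_space \<Rightarrow> real"
  assumes "f \<in> borel_measurable borel"
  shows "(LBINT x. f (x + c)) = (LBINT x. f x)"
proof -
  have "(LBINT x. f x) = (\<integral>x. f x \<partial>distr lborel borel ((+) c))"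
    by (simp add: lborel_distr_plus)
  also have "\<dots> = (LBINT x. f (c + x))"
    by (rule integral_distr) (use assms in auto)
  finally show ?thesis by (simp add: add.commute)
qed

lemma integrable_lborel_translate:
  fixes f :: "'a::euclidean_space \<Rightarrow> real"
  assumes "integrable lborel f"
  shows "integrable lborel (\<lambda>x. f (x + c))"
proof -
  have "integrable (distr lborel borel ((+) c)) f"
    using assms by (simp add: lborel_distr_plus)
  then show ?thesis
    by (subst (asm) integrable_distr_eq) (use assms in \<open>auto simp: add.commute\<close>)
qed

text \<open>The bound is a sum of squares and not a product of norms: applied at each time, it is
  linear in the integral of the square of \<open>f\<close> and can be integrated over a bounded time
  interval directly.\<close>

lemma mollify_abs_le:
  assumes "Cc \<psi>" "L2 f"
  shows "\<bar>mollify \<psi> f y\<bar> \<le> (LBINT x. (\<psi> x)\<^sup>2) + (LBINT x. (f x)\<^sup>2)"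
proof -
  have [measurable]: "\<psi> \<in> borel_measurable borel" by (rule Cc_measurable[OF assms(1)])
  have "(LBINT x. (\<psi> (x - y))\<^sup>2) = (LBINT x. (\<psi> x)\<^sup>2)"
    using integral_lborel_translate[of "\<lambda>x. (\<psi> x)\<^sup>2" "-y"] by simp
  then show ?thesis
    using abs_integral_mult_le[OF Cc_L2[OF Cc_shift[OF assms(1)]] assms(2), of y] by (simp add: mollify_def)
qed

lemma has_dir_derivD:
  assumes "has_dir_deriv e f f'"
  shows "((\<lambda>s. f (x + s *\<^sub>R e)) has_real_derivative f' (x + t *\<^sub>R e)) (at t)"
proof -
  have "((\<lambda>s. f ((x + t *\<^sub>R e) + s *\<^sub>R e)) has_real_derivative f' (x + t *\<^sub>R e)) (at 0)"
    using assms by (simp add: has_dir_deriv_def)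
  then have "((\<lambda>s. f ((x + t *\<^sub>R e) + (s - t) *\<^sub>R e)) has_real_derivative f' (x + t *\<^sub>R e)) (at t)"
    using DERIV_shift[of "\<lambda>s. f ((x + t *\<^sub>R e) + (s - t) *\<^sub>R e)" "f' (x + t *\<^sub>R e)" 0 t] by (simp add: add.commute)
  then show ?thesis by (simp add: algebra_simps)
qed

lemma has_dir_deriv_mult:
  assumes "has_dir_deriv e f f'" "has_dir_deriv e g g'"
  shows "has_dir_deriv e (\<lambda>x. f x * g x) (\<lambda>x. f' x * g x + f x * g' x)"
  unfolding has_dir_deriv_def
proof
  fix x
  have "((\<lambda>s. f (x + s *\<^sub>R e) * g (x + s *\<^sub>R e)) has_real_derivative f' x * g (x + 0 *\<^sub>R e) + g' x * f (x + 0 *\<^sub>R e)) (at 0)"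
    using assms by (intro DERIV_mult) (auto simp: has_dir_deriv_def)
  then show "((\<lambda>s. f (x + s *\<^sub>R e) * g (x + s *\<^sub>R e)) has_real_derivative f' x * g x + f x * g' x) (at 0)"
    by (simp add: mult.commute)
qed

lemma has_dir_deriv_lipschitz:
  assumes "has_dir_deriv e f f'" and "\<And>x. \<bar>f' x\<bar> \<le> M"
  shows "\<bar>f (x + h *\<^sub>R e) - f x\<bar> \<le> M * \<bar>h\<bar>"
proof -
  have "norm (f (x + h *\<^sub>R e) - f (x + 0 *\<^sub>R e)) \<le> M * norm (h - 0)"
    by (rule field_differentiable_bound[where S=UNIV and f'="\<lambda>t. f' (x + t *\<^sub>R e)"]) (use assms has_dir_derivD in auto)
  then show ?thesis by simp
qed

text \<open>By the mean value theorem the difference quotients of the kernel are bounded by the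
  supremum of \<open>\<psi>'\<close>, and for short steps they are supported in one ball; dominated
  convergence then differentiates under the integral.\<close>

lemma has_dir_deriv_mollify:
  assumes psi: "Cc \<psi>" "Cc \<psi>'" "has_dir_deriv e \<psi> \<psi>'" and f: "L2 f"
  shows "has_dir_deriv e (mollify \<psi> f) (\<lambda>y. - mollify \<psi>' f y)"
  unfolding has_dir_deriv_def
proof
  fix y :: 'a
  note [measurable] = Cc_measurable[OF psi(1)] Cc_measurable[OF psi(2)] L2_measurable[OF f]
  obtain R M where R: "\<And>x. R < norm x \<Longrightarrow> \<psi> x = 0" "R \<ge> 0" using CcE[OF psi(1)] by metis
  obtain M where M: "\<And>x. \<bar>\<psi>' x\<bar> \<le> M" "M \<ge> 0" using CcE[OF psi(2)] by metis
  let ?B = "cball y (R + norm e)"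
  have "((\<lambda>h. (mollify \<psi> f (y + h *\<^sub>R e) - mollify \<psi> f y) / h) \<longlongrightarrow> - mollify \<psi>' f y) (at 0)"
  proof (unfold tendsto_at_iff_sequentially, intro allI impI)
    fix X :: "nat \<Rightarrow> real"
    assume X: "\<forall>i. X i \<in> UNIV - {0}" "X \<longlonglongrightarrow> 0"
    \<comment> \<open>Steps shorter than 1 keep the supports of all shifted kernels inside
      \<open>?B\<close>.\<close>
    obtain N where N: "\<And>n. n \<ge> N \<Longrightarrow> \<bar>X n\<bar> < 1"
      using LIMSEQ_D[OF X(2), of 1] by auto
    define Y where "Y n = X (n + N)" for n
    have Y: "Y n \<noteq> 0" "\<bar>Y n\<bar> < 1" for n using X(1) N[of "n+N"] by (auto simp: Y_def)
    have Y0: "Y \<longlonglongrightarrow> 0" unfolding Y_def by (rule LIMSEQ_ignore_initial_segment[OF X(2)])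
    let ?s = "\<lambda>n x. (\<psi> (x - (y + Y n *\<^sub>R e)) - \<psi> (x - y)) / Y n * f x"
    have eq: "(mollify \<psi> f (y + Y n *\<^sub>R e) - mollify \<psi> f y) / Y n = (LBINT x. ?s n x)" for n
      unfolding mollify_def
      by (subst Bochner_Integration.integral_diff[symmetric])
         (auto intro!: mollify_integrable psi f Bochner_Integration.integral_cong
           simp: left_diff_distrib diff_divide_distrib simp flip: integral_divide_zero)
    have "(\<lambda>n. LBINT x. ?s n x) \<longlonglongrightarrow> (LBINT x. - \<psi>' (x - y) * f x)"
    proof (rule integral_dominated_convergence)
      show "integrable lborel (\<lambda>x. (M * indicator ?B x) * \<bar>f x\<bar>)"
        using f by (intro L2_mult_integrable L2_indicator_cball) (auto simp: L2_def)
      show "AE x in lborel. (\<lambda>n. ?s n x) \<longlonglongrightarrow> - \<psi>' (x - y) * f x"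
      proof (rule AE_I2)
        fix x
        have "((\<lambda>s. \<psi> (x - y + s *\<^sub>R e)) has_real_derivative \<psi>' (x - y)) (at 0)"
          using psi(3) by (simp add: has_dir_deriv_def)
        then have "((\<lambda>h. (\<psi> (x - y + h *\<^sub>R e) - \<psi> (x - y)) / h) \<longlongrightarrow> \<psi>' (x - y)) (at 0)"
          by (simp add: has_field_derivative_iff)
        \<comment> \<open>Moving \<open>y\<close> by \<open>h\<close> moves the argument of the
          kernel by \<open>-h\<close>, hence the quotients along \<open>- Y n\<close>.\<close>
        then have l: "(\<lambda>n. (\<psi> (x - y + (- Y n) *\<^sub>R e) - \<psi> (x - y)) / (- Y n)) \<longlonglongrightarrow> \<psi>' (x - y)"
          unfolding tendsto_at_iff_sequentially comp_def
          using Y by (elim allE[of _ "\<lambda>n. - Y n"] impE) (auto intro: tendsto_eq_intros Y0)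
        have "(\<lambda>n. - ((\<psi> (x - y + (- Y n) *\<^sub>R e) - \<psi> (x - y)) / (- Y n)) * f x) \<longlonglongrightarrow> - \<psi>' (x - y) * f x"
          by (intro tendsto_intros l)
        then show "(\<lambda>n. ?s n x) \<longlonglongrightarrow> - \<psi>' (x - y) * f x" by (simp add: algebra_simps)
      qed
      fix n
      show "AE x in lborel. norm (?s n x) \<le> (M * indicator ?B x) * \<bar>f x\<bar>"
      proof (rule AE_I2)
        fix x
        have "\<bar>\<psi> (x - (y + Y n *\<^sub>R e)) - \<psi> (x - y)\<bar> \<le> M * indicator ?B x * \<bar>Y n\<bar>"
        proof (cases "x \<in> ?B")
          case True
          then show ?thesis using has_dir_deriv_lipschitz[OF psi(3) M(1), of "x - y" "- Y n"] by (simp add: algebra_simps)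
        next
          case False
          then have d: "norm (x - y) > R + norm e" by (simp add: dist_norm norm_minus_commute)
          have "norm (Y n *\<^sub>R e) \<le> norm e" using Y(2)[of n] by (simp add: mult_left_le_one_le)
          then have "norm (x - y - Y n *\<^sub>R e) > R"
            using d norm_triangle_ineq2[of "x - y" "Y n *\<^sub>R e"] by linarith
          then have "\<psi> (x - (y + Y n *\<^sub>R e)) = 0" using R by (simp add: diff_diff_eq)
          moreover have "\<psi> (x - y) = 0" by (rule R(1)) (use d norm_ge_zero[of e] in linarith)
          ultimately show ?thesis using M by simp
        qed
        then have "\<bar>(\<psi> (x - (y + Y n *\<^sub>R e)) - \<psi> (x - y)) / Y n\<bar> \<le> M * indicator ?B x"
          using Y(1)[of n] by (simp add: field_simps)
        then show "norm (?s n x) \<le> (M * indicator ?B x) * \<bar>f x\<bar>"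
          using mult_right_mono[of _ _ "\<bar>f x\<bar>"] by (simp only: real_norm_def abs_mult abs_ge_zero)
      qed
    qed measurable
    also have "(LBINT x. - \<psi>' (x - y) * f x) = - mollify \<psi>' f y"
      by (simp add: mollify_def)
    finally have "(\<lambda>n. (mollify \<psi> f (y + Y n *\<^sub>R e) - mollify \<psi> f y) / Y n) \<longlonglongrightarrow> - mollify \<psi>' f y"
      by (simp add: eq)
    then show "((\<lambda>h. (mollify \<psi> f (y + h *\<^sub>R e) - mollify \<psi> f y) / h) \<circ> X) \<longlonglongrightarrow> - mollify \<psi>' f y"
      unfolding Y_def comp_def by (rule LIMSEQ_offset)
  qed
  then show "((\<lambda>s. mollify \<psi> f (y + s *\<^sub>R e)) has_real_derivative - mollify \<psi>' f y) (at 0)"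
    by (simp add: has_field_derivative_iff)
qed

lemma continuous_mollify:
  assumes psi: "Cc \<psi>" and f: "L2 f"
  shows "continuous_on UNIV (mollify \<psi> f)"
proof (unfold continuous_on_sequentially, intro allI ballI impI)
  fix X :: "nat \<Rightarrow> 'a" and y
  assume "(\<forall>n. X n \<in> UNIV) \<and> X \<longlonglongrightarrow> y"
  then have X: "X \<longlonglongrightarrow> y" by simp
  note [measurable] = Cc_measurable[OF psi(1)] L2_measurable[OF f]
  obtain R M where R: "\<And>x. R < norm x \<Longrightarrow> \<psi> x = 0" and M: "\<And>x. \<bar>\<psi> x\<bar> \<le> M" "M \<ge> 0"
    using CcE[OF psi(1)] by metis
  obtain B where B: "\<And>n. norm (X n) \<le> B"
    using Bseq_def X convergentI convergent_imp_Bseq by metis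
  have "(\<lambda>n. LBINT x. \<psi> (x - X n) * f x) \<longlonglongrightarrow> (LBINT x. \<psi> (x - y) * f x)"
  proof (rule integral_dominated_convergence)
    let ?B = "cball 0 (R + B)"
    show "integrable lborel (\<lambda>x. (M * indicator ?B x) * \<bar>f x\<bar>)"
      using f by (intro L2_mult_integrable L2_indicator_cball) (auto simp: L2_def)
    fix n
    show "AE x in lborel. norm (\<psi> (x - X n) * f x) \<le> (M * indicator ?B x) * \<bar>f x\<bar>"
    proof (rule AE_I2)
      fix x
      have "\<bar>\<psi> (x - X n)\<bar> \<le> M * indicator ?B x"
      proof (cases "x \<in> ?B")
        case False
        then have "norm (x - X n) > R" using B[of n] norm_triangle_ineq2[of x "X n"] by simp
        then show ?thesis using R M by simp
      qed (use M in auto)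
      then show "norm (\<psi> (x - X n) * f x) \<le> (M * indicator ?B x) * \<bar>f x\<bar>"
        by (simp add: abs_mult mult_right_mono)
    qed
  next
    show "AE x in lborel. (\<lambda>n. \<psi> (x - X n) * f x) \<longlonglongrightarrow> \<psi> (x - y) * f x"
    proof (rule AE_I2)
      fix x
      have "isCont \<psi> (x - y)" using psi by (auto simp: Cc_def continuous_on_eq_continuous_at)
      then show "(\<lambda>n. \<psi> (x - X n) * f x) \<longlonglongrightarrow> \<psi> (x - y) * f x"
        by (intro tendsto_mult isCont_tendsto_compose[of "x - y" \<psi>] tendsto_intros X)
    qed
  qed measurable
  then show "(mollify \<psi> f \<circ> X) \<longlonglongrightarrow> mollify \<psi> f y" by (simp add: comp_def mollify_def)
qed

text \<open>Splitting the kernel into two square roots, the Cauchy-Schwarz inequality bounds the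
  squared convolution by the mass of \<open>|\<psi>|\<close> times the convolution of
  \<open>|\<psi>|\<close> with \<open>f^2\<close>, and Tonelli integrates the latter. For a
  nonnegative kernel of mass one this is a contraction.\<close>

lemma young_L2:
  assumes psi: "Cc \<psi>" and f: "L2 f"
  shows "(\<integral>\<^sup>+y. ennreal ((mollify \<psi> f y)\<^sup>2) \<partial>lborel) \<le> ennreal ((LBINT x. \<bar>\<psi> x\<bar>)\<^sup>2 * (LBINT x. (f x)\<^sup>2))"
proof -
  note [measurable] = Cc_measurable[OF psi(1)] L2_measurable[OF f]
  let ?a = "LBINT x. \<bar>\<psi> x\<bar>"
  have nn1: "(\<integral>\<^sup>+x. ennreal \<bar>\<psi> x\<bar> \<partial>lborel) = ennreal ?a"
    by (intro nn_integral_eq_integral Cc_integrable Cc_abs psi) auto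
  have *: "ennreal ((mollify \<psi> f y)\<^sup>2) \<le> ennreal ?a * (\<integral>\<^sup>+x. ennreal (\<bar>\<psi> (x - y)\<bar> * (f x)\<^sup>2) \<partial>lborel)" for y
  proof -
    have "ennreal \<bar>mollify \<psi> f y\<bar> \<le> (\<integral>\<^sup>+x. ennreal \<bar>\<psi> (x - y) * f x\<bar> \<partial>lborel)"
      unfolding mollify_def real_norm_def[symmetric] by (rule integral_norm_bound_ennreal[OF mollify_integrable[OF psi f]])
    also have "\<dots> = (\<integral>\<^sup>+x. ennreal (sqrt \<bar>\<psi> (x - y)\<bar>) * ennreal (sqrt \<bar>\<psi> (x - y)\<bar> * \<bar>f x\<bar>) \<partial>lborel)"
      by (intro nn_integral_cong) (simp add: ennreal_mult[symmetric] abs_mult mult.assoc[symmetric])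
    finally have "ennreal \<bar>mollify \<psi> f y\<bar> ^ 2 \<le> (\<integral>\<^sup>+x. ennreal (sqrt \<bar>\<psi> (x - y)\<bar>) * ennreal (sqrt \<bar>\<psi> (x - y)\<bar> * \<bar>f x\<bar>) \<partial>lborel) ^ 2"
      by (rule power_mono) simp
    also have "\<dots> \<le> (\<integral>\<^sup>+x. ennreal (sqrt \<bar>\<psi> (x - y)\<bar>) ^ 2 \<partial>lborel) * (\<integral>\<^sup>+x. ennreal (sqrt \<bar>\<psi> (x - y)\<bar> * \<bar>f x\<bar>) ^ 2 \<partial>lborel)"
      by (rule Cauchy_Schwarz_nn_integral) auto
    also have "(\<integral>\<^sup>+x. ennreal (sqrt \<bar>\<psi> (x - y)\<bar>) ^ 2 \<partial>lborel) = (\<integral>\<^sup>+x. ennreal \<bar>\<psi> (x - y)\<bar> \<partial>lborel)"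
      by (simp add: ennreal_power)
    also have "\<dots> = ennreal ?a"
      using nn_integral_lborel_translate[of "\<lambda>x. ennreal \<bar>\<psi> x\<bar>" "-y"] nn1 by simp
    also have "(\<integral>\<^sup>+x. ennreal (sqrt \<bar>\<psi> (x - y)\<bar> * \<bar>f x\<bar>) ^ 2 \<partial>lborel) = (\<integral>\<^sup>+x. ennreal (\<bar>\<psi> (x - y)\<bar> * (f x)\<^sup>2) \<partial>lborel)"
      by (simp add: ennreal_power power_mult_distrib)
    finally show ?thesis by (simp add: ennreal_power)
  qed
  have "(\<integral>\<^sup>+y. ennreal ((mollify \<psi> f y)\<^sup>2) \<partial>lborel) \<le> (\<integral>\<^sup>+y. ennreal ?a * (\<integral>\<^sup>+x. ennreal (\<bar>\<psi> (x - y)\<bar> * (f x)\<^sup>2) \<partial>lborel) \<partial>lborel)"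
    by (intro nn_integral_mono *)
  also have "\<dots> = ennreal ?a * (\<integral>\<^sup>+y. \<integral>\<^sup>+x. ennreal (\<bar>\<psi> (x - y)\<bar> * (f x)\<^sup>2) \<partial>lborel \<partial>lborel)"
    by (rule nn_integral_cmult) measurable
  also have "(\<integral>\<^sup>+y. \<integral>\<^sup>+x. ennreal (\<bar>\<psi> (x - y)\<bar> * (f x)\<^sup>2) \<partial>lborel \<partial>lborel) = (\<integral>\<^sup>+x. \<integral>\<^sup>+y. ennreal (\<bar>\<psi> (x - y)\<bar> * (f x)\<^sup>2) \<partial>lborel \<partial>lborel)"
    by (rule lborel_pair.Fubini') measurable
  also have "\<dots> = (\<integral>\<^sup>+x. ennreal ?a * ennreal ((f x)\<^sup>2) \<partial>lborel)"
    using nn_integral_lborel_reflect[of "\<lambda>x. ennreal \<bar>\<psi> x\<bar>"] nn1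
    by (intro nn_integral_cong) (simp add: ennreal_mult nn_integral_multc)
  also have "\<dots> = ennreal ?a * ennreal (LBINT x. (f x)\<^sup>2)"
    using nn_integral_L2[OF f] by (simp add: nn_integral_cmult)
  finally show ?thesis
    by (simp add: ennreal_mult[symmetric] power2_eq_square mult.assoc)
qed

lemma L2_mollify:
  assumes psi: "Cc \<psi>" and f: "L2 f"
  shows "L2 (mollify \<psi> f)"
proof -
  have m: "mollify \<psi> f \<in> borel_measurable borel"
    using continuous_mollify[OF assms] by (rule borel_measurable_continuous_onI)
  have "(\<integral>\<^sup>+y. ennreal (norm ((mollify \<psi> f y)\<^sup>2)) \<partial>lborel) < \<infinity>"
    using young_L2[OF assms] by (auto intro: le_less_trans)
  then show ?thesis unfolding L2_def using m by (auto intro!: integrableI_bounded)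
qed

lemma integral_mollify_sq_le:
  assumes psi: "Cc \<psi>" and f: "L2 f"
  shows "(LBINT y. (mollify \<psi> f y)\<^sup>2) \<le> (LBINT x. \<bar>\<psi> x\<bar>)\<^sup>2 * (LBINT x. (f x)\<^sup>2)"
  using young_L2[OF assms] by (simp add: nn_integral_L2[OF L2_mollify[OF assms]] ennreal_le_iff)

subsection \<open>Integration by parts and the Ladyzhenskaya inequality\<close>

text \<open>By translation invariance \<open>h (x + e) - h x\<close> has integral zero; the fundamental theorem of calculus and
  Fubini turn this into a statement on \<open>h'\<close>.\<close>

lemma integral_has_dir_deriv_zero:
  fixes h :: "'a::euclidean_space \<Rightarrow> real"
  assumes d: "has_dir_deriv e h h'" and c: "continuous_on UNIV h'"
    and i: "integrable lborel h" and i': "integrable lborel h'"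
  shows "(LBINT x. h' x) = 0"
proof -
  have [measurable]: "h' \<in> borel_measurable borel" using i' by simp
  have nn: "integrable lborel (\<lambda>x. \<bar>h' x\<bar>)" using i' by simp
  have ftc: "(LBINT s. h' (x + s *\<^sub>R e) * indicator {0..1} s) = h (x + e) - h x" for x
  proof -
    have "(LBINT s. h' (x + s *\<^sub>R e) * indicator {0..1} s) = h (x + 1 *\<^sub>R e) - h (x + 0 *\<^sub>R e)"
    proof (rule integral_FTC_Icc_real)
      fix s :: real
      have "continuous_on UNIV (\<lambda>s. h' (x + s *\<^sub>R e))"
        by (rule continuous_on_compose2[OF c]) (auto intro!: continuous_intros)
      then show "isCont (\<lambda>s. h' (x + s *\<^sub>R e)) s" by (simp add: continuous_on_eq_continuous_at)
      show "((\<lambda>s. h (x + s *\<^sub>R e)) has_real_derivative h' (x + s *\<^sub>R e)) (at s)" by (rule has_dir_derivD[OF d])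
    qed simp
    then show ?thesis by simp
  qed
  have tr: "(LBINT x. f (x + c)) = (LBINT x. f x)" if "integrable lborel f" for f :: "'a \<Rightarrow> real" and c
    by (rule integral_lborel_translate) (use that in auto)
  let ?g = "\<lambda>s x. h' (x + s *\<^sub>R e) * indicator {0..1::real} s"
  have "integrable (lborel \<Otimes>\<^sub>M lborel) (\<lambda>(s,x). ?g s x)"
  proof (rule lborel_pair.Fubini_integrable)
    have "(\<lambda>s. LBINT x. norm (case (s, x) of (s, x) \<Rightarrow> ?g s x)) = (\<lambda>s. indicator {0..1} s * (LBINT x. \<bar>h' x\<bar>))"
      using tr[OF nn] by (auto simp: abs_mult)
    then show "integrable lborel (\<lambda>s. LBINT x. norm (case (s, x) of (s, x) \<Rightarrow> ?g s x))"
      by simp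
    show "AE s in lborel. integrable lborel (\<lambda>x. case (s, x) of (s, x) \<Rightarrow> ?g s x)"
      using integrable_lborel_translate[OF i'] by simp
  qed measurable
  then have "(LBINT x. LBINT s. ?g s x) = (LBINT s. LBINT x. ?g s x)"
    by (rule lborel_pair.Fubini_integral)
  also have "(LBINT x. LBINT s. ?g s x) = (LBINT x. h (x + e) - h x)"
    by (simp add: ftc)
  also have "\<dots> = 0"
    using tr[OF i, of e] i integrable_lborel_translate[OF i] by simp
  also have "(LBINT s. LBINT x. ?g s x) = (LBINT s. (LBINT x. h' x) * indicator {0..1::real} s)"
    using tr[OF i'] by simp
  finally show ?thesis by simp
qed

text \<open>Differentiation in \<open>y\<close> produces a minus sign on either factor; the two
  agree, so the formula has the familiar shape although the derivatives sit on the kernels.\<close>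

lemma integral_mollify_by_parts:
  fixes f g :: "'a::euclidean_space \<Rightarrow> real"
  assumes psi: "Cc \<psi>" "Cc \<psi>'" "has_dir_deriv e \<psi> \<psi>'" and chi: "Cc \<theta>" "Cc \<theta>'" "has_dir_deriv e \<theta> \<theta>'"
    and f: "L2 f" and g: "L2 g"
  shows "(LBINT y. mollify \<psi>' f y * mollify \<theta> g y) = - (LBINT y. mollify \<psi> f y * mollify \<theta>' g y)"
proof -
  let ?h = "\<lambda>y. mollify \<psi> f y * mollify \<theta> g y"
  let ?h' = "\<lambda>y. - mollify \<psi>' f y * mollify \<theta> g y + mollify \<psi> f y * - mollify \<theta>' g y"
  have i: "integrable lborel (\<lambda>y. mollify \<psi>' f y * mollify \<theta> g y)" "integrable lborel (\<lambda>y. mollify \<psi> f y * mollify \<theta>' g y)"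
    by (intro L2_mult_integrable L2_mollify psi chi f g)+
  have "(LBINT y. ?h' y) = 0"
  proof (rule integral_has_dir_deriv_zero)
    show "has_dir_deriv e ?h ?h'" by (intro has_dir_deriv_mult has_dir_deriv_mollify psi chi f g)
    show "continuous_on UNIV ?h'" by (intro continuous_intros continuous_mollify psi chi f g)
    show "integrable lborel ?h" by (intro L2_mult_integrable L2_mollify psi chi f g)
    show "integrable lborel ?h'" using i by simp
  qed
  then show ?thesis using i by simp
qed

text \<open>Integrability of \<open>f\<close> stands in for decay at infinity: were the total
  variation smaller than \<open>|f x|\<close>, then \<open>|f|\<close> would stay above a positive
  constant on the whole line and could not be integrable.\<close>

lemma abs_le_nn_integral_deriv:
  fixes f f' :: "real \<Rightarrow> real"
  assumes d: "\<And>x. (f has_real_derivative f' x) (at x)" and c: "continuous_on UNIV f'"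
    and fin: "(\<integral>\<^sup>+x. ennreal \<bar>f x\<bar> \<partial>lborel) < \<infinity>"
  shows "ennreal \<bar>f x\<bar> \<le> (\<integral>\<^sup>+x. ennreal \<bar>f' x\<bar> \<partial>lborel)"
proof (rule ccontr)
  assume "\<not> ?thesis"
  then have lt: "(\<integral>\<^sup>+x. ennreal \<bar>f' x\<bar> \<partial>lborel) < ennreal \<bar>f x\<bar>" by simp
  have [measurable]: "f' \<in> borel_measurable borel" using c by (rule borel_measurable_continuous_onI)
  have int: "integrable lborel f'"
    using lt by (intro integrableI_bounded) (auto intro: less_trans)
  define I where "I = (LBINT x. \<bar>f' x\<bar>)"
  have "(\<integral>\<^sup>+x. ennreal \<bar>f' x\<bar> \<partial>lborel) = ennreal I"
    unfolding I_def using int by (intro nn_integral_eq_integral) auto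
  with lt have I: "I < \<bar>f x\<bar>" by (simp add: ennreal_less_iff I_def)
  have diff: "\<bar>f b - f a\<bar> \<le> I" if "a \<le> b" for a b
  proof -
    have "f b - f a = (LBINT x. f' x * indicator {a..b} x)"
      using integral_FTC_Icc_real[of a b f f'] that d c by (simp add: continuous_on_eq_continuous_at)
    also have "norm \<dots> \<le> I"
      unfolding I_def
    proof (rule Bochner_Integration.integral_norm_bound_integral)
      show "integrable lborel (\<lambda>x. f' x * indicator {a..b} x)"
        using int integrable_mult_indicator[of "{a..b}" lborel f'] by (simp add: mult.commute)
    qed (use int in \<open>auto split: split_indicator\<close>)
    finally show ?thesis by simp
  qed
  have "\<bar>f x\<bar> - I \<le> \<bar>f y\<bar>" for y
    using diff[of x y] diff[of y x] by (cases "x \<le> y") auto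
  then have "(\<integral>\<^sup>+y. ennreal (\<bar>f x\<bar> - I) \<partial>(lborel::real measure)) \<le> (\<integral>\<^sup>+y. ennreal \<bar>f y\<bar> \<partial>lborel)"
    by (intro nn_integral_mono ennreal_leI)
  moreover have "(\<integral>\<^sup>+y. ennreal (\<bar>f x\<bar> - I) \<partial>(lborel::real measure)) = \<infinity>"
    using I by (simp add: ennreal_mult_top)
  ultimately show False using fin by auto
qed

text \<open>The derivative of \<open>f^2\<close> along a coordinate line is
  \<open>2 * f * D1\<close> or \<open>2 * f * D2\<close>, so \<open>f^2\<close> is at most
  \<open>A b\<close> on a horizontal line and at most \<open>B a\<close> on a vertical one. In
  \<open>f^4 \<le> B a * A b\<close> each factor depends on one variable only, and the double
  integral factorises.\<close>

lemma ladyzhenskaya_nn: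
  fixes f :: "real \<times> real \<Rightarrow> real"
  assumes f: "L2 f" "continuous_on UNIV f"
    and d1: "has_dir_deriv (1,0) f D1" "continuous_on UNIV D1" and d2: "has_dir_deriv (0,1) f D2" "continuous_on UNIV D2"
  shows "(\<integral>\<^sup>+x. ennreal (f x ^ 4) \<partial>lborel) \<le>
    (\<integral>\<^sup>+x. ennreal (2 * \<bar>f x * D1 x\<bar>) \<partial>lborel) * (\<integral>\<^sup>+x. ennreal (2 * \<bar>f x * D2 x\<bar>) \<partial>lborel)"
proof -
  have [measurable]: "f \<in> borel_measurable (borel \<Otimes>\<^sub>M borel)" "D1 \<in> borel_measurable (borel \<Otimes>\<^sub>M borel)" "D2 \<in> borel_measurable (borel \<Otimes>\<^sub>M borel)"
    using f(2) d1(2) d2(2) by (auto simp: borel_prod intro: borel_measurable_continuous_onI)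
  define A where "A b = (\<integral>\<^sup>+a. ennreal \<bar>2 * f (a,b) * D1 (a,b)\<bar> \<partial>lborel)" for b
  define B where "B a = (\<integral>\<^sup>+b. ennreal \<bar>2 * f (a,b) * D2 (a,b)\<bar> \<partial>lborel)" for a
  have [measurable]: "A \<in> borel_measurable borel" "B \<in> borel_measurable borel"
    unfolding A_def B_def by measurable
  have "(\<integral>\<^sup>+x. ennreal ((f x)\<^sup>2) \<partial>(lborel \<Otimes>\<^sub>M lborel)) < \<infinity>"
    using nn_integral_L2[OF f(1)] by (simp add: lborel_prod)
  then have fin1: "(\<integral>\<^sup>+b. \<integral>\<^sup>+a. ennreal ((f (a,b))\<^sup>2) \<partial>lborel \<partial>lborel) < \<infinity>"
    and fin2: "(\<integral>\<^sup>+a. \<integral>\<^sup>+b. ennreal ((f (a,b))\<^sup>2) \<partial>lborel \<partial>lborel) < \<infinity>"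
    by (subst lborel_pair.nn_integral_snd lborel.nn_integral_fst; simp)+
  have ca: "continuous_on UNIV (\<lambda>a. g (a,b))" and cb: "continuous_on UNIV (\<lambda>b. g (c,b))"
    if "continuous_on UNIV g" for g :: "real \<times> real \<Rightarrow> real" and b c
    by (rule continuous_on_compose2[OF that], auto intro!: continuous_intros)+
  \<comment> \<open>The one-dimensional bound needs \<open>f^2\<close> to be integrable on the line,
    which Fubini gives for almost every line only.\<close>
  have A: "AE b in lborel. \<forall>a. ennreal ((f (a,b))\<^sup>2) \<le> A b"
  proof -
    have "AE b in lborel. (\<integral>\<^sup>+a. ennreal ((f (a,b))\<^sup>2) \<partial>lborel) \<noteq> \<infinity>"
      using fin1 by (intro nn_integral_PInf_AE) auto
    then show ?thesis
    proof eventually_elim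
      case (elim b)
      show ?case
      proof
        fix a
        have "ennreal \<bar>(f (a,b))\<^sup>2\<bar> \<le> (\<integral>\<^sup>+a. ennreal \<bar>2 * f (a,b) * D1 (a,b)\<bar> \<partial>lborel)"
        proof (rule abs_le_nn_integral_deriv[of "\<lambda>a. (f (a,b))\<^sup>2"])
          fix x
          have "((\<lambda>s. f ((0,b) + s *\<^sub>R (1,0))) has_real_derivative D1 ((0,b) + x *\<^sub>R (1,0))) (at x)"
            by (rule has_dir_derivD[OF d1(1)])
          then have "((\<lambda>a. f (a,b)) has_real_derivative D1 (x,b)) (at x)" by simp
          from DERIV_power[OF this, of 2]
          show "((\<lambda>a. (f (a,b))\<^sup>2) has_real_derivative 2 * f (x,b) * D1 (x,b)) (at x)" by (simp add: mult_ac)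
        qed (use elim in \<open>auto intro!: continuous_intros ca f d1 simp: less_top\<close>)
        then show "ennreal ((f (a,b))\<^sup>2) \<le> A b" by (simp add: A_def)
      qed
    qed
  qed
  have B: "AE a in lborel. \<forall>b. ennreal ((f (a,b))\<^sup>2) \<le> B a"
  proof -
    have "AE a in lborel. (\<integral>\<^sup>+b. ennreal ((f (a,b))\<^sup>2) \<partial>lborel) \<noteq> \<infinity>"
      using fin2 by (intro nn_integral_PInf_AE) auto
    then show ?thesis
    proof eventually_elim
      case (elim a)
      show ?case
      proof
        fix b
        have "ennreal \<bar>(f (a,b))\<^sup>2\<bar> \<le> (\<integral>\<^sup>+b. ennreal \<bar>2 * f (a,b) * D2 (a,b)\<bar> \<partial>lborel)"
        proof (rule abs_le_nn_integral_deriv[of "\<lambda>b. (f (a,b))\<^sup>2"])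
          fix x
          have "((\<lambda>s. f ((a,0) + s *\<^sub>R (0,1))) has_real_derivative D2 ((a,0) + x *\<^sub>R (0,1))) (at x)"
            by (rule has_dir_derivD[OF d2(1)])
          then have "((\<lambda>b. f (a,b)) has_real_derivative D2 (a,x)) (at x)" by simp
          from DERIV_power[OF this, of 2]
          show "((\<lambda>b. (f (a,b))\<^sup>2) has_real_derivative 2 * f (a,x) * D2 (a,x)) (at x)" by (simp add: mult_ac)
        qed (use elim in \<open>auto intro!: continuous_intros cb f d2 simp: less_top\<close>)
        then show "ennreal ((f (a,b))\<^sup>2) \<le> B a" by (simp add: B_def)
      qed
    qed
  qed
  have "(\<integral>\<^sup>+x. ennreal (f x ^ 4) \<partial>lborel) = (\<integral>\<^sup>+x. ennreal (f x ^ 4) \<partial>(lborel \<Otimes>\<^sub>M lborel))"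
    by (simp add: lborel_prod)
  also have "\<dots> = (\<integral>\<^sup>+a. \<integral>\<^sup>+b. ennreal (f (a,b) ^ 4) \<partial>lborel \<partial>lborel)"
    by (subst lborel.nn_integral_fst) simp_all
  also have "\<dots> \<le> (\<integral>\<^sup>+a. \<integral>\<^sup>+b. B a * A b \<partial>lborel \<partial>lborel)"
  proof (rule nn_integral_mono_AE, use B in eventually_elim)
    case (elim a)
    show ?case
    proof (rule nn_integral_mono_AE, use A in eventually_elim)
      case (elim b)
      have "ennreal (f (a,b) ^ 4) = ennreal ((f (a,b))\<^sup>2) * ennreal ((f (a,b))\<^sup>2)"
        by (simp add: ennreal_mult[symmetric] power4_eq_xxxx power2_eq_square mult.assoc)
      also have "\<dots> \<le> B a * A b"
        using elim \<open>\<forall>b. ennreal ((f (a,b))\<^sup>2) \<le> B a\<close> by (intro mult_mono) auto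
      finally show ?case .
    qed
  qed
  also have "\<dots> = (\<integral>\<^sup>+b. A b \<partial>lborel) * (\<integral>\<^sup>+a. B a \<partial>lborel)"
    by (simp add: nn_integral_cmult nn_integral_multc mult.commute)
  also have "(\<integral>\<^sup>+b. A b \<partial>lborel) = (\<integral>\<^sup>+x. ennreal (2 * \<bar>f x * D1 x\<bar>) \<partial>(lborel \<Otimes>\<^sub>M lborel))"
    unfolding A_def by (subst lborel_pair.nn_integral_snd[symmetric]) (simp_all add: abs_mult mult.assoc)
  also have "(\<integral>\<^sup>+a. B a \<partial>lborel) = (\<integral>\<^sup>+x. ennreal (2 * \<bar>f x * D2 x\<bar>) \<partial>(lborel \<Otimes>\<^sub>M lborel))"
    unfolding B_def by (subst lborel.nn_integral_fst[symmetric]) (simp_all add: abs_mult mult.assoc)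
  finally show ?thesis by (simp add: lborel_prod)
qed

lemma integral_abs_mult_sq_le:
  assumes "L2 f" "L2 g"
  shows "(LBINT x. \<bar>f x * g x\<bar>)\<^sup>2 \<le> (LBINT x. (f x)\<^sup>2) * (LBINT x. (g x)\<^sup>2)"
proof -
  note [measurable] = L2_measurable[OF assms(1)] L2_measurable[OF assms(2)]
  have "(\<integral>\<^sup>+x. ennreal \<bar>f x * g x\<bar> \<partial>lborel) = ennreal (LBINT x. \<bar>f x * g x\<bar>)"
    using L2_mult_integrable[OF assms] by (intro nn_integral_eq_integral) auto
  moreover have "(\<integral>\<^sup>+x. ennreal \<bar>f x\<bar> * ennreal \<bar>g x\<bar> \<partial>lborel)\<^sup>2 \<le> (\<integral>\<^sup>+x. (ennreal \<bar>f x\<bar>)\<^sup>2 \<partial>lborel) * (\<integral>\<^sup>+x. (ennreal \<bar>g x\<bar>)\<^sup>2 \<partial>lborel)"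
    by (rule Cauchy_Schwarz_nn_integral) auto
  ultimately show ?thesis
    using nn_integral_L2[OF assms(1)] nn_integral_L2[OF assms(2)]
    by (simp add: ennreal_mult[symmetric] abs_mult ennreal_power ennreal_le_iff)
qed

lemma ladyzhenskaya:
  fixes f :: "real \<times> real \<Rightarrow> real"
  assumes f: "L2 f" "continuous_on UNIV f"
    and d1: "has_dir_deriv (1,0) f D1" "continuous_on UNIV D1" "L2 D1" and d2: "has_dir_deriv (0,1) f D2" "continuous_on UNIV D2" "L2 D2"
  shows "(\<integral>\<^sup>+x. ennreal (f x ^ 4) \<partial>lborel) \<le>
    ennreal (2 * (LBINT x. (f x)\<^sup>2) * ((LBINT x. (D1 x)\<^sup>2) + (LBINT x. (D2 x)\<^sup>2)))"
proof -
  let ?a = "LBINT x. \<bar>f x * D1 x\<bar>" and ?b = "LBINT x. \<bar>f x * D2 x\<bar>"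
  have "(\<integral>\<^sup>+x. ennreal (2 * \<bar>f x * D x\<bar>) \<partial>lborel) = ennreal (2 * (LBINT x. \<bar>f x * D x\<bar>))" if "L2 D" for D
    using L2_mult_integrable[OF f(1) that] by (subst nn_integral_eq_integral) auto
  note eq = this[OF d1(3)] this[OF d2(3)]
  have "(\<integral>\<^sup>+x. ennreal (f x ^ 4) \<partial>lborel) \<le> ennreal (2 * ?a) * ennreal (2 * ?b)"
    using ladyzhenskaya_nn[OF f d1(1,2) d2(1,2)] by (simp only: eq)
  also have "\<dots> = ennreal (4 * (?a * ?b))" by (simp add: ennreal_mult[symmetric])
  \<comment> \<open>\<open>4 * ?a * ?b \<le> 2 * (?a^2 + ?b^2)\<close>, and the Cauchy-Schwarz
    inequality is applied to each square; this is the origin of the factor 2.\<close>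
  also have "\<dots> \<le> ennreal (2 * (LBINT x. (f x)\<^sup>2) * ((LBINT x. (D1 x)\<^sup>2) + (LBINT x. (D2 x)\<^sup>2)))"
    using integral_abs_mult_sq_le[OF f(1) d1(3)] integral_abs_mult_sq_le[OF f(1) d2(3)] sum_squares_bound[of ?a ?b]
    by (intro ennreal_leI) (simp add: algebra_simps)
  finally show ?thesis .
qed

subsection \<open>Approximation in the mean square\<close>

text \<open>A measurable function is almost everywhere a limit of continuous ones, but without a
  dominating function. Clipping the values and cutting off in space provides one: first
  \<open>f\<close> is replaced by its clipped version, then that by the clipped continuous
  functions.\<close>

lemma L2_dense:
  fixes f :: "'a::euclidean_space \<Rightarrow> real"
  assumes f: "L2 f" and e: "e > 0"
  obtains g where "Cc g" "(LBINT x. (f x - g x)\<^sup>2) < e"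
proof -
  note [measurable] = L2_measurable[OF f]
  have "f \<in> borel_measurable lebesgue" by (simp add: measurable_completion)
  then have "f measurable_on UNIV" by (rule lebesgue_measurable_imp_measurable_on_real) simp
  then obtain N g where N: "negligible N" and g: "\<And>n. continuous_on UNIV (g n)"
    and lim: "\<And>x. x \<notin> N \<Longrightarrow> (\<lambda>n. g n x) \<longlonglongrightarrow> f x"
    unfolding measurable_on_def by auto
  have [measurable]: "g n \<in> borel_measurable borel" for n
    using g by (rule borel_measurable_continuous_onI)
  have AEN: "AE x in lborel. x \<notin> N"
  proof -
    have "AE x in lebesgue. x \<notin> N"
      using N by (intro AE_not_in) (simp add: negligible_iff_null_sets)
    then show ?thesis by (simp add: AE_completion_iff)
  qed
  define cut :: "nat \<Rightarrow> 'a \<Rightarrow> real" where "cut m x = max 0 (min 1 (real m + 1 - norm x))" for m x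
  define clip :: "nat \<Rightarrow> real \<Rightarrow> real" where "clip m v = max (- real m) (min (real m) v)" for m v
  have [measurable]: "cut m \<in> borel_measurable borel" "clip m \<in> borel_measurable borel" for m
    unfolding cut_def clip_def by measurable
  have cut01: "0 \<le> cut m x" "cut m x \<le> 1" for m x by (auto simp: cut_def)
  have clip_bd: "\<bar>clip m v\<bar> \<le> real m" for m v by (auto simp: clip_def)
  \<comment> \<open>Clipping and multiplying by a factor between 0 and 1 moves \<open>v\<close>
    towards 0 without crossing it; the squared error is therefore dominated by
    \<open>f^2\<close>.\<close>
  have near: "\<bar>clip m v * cut m x - v\<bar> \<le> \<bar>v\<bar>" for m v x
  proof -
    have c: "0 \<le> clip m v \<and> clip m v \<le> v \<or> v \<le> clip m v \<and> clip m v \<le> 0"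
      by (auto simp: clip_def)
    then show ?thesis
    proof
      assume a: "0 \<le> clip m v \<and> clip m v \<le> v"
      then have "0 \<le> clip m v * cut m x" "clip m v * cut m x \<le> clip m v * 1"
        using cut01 by (auto intro!: mult_left_mono mult_nonneg_nonneg simp del: mult_1_right)
      then show ?thesis using a by auto
    next
      assume a: "v \<le> clip m v \<and> clip m v \<le> 0"
      then have "clip m v * cut m x \<le> 0" "clip m v * 1 \<le> clip m v * cut m x"
        using cut01 by (auto intro!: mult_left_mono_neg mult_nonpos_nonneg simp del: mult_1_right)
      then show ?thesis using a by auto
    qed
  qed
  have "(\<lambda>m. LBINT x. (clip m (f x) * cut m x - f x)\<^sup>2) \<longlonglongrightarrow> (\<integral>x. 0 \<partial>(lborel::'a measure))"
  proof (rule integral_dominated_convergence[where w = "\<lambda>x. (f x)\<^sup>2"])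
    show "integrable lborel (\<lambda>x. (f x)\<^sup>2)" by (rule L2_integrable[OF f])
    show "AE x in lborel. norm ((clip m (f x) * cut m x - f x)\<^sup>2) \<le> (f x)\<^sup>2" for m
      using near by (auto simp: power2_le_iff_abs_le abs_le_square_iff[symmetric])
    show "AE x in lborel. (\<lambda>m. (clip m (f x) * cut m x - f x)\<^sup>2) \<longlonglongrightarrow> 0"
    proof (rule AE_I2)
      fix x
      obtain k where k: "norm x \<le> real k" "\<bar>f x\<bar> \<le> real k"
        by (meson order_trans real_arch_simple linear)
      have "eventually (\<lambda>m. (clip m (f x) * cut m x - f x)\<^sup>2 = 0) sequentially"
        using eventually_ge_at_top[of k]
      proof eventually_elim
        case (elim m)
        then have "real k \<le> real m" by simp
        then have "clip m (f x) = f x" "cut m x = 1" using k by (auto simp: clip_def cut_def)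
        then show ?case by simp
      qed
      then show "(\<lambda>m. (clip m (f x) * cut m x - f x)\<^sup>2) \<longlonglongrightarrow> 0" by (rule tendsto_eventually)
    qed
  qed measurable
  then have "(\<lambda>m. LBINT x. (clip m (f x) * cut m x - f x)\<^sup>2) \<longlonglongrightarrow> 0" by simp
  from order_tendstoD(2)[OF this, of "e/4"] e
  obtain m where m: "(LBINT x. (clip m (f x) * cut m x - f x)\<^sup>2) < e/4"
    by (auto simp: eventually_sequentially)
  let ?h = "\<lambda>x. clip m (f x) * cut m x"
  have cut0: "cut m x = 0" if "real m + 1 < norm x" for x using that by (simp add: cut_def)
  have bd: "(clip m v * cut m x - clip m v' * cut m x)\<^sup>2 \<le> ((2 * real m) * indicator (cball 0 (real m + 1)) x)\<^sup>2" for v v' x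
  proof (cases "x \<in> cball 0 (real m + 1)")
    case True
    have "\<bar>(clip m v - clip m v') * cut m x\<bar> \<le> (2 * real m) * 1"
      unfolding abs_mult using clip_bd[of m v] clip_bd[of m v'] cut01[of m x] by (intro mult_mono) auto
    from power_mono[OF this, of 2] show ?thesis using True by (simp add: left_diff_distrib)
  qed (auto simp: cut0)
  have ind: "integrable lborel (\<lambda>x::'a. ((2 * real m) * indicator (cball 0 (real m + 1)) x)\<^sup>2)"
    by (rule L2_integrable[OF L2_indicator_cball])
  have "(\<lambda>n. LBINT x. (?h x - clip m (g n x) * cut m x)\<^sup>2) \<longlonglongrightarrow> (\<integral>x. 0 \<partial>(lborel::'a measure))"
  proof (rule integral_dominated_convergence[OF _ _ ind])
    show "AE x in lborel. norm ((?h x - clip m (g n x) * cut m x)\<^sup>2) \<le> ((2 * real m) * indicator (cball 0 (real m + 1)) x)\<^sup>2" for n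
      using bd by simp
    show "AE x in lborel. (\<lambda>n. (?h x - clip m (g n x) * cut m x)\<^sup>2) \<longlonglongrightarrow> 0"
      using AEN
    proof eventually_elim
      case (elim x)
      have "(\<lambda>n. (?h x - clip m (g n x) * cut m x)\<^sup>2) \<longlonglongrightarrow> (?h x - clip m (f x) * cut m x)\<^sup>2"
        unfolding clip_def by (intro tendsto_intros lim elim)
      then show ?case by simp
    qed
  qed measurable
  then have "(\<lambda>n. LBINT x. (?h x - clip m (g n x) * cut m x)\<^sup>2) \<longlonglongrightarrow> 0" by simp
  from order_tendstoD(2)[OF this, of "e/4"] e
  obtain n where n: "(LBINT x. (?h x - clip m (g n x) * cut m x)\<^sup>2) < e/4"
    by (auto simp: eventually_sequentially)
  let ?g = "\<lambda>x. clip m (g n x) * cut m x"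
  have Cc: "Cc ?g"
    unfolding Cc_def
  proof
    show "continuous_on UNIV ?g"
      unfolding clip_def cut_def by (intro continuous_intros g)
    show "\<exists>R. \<forall>x. R < norm x \<longrightarrow> ?g x = 0" using cut0 by auto
  qed
  have i1: "integrable lborel (\<lambda>x. (?h x - f x)\<^sup>2)"
    by (rule Bochner_Integration.integrable_bound[OF L2_integrable[OF f]])
       (use near in \<open>auto simp: abs_le_square_iff[symmetric]\<close>)
  have i2: "integrable lborel (\<lambda>x. (?h x - ?g x)\<^sup>2)"
    by (rule Bochner_Integration.integrable_bound[OF ind]) (use bd in auto)
  have "(LBINT x. (f x - ?g x)\<^sup>2) \<le> (LBINT x. 2 * (?h x - f x)\<^sup>2 + 2 * (?h x - ?g x)\<^sup>2)"
  proof (rule integral_mono)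
    have "L2 (\<lambda>x. f x + (-1) * ?g x)" by (intro L2_add L2_cmult Cc_L2 Cc f)
    then show "integrable lborel (\<lambda>x. (f x - ?g x)\<^sup>2)" by (simp add: L2_def)
    show "integrable lborel (\<lambda>x. 2 * (?h x - f x)\<^sup>2 + 2 * (?h x - ?g x)\<^sup>2)" using i1 i2 by simp
    fix x
    have "0 \<le> ((?h x - f x) + (?h x - ?g x))\<^sup>2" by simp
    then show "(f x - ?g x)\<^sup>2 \<le> 2 * (?h x - f x)\<^sup>2 + 2 * (?h x - ?g x)\<^sup>2"
      by (simp add: power2_eq_square algebra_simps)
  qed
  also have "\<dots> = 2 * (LBINT x. (?h x - f x)\<^sup>2) + 2 * (LBINT x. (?h x - ?g x)\<^sup>2)"
    using i1 i2 by simp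
  also have "\<dots> < e" using m n by simp
  finally show thesis using that Cc by blast
qed

lemma mollify_diff:
  assumes "Cc \<psi>" "L2 f" "L2 g"
  shows "mollify \<psi> (\<lambda>x. f x - g x) y = mollify \<psi> f y - mollify \<psi> g y"
  unfolding mollify_def using mollify_integrable[OF assms(1,2)] mollify_integrable[OF assms(1,3)]
  by (simp add: right_diff_distrib)

lemma L2_diff: "L2 f \<Longrightarrow> L2 g \<Longrightarrow> L2 (\<lambda>x. f x - g x)"
  using L2_add[of f "\<lambda>x. (-1) * g x"] L2_cmult[of g "-1"] by simp

lemma mollify_tendsto_Cc:
  fixes g :: "'a::euclidean_space \<Rightarrow> real"
  assumes rho: "\<And>n. Cc (\<rho> n)" "\<And>n x. 0 \<le> \<rho> n x" "\<And>n. (LBINT x. \<rho> n x) = 1"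
    and supp: "\<And>n x. r n < norm x \<Longrightarrow> \<rho> n x = 0" and r: "r \<longlonglongrightarrow> 0" "\<And>n. r n \<le> 1"
    and g: "Cc g"
  shows "(\<lambda>n. LBINT y. (mollify (\<rho> n) g y - g y)\<^sup>2) \<longlonglongrightarrow> 0"
proof -
  obtain R M where R: "\<And>x. R < norm x \<Longrightarrow> g x = 0" and M: "\<And>x. \<bar>g x\<bar> \<le> M" "M \<ge> 0"
    using CcE[OF g] by metis
  note [measurable] = Cc_measurable[OF g]
  have sh: "integrable lborel (\<lambda>x. \<rho> n (x - y))" "(LBINT x. \<rho> n (x - y)) = 1" for n y
    using Cc_integrable[OF Cc_shift[OF rho(1)]] integral_lborel_translate[of "\<rho> n" "-y"] rho(3) Cc_measurable[OF rho(1)]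
    by auto
  \<comment> \<open>A nonnegative kernel of mass one averages over the ball of radius
    \<open>r n\<close>, so the error at \<open>y\<close> is at most the oscillation of
    \<open>g\<close> there. This yields the dominating function as well as the pointwise
    limit.\<close>
  have key: "\<bar>mollify (\<rho> n) g y - g y\<bar> \<le> B" if B: "\<And>x. norm (x - y) \<le> r n \<Longrightarrow> \<bar>g x - g y\<bar> \<le> B" for n y B
  proof -
    have i: "integrable lborel (\<lambda>x. \<rho> n (x - y) * g x)" by (rule mollify_integrable[OF rho(1) Cc_L2[OF g]])
    have "mollify (\<rho> n) g y - g y = (LBINT x. \<rho> n (x - y) * g x) - (LBINT x. \<rho> n (x - y) * g y)"
      using sh by (simp add: mollify_def)
    also have "\<dots> = (LBINT x. \<rho> n (x - y) * (g x - g y))"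
      using sh i by (simp add: right_diff_distrib)
    also have "norm \<dots> \<le> (LBINT x. \<rho> n (x - y) * B)"
    proof (rule Bochner_Integration.integral_norm_bound_integral)
      show "integrable lborel (\<lambda>x. \<rho> n (x - y) * (g x - g y))" using sh i by (simp add: right_diff_distrib)
      show "integrable lborel (\<lambda>x. \<rho> n (x - y) * B)" using sh by simp
      fix x
      show "norm (\<rho> n (x - y) * (g x - g y)) \<le> \<rho> n (x - y) * B"
      proof (cases "norm (x - y) \<le> r n")
        case True
        then show ?thesis using B rho(2) by (simp add: abs_mult mult_left_mono)
      qed (simp add: supp)
    qed
    also have "\<dots> = B" using sh by simp
    finally show ?thesis by simp
  qed
  have "(\<lambda>n. LBINT y. (mollify (\<rho> n) g y - g y)\<^sup>2) \<longlonglongrightarrow> (\<integral>y. 0 \<partial>(lborel::'a measure))"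
  proof (rule integral_dominated_convergence)
    show "integrable lborel (\<lambda>x::'a. ((2 * M) * indicator (cball 0 (R + 1)) x)\<^sup>2)"
      by (rule L2_integrable[OF L2_indicator_cball])
    show "(\<lambda>y. (mollify (\<rho> n) g y - g y)\<^sup>2) \<in> borel_measurable lborel" for n
      using L2_measurable[OF L2_mollify[OF rho(1) Cc_L2[OF g]]] by simp
    fix n
    show "AE y in lborel. norm ((mollify (\<rho> n) g y - g y)\<^sup>2) \<le> ((2 * M) * indicator (cball 0 (R + 1)) y)\<^sup>2"
    proof (rule AE_I2)
      fix y
      have "\<bar>mollify (\<rho> n) g y - g y\<bar> \<le> (2 * M) * indicator (cball 0 (R + 1)) y"
      proof (rule key)
        fix x assume x: "norm (x - y) \<le> r n"
        show "\<bar>g x - g y\<bar> \<le> (2 * M) * indicator (cball 0 (R + 1)) y"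
        proof (cases "y \<in> cball 0 (R + 1)")
          case True
          then show ?thesis using M(1)[of x] M(1)[of y] by simp
        next
          case False
          then have "norm x > R"
            using x r(2)[of n] norm_triangle_ineq2[of y x] by (simp add: norm_minus_commute)
          then show ?thesis using False R by simp
        qed
      qed
      then show "norm ((mollify (\<rho> n) g y - g y)\<^sup>2) \<le> ((2 * M) * indicator (cball 0 (R + 1)) y)\<^sup>2"
        using power_mono[of "\<bar>mollify (\<rho> n) g y - g y\<bar>" _ 2] by simp
    qed
  next
    show "AE y in lborel. (\<lambda>n. (mollify (\<rho> n) g y - g y)\<^sup>2) \<longlonglongrightarrow> 0"
    proof (rule AE_I2)
      fix y
      have "(\<lambda>n. mollify (\<rho> n) g y - g y) \<longlonglongrightarrow> 0"
      proof (rule tendstoI)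
        fix e :: real assume "e > 0"
        have "continuous_on UNIV g" using g by (simp add: Cc_def)
        then have "isCont g y" by (simp add: continuous_on_eq_continuous_at)
        then obtain d where d: "d > 0" "\<And>x. dist x y < d \<Longrightarrow> dist (g x) (g y) < e/2"
          using \<open>e > 0\<close> unfolding continuous_at_eps_delta by (metis half_gt_zero)
        have "eventually (\<lambda>n. r n < d) sequentially" using order_tendstoD(2)[OF r(1) d(1)] .
        then show "eventually (\<lambda>n. dist (mollify (\<rho> n) g y - g y) 0 < e) sequentially"
        proof eventually_elim
          case (elim n)
          have "\<bar>mollify (\<rho> n) g y - g y\<bar> \<le> e/2"
          proof (rule key)
            fix x assume "norm (x - y) \<le> r n"
            then have "dist x y < d" using elim by (simp add: dist_norm)
            then show "\<bar>g x - g y\<bar> \<le> e/2" using d(2)[of x] by (simp add: dist_real_def)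
          qed
          then show ?case using \<open>e > 0\<close> by simp
        qed
      qed
      from tendsto_power[OF this, of 2]
      show "(\<lambda>n. (mollify (\<rho> n) g y - g y)\<^sup>2) \<longlonglongrightarrow> 0" by simp
    qed
  qed simp
  then show ?thesis by simp
qed

text \<open>Density of compactly supported functions, together with the contraction property, which
  makes the mollification of \<open>f - g\<close> no larger than \<open>f - g\<close> uniformly in
  \<open>n\<close>. Splitting a square into three terms costs a factor 3, hence the thresholds
  \<open>e/9\<close>.\<close>

lemma mollify_tendsto_L2:
  fixes f :: "'a::euclidean_space \<Rightarrow> real"
  assumes rho: "\<And>n. Cc (\<rho> n)" "\<And>n x. 0 \<le> \<rho> n x" "\<And>n. (LBINT x. \<rho> n x) = 1"
    and supp: "\<And>n x. r n < norm x \<Longrightarrow> \<rho> n x = 0" and r: "r \<longlonglongrightarrow> 0" "\<And>n. r n \<le> 1"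
    and f: "L2 f"
  shows "(\<lambda>n. LBINT y. (mollify (\<rho> n) f y - f y)\<^sup>2) \<longlonglongrightarrow> 0"
proof (rule tendstoI)
  fix e :: real assume e: "e > 0"
  obtain g where g: "Cc g" "(LBINT x. (f x - g x)\<^sup>2) < e/9"
    using L2_dense[OF f, of "e/9"] e by auto
  have gL: "L2 g" by (rule Cc_L2[OF g(1)])
  have fg: "L2 (\<lambda>x. f x - g x)" by (rule L2_diff[OF f gL])
  have "eventually (\<lambda>n. (LBINT y. (mollify (\<rho> n) g y - g y)\<^sup>2) < e/9) sequentially"
  proof -
    have "(\<lambda>n. LBINT y. (mollify (\<rho> n) g y - g y)\<^sup>2) \<longlonglongrightarrow> 0"
      by (rule mollify_tendsto_Cc[OF rho supp r g(1)])
    from order_tendstoD(2)[OF this, of "e/9"] show ?thesis using e by simp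
  qed
  then show "eventually (\<lambda>n. dist (LBINT y. (mollify (\<rho> n) f y - f y)\<^sup>2) 0 < e) sequentially"
  proof eventually_elim
    case (elim n)
    let ?c = "mollify (\<rho> n)"
    have i1: "integrable lborel (\<lambda>y. (?c (\<lambda>x. f x - g x) y)\<^sup>2)" by (intro L2_integrable L2_mollify rho fg)
    have i2: "integrable lborel (\<lambda>y. (?c g y - g y)\<^sup>2)" by (intro L2_integrable L2_diff L2_mollify rho gL)
    have i3: "integrable lborel (\<lambda>y. (f y - g y)\<^sup>2)" by (intro L2_integrable fg)
    have "(LBINT y. (?c f y - f y)\<^sup>2) \<le> (LBINT y. 3 * (?c (\<lambda>x. f x - g x) y)\<^sup>2 + 3 * (?c g y - g y)\<^sup>2 + 3 * (f y - g y)\<^sup>2)"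
    proof (rule integral_mono)
      show "integrable lborel (\<lambda>y. (?c f y - f y)\<^sup>2)" by (intro L2_integrable L2_diff L2_mollify rho f)
      show "integrable lborel (\<lambda>y. 3 * (?c (\<lambda>x. f x - g x) y)\<^sup>2 + 3 * (?c g y - g y)\<^sup>2 + 3 * (f y - g y)\<^sup>2)"
        using i1 i2 i3 by simp
      fix y
      have *: "(a + b - c)\<^sup>2 \<le> 3 * a\<^sup>2 + 3 * b\<^sup>2 + 3 * c\<^sup>2" for a b c :: real
      proof -
        have "0 \<le> (a - b)\<^sup>2 + (a + c)\<^sup>2 + (b + c)\<^sup>2" by simp
        then show ?thesis by (simp add: power2_eq_square algebra_simps)
      qed
      show "(?c f y - f y)\<^sup>2 \<le> 3 * (?c (\<lambda>x. f x - g x) y)\<^sup>2 + 3 * (?c g y - g y)\<^sup>2 + 3 * (f y - g y)\<^sup>2"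
        using *[of "?c (\<lambda>x. f x - g x) y" "?c g y - g y" "f y - g y"] by (simp add: mollify_diff[OF rho(1) f gL])
    qed
    also have "\<dots> = 3 * (LBINT y. (?c (\<lambda>x. f x - g x) y)\<^sup>2) + 3 * (LBINT y. (?c g y - g y)\<^sup>2) + 3 * (LBINT y. (f y - g y)\<^sup>2)"
      using i1 i2 i3 by simp
    also have "(LBINT y. (?c (\<lambda>x. f x - g x) y)\<^sup>2) \<le> (LBINT x. (f x - g x)\<^sup>2)"
      using integral_mollify_sq_le[OF rho(1) fg, of n] rho(2,3) by (simp add: abs_of_nonneg)
    finally have "(LBINT y. (?c f y - f y)\<^sup>2) < e" using g(2) elim by linarith
    then show ?case by simp
  qed
qed

section \<open>Primitives of integrable functions on the line\<close>

lemma integrable_product_real: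
  fixes b h :: "real \<Rightarrow> real"
  assumes "integrable lborel b" "integrable lborel h"
  shows "integrable (lborel \<Otimes>\<^sub>M lborel) (\<lambda>(r,t). h r * b t)"
proof (rule lborel_pair.Fubini_integrable)
  have [measurable]: "b \<in> borel_measurable borel" "h \<in> borel_measurable borel" using assms by auto
  show "(\<lambda>(r,t). h r * b t) \<in> borel_measurable (lborel \<Otimes>\<^sub>M lborel)" by measurable
  show "integrable lborel (\<lambda>r. LBINT t. norm (case (r, t) of (r, t) \<Rightarrow> h r * b t))"
    using assms by (simp add: abs_mult)
  show "AE r in lborel. integrable lborel (\<lambda>t. case (r, t) of (r, t) \<Rightarrow> h r * b t)"
    using assms by simp
qed

lemma integral_triangle:
  fixes b h :: "real \<Rightarrow> real"
  assumes "integrable lborel b" "integrable lborel h"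
  shows "(LBINT r. h r * (LBINT t. b t * indicator {..<r} t)) =
         (LBINT t. b t * (LBINT r. h r * indicator {t<..} r))"
proof -
  have [measurable]: "b \<in> borel_measurable borel" "h \<in> borel_measurable borel" using assms by auto
  let ?k = "\<lambda>r t. h r * b t * (if t < r then 1 else 0)"
  have "integrable (lborel \<Otimes>\<^sub>M lborel) (\<lambda>(r,t). ?k r t)"
    by (rule Bochner_Integration.integrable_bound[OF integrable_product_real[OF assms]]) auto
  then have "(LBINT t. LBINT r. ?k r t) = (LBINT r. LBINT t. ?k r t)"
    by (rule lborel_pair.Fubini_integral)
  moreover have "(LBINT t. ?k r t) = h r * (LBINT t. b t * indicator {..<r} t)" for r
  proof -
    have "(LBINT t. ?k r t) = (LBINT t. h r * (b t * indicator {..<r} t))"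
      by (intro Bochner_Integration.integral_cong) (auto split: split_indicator)
    then show ?thesis by simp
  qed
  moreover have "(LBINT r. ?k r t) = b t * (LBINT r. h r * indicator {t<..} r)" for t
  proof -
    have "(LBINT r. ?k r t) = (LBINT r. b t * (h r * indicator {t<..} r))"
      by (intro Bochner_Integration.integral_cong) (auto split: split_indicator)
    then show ?thesis by simp
  qed
  ultimately show ?thesis by simp
qed

lemma integrable_indicator_mult:
  fixes b :: "'a::euclidean_space \<Rightarrow> real"
  assumes "integrable lborel b" "A \<in> sets borel"
  shows "integrable lborel (\<lambda>t. b t * indicator A t)"
  using integrable_mult_indicator[of A lborel b] assms by (simp add: mult.commute)

text \<open>The chain rule for the square of an absolutely continuous function, in integrated form:
  by symmetry the integral of \<open>b r * b t\<close> over the square \<open>r, t < s\<close> is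
  twice that over the triangle \<open>t < r < s\<close>.\<close>

lemma primitive_square:
  fixes b :: "real \<Rightarrow> real"
  assumes b: "integrable lborel b"
  defines "B \<equiv> \<lambda>r. LBINT t. b t * indicator {..<r} t"
  shows "(B s)\<^sup>2 = 2 * (LBINT r. b r * B r * indicator {..<s} r)"
proof -
  have [measurable]: "b \<in> borel_measurable borel" using b by auto
  define bs where "bs t = b t * indicator {..<s} t" for t
  have ibs: "integrable lborel bs" unfolding bs_def by (rule integrable_indicator_mult[OF b]) simp
  have i: "integrable lborel (\<lambda>t. bs t * indicator A t)" if "A \<in> sets borel" for A
    by (rule integrable_indicator_mult[OF ibs that])
  define X where "X = (LBINT r. bs r * (LBINT t. bs t * indicator {..<r} t))"
  have 1: "(LBINT r. b r * B r * indicator {..<s} r) = X"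
    unfolding X_def
  proof (rule Bochner_Integration.integral_cong[OF refl])
    fix r
    have "(LBINT t. bs t * indicator {..<r} t) = B r" if "r < s"
      unfolding B_def bs_def using that
      by (intro Bochner_Integration.integral_cong) (auto split: split_indicator)
    then show "b r * B r * indicator {..<s} r = bs r * (LBINT t. bs t * indicator {..<r} t)"
      by (auto simp: bs_def split: split_indicator)
  qed
  have Bs: "B s = (LBINT t. bs t)" by (simp add: B_def bs_def)
  have split: "(LBINT r. bs r * indicator {t<..} r) = B s - (LBINT r. bs r * indicator {..<t} r)" for t
  proof -
    have "(LBINT r. bs r * indicator {t<..} r) + (LBINT r. bs r * indicator {..<t} r)
      = (LBINT r. bs r * indicator {t<..} r + bs r * indicator {..<t} r)"
      using i by simp
    also have "\<dots> = (LBINT r. bs r)"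
    proof (rule integral_cong_AE)
      show "AE r in lborel. bs r * indicator {t<..} r + bs r * indicator {..<t} r = bs r"
        using AE_lborel_singleton[of t] by eventually_elim (auto split: split_indicator)
    qed (auto simp: bs_def)
    finally show ?thesis using Bs by simp
  qed
  have p: "integrable lborel (\<lambda>t. bs t * (LBINT r. bs r * indicator {..<t} r))"
  proof -
    have "integrable (lborel \<Otimes>\<^sub>M lborel) (\<lambda>(r,t). bs r * bs t * (if t < r then 1 else 0))"
      by (rule Bochner_Integration.integrable_bound[OF integrable_product_real[OF ibs ibs]]) (auto simp: bs_def)
    from lborel_pair.integrable_fst'[OF this]
    show ?thesis
    proof (rule iffD1[OF Bochner_Integration.integrable_cong, rotated -1])
      fix t
      show "(LBINT y. (case (t, y) of (r, t) \<Rightarrow> bs r * bs t * (if t < r then 1 else 0))) = bs t * (LBINT r. bs r * indicator {..<t} r)"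
      proof -
        have "(LBINT y. (case (t, y) of (r, t) \<Rightarrow> bs r * bs t * (if t < r then 1 else 0))) = (LBINT r. bs t * (bs r * indicator {..<t} r))"
          by (intro Bochner_Integration.integral_cong) (auto split: split_indicator)
        then show ?thesis by simp
      qed
    qed simp
  qed
  \<comment> \<open>Exchanging the order of integration reflects the triangle in the diagonal; the
    complement of the reflected triangle in the square is the original one up to a null set, whence
    \<open>X = (B s)^2 - X\<close>.\<close>
  have "X = (LBINT t. bs t * (B s - (LBINT r. bs r * indicator {..<t} r)))"
    unfolding X_def by (subst integral_triangle[OF ibs ibs]) (simp add: split)
  also have "\<dots> = (LBINT t. bs t * B s) - X"
    unfolding X_def right_diff_distrib by (rule Bochner_Integration.integral_diff) (use p ibs in auto)
  also have "(LBINT t. bs t * B s) = (B s)\<^sup>2" by (simp add: Bs power2_eq_square)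
  finally show ?thesis using 1 by simp
qed

subsection \<open>The weak ordinary differential equation\<close>

text \<open>The positive and the negative part of \<open>q\<close> are densities of two finite
  measures that agree on all half-lines; the measures coincide, and so do the densities almost
  everywhere.\<close>

lemma AE_zero_if_tail_integrals_zero:
  fixes q :: "real \<Rightarrow> real"
  assumes q: "integrable lborel q" and z: "\<And>s. (LBINT t. q t * indicator {s<..} t) = 0"
  shows "AE t in lborel. q t = 0"
proof -
  have [measurable]: "q \<in> borel_measurable borel" using q by auto
  define p where "p t = max 0 (q t)" for t
  define m where "m t = max 0 (- q t)" for t
  have [measurable]: "p \<in> borel_measurable borel" "m \<in> borel_measurable borel"
    unfolding p_def m_def by measurable
  have ip: "integrable lborel p" and im: "integrable lborel m"
    unfolding p_def m_def by (rule Bochner_Integration.integrable_bound[OF q]; auto)+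
  have pm: "q t = p t - m t" "0 \<le> p t" "0 \<le> m t" for t by (auto simp: p_def m_def)
  have em: "emeasure (density lborel (\<lambda>t. ennreal (f t))) {s<..} = ennreal (LBINT t. f t * indicator {s<..} t)"
    if f: "integrable lborel f" "\<And>t. 0 \<le> f t" for f :: "real \<Rightarrow> real" and s
  proof -
    have [measurable]: "f \<in> borel_measurable borel" using f by auto
    have "emeasure (density lborel (\<lambda>t. ennreal (f t))) {s<..} = (\<integral>\<^sup>+t. ennreal (f t * indicator {s<..} t) \<partial>lborel)"
      by (subst emeasure_density) (auto intro!: nn_integral_cong split: split_indicator)
    also have "\<dots> = ennreal (LBINT t. f t * indicator {s<..} t)"
      by (intro nn_integral_eq_integral integrable_indicator_mult f) (use f in auto)
    finally show ?thesis .
  qed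
  have "density lborel (\<lambda>t. ennreal (p t)) = density lborel (\<lambda>t. ennreal (m t))"
  proof (rule measure_eqI_lessThan)
    fix s
    show "emeasure (density lborel (\<lambda>t. ennreal (p t))) {s<..} < \<infinity>"
      by (simp add: em[OF ip pm(2)])
    have "(LBINT t. p t * indicator {s<..} t - m t * indicator {s<..} t) = 0"
      using z[of s] by (simp add: pm(1) left_diff_distrib)
    then have "(LBINT t. p t * indicator {s<..} t) = (LBINT t. m t * indicator {s<..} t)"
      using integrable_indicator_mult[OF ip, of "{s<..}"] integrable_indicator_mult[OF im, of "{s<..}"] by simp
    then show "emeasure (density lborel (\<lambda>t. ennreal (p t))) {s<..} = emeasure (density lborel (\<lambda>t. ennreal (m t))) {s<..}"
      by (simp add: em[OF ip pm(2)] em[OF im pm(3)])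
  qed auto
  then have "AE t in lborel. ennreal (p t) = ennreal (m t)"
    using ip by (subst (asm) finite_density_unique) (auto simp: nn_integral_eq_integral pm)
  then show ?thesis by eventually_elim (simp add: pm)
qed

text \<open>The second difference of \<open>max 0 x ^ 2 / 2\<close> is a smoothed Heaviside function.\<close>

definition spline_step :: "real \<Rightarrow> real" where
  "spline_step x = ((max 0 x)\<^sup>2 - 2 * (max 0 (x - 1))\<^sup>2 + (max 0 (x - 2))\<^sup>2) / 2"

lemma spline_step_nonpos: "x \<le> 0 \<Longrightarrow> spline_step x = 0"
  by (simp add: spline_step_def)

lemma spline_step_ge2: "x \<ge> 2 \<Longrightarrow> spline_step x = 1"
  by (simp add: spline_step_def power2_eq_square algebra_simps)

lemma spline_step_bound: "\<bar>spline_step x\<bar> \<le> 1"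
proof -
  consider "x \<le> 0" | "0 < x" "x \<le> 1" | "1 < x" "x \<le> 2" | "2 < x" by linarith
  then show ?thesis
  proof cases
    case 2
    then have "spline_step x = x\<^sup>2 / 2" by (simp add: spline_step_def)
    moreover have "x\<^sup>2 \<le> 1" "0 \<le> x\<^sup>2" using 2 by (simp_all add: power_le_one)
    ultimately show ?thesis by linarith
  next
    case 3
    define u where "u = (2 - x)\<^sup>2"
    have "spline_step x = (2 - u) / 2"
      using 3 by (simp add: spline_step_def u_def power2_eq_square algebra_simps)
    moreover have "u \<le> 1" "0 \<le> u" using 3 by (auto simp: u_def intro!: power_le_one)
    ultimately show ?thesis by (simp add: abs_le_iff)
  qed (simp_all add: spline_step_nonpos spline_step_ge2)
qed

text \<open>The bound is asked for only where \<open>f\<close> does not vanish, since powers of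
  \<open>max 0 (s - t)\<close> are unbounded as \<open>t\<close> tends to minus infinity but are
  multiplied by functions supported in \<open>{0<..<T}\<close>.\<close>

lemma integrable_mult_bounded:
  fixes f g :: "'a::euclidean_space \<Rightarrow> real"
  assumes "g \<in> borel_measurable borel" "integrable lborel f" "\<And>t. f t \<noteq> 0 \<Longrightarrow> \<bar>g t\<bar> \<le> C"
  shows "integrable lborel (\<lambda>t. g t * f t)"
proof (rule Bochner_Integration.integrable_bound)
  show "integrable lborel (\<lambda>t. C * \<bar>f t\<bar>)" using assms by simp
  show "(\<lambda>t. g t * f t) \<in> borel_measurable lborel" using assms by auto
  show "AE t in lborel. norm (g t * f t) \<le> norm (C * \<bar>f t\<bar>)"
  proof (rule AE_I2)
    fix t
    show "norm (g t * f t) \<le> norm (C * \<bar>f t\<bar>)"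
    proof (cases "f t = 0")
      case False
      then have "\<bar>g t\<bar> \<le> \<bar>C\<bar>" using assms(3)[of t] by linarith
      then show ?thesis by (simp add: abs_mult mult_right_mono)
    qed simp
  qed
qed

text \<open>\<open>eq\<close> is the weak form of \<open>a' = b\<close> with initial value 0: it has
  no term at time 0, so the primitive starts from 0. Writing the cube as an integral of truncated
  squares shows that \<open>q\<close>, the difference of \<open>a\<close> and the primitive, is
  orthogonal to all truncated squares. Their second differences in \<open>s\<close> approximate
  indicators of half-lines, and these determine \<open>q\<close>.\<close>

lemma weak_ode:
  fixes a b :: "real \<Rightarrow> real"
  assumes T: "T > 0" and a: "integrable lborel a" and b: "integrable lborel b"
    and b0: "\<And>t. t \<notin> {0<..<T} \<Longrightarrow> b t = 0"
    and a0: "\<And>t. t \<notin> {0<..<T} \<Longrightarrow> a t = 0"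
    and eq: "\<And>s. 0 < s \<Longrightarrow> s < T \<Longrightarrow>
       (LBINT t. - 3 * (max 0 (s - t))\<^sup>2 * a t + (max 0 (s - t)) ^ 3 * b t) = 0"
  shows "AE t in lborel. t \<in> {0<..<T} \<longrightarrow> a t = (LBINT r. b r * indicator {..<t} r)"
proof -
  have [measurable]: "a \<in> borel_measurable borel" "b \<in> borel_measurable borel" using a b by auto
  define B where "B = (\<lambda>t. LBINT r. b r * indicator {..<t} r)"
  have Bm[measurable]: "B \<in> borel_measurable borel"
  proof -
    have "B = (\<lambda>t. LBINT r. b r * (if r < t then 1 else 0))"
      unfolding B_def by (intro ext Bochner_Integration.integral_cong) (auto split: split_indicator)
    then show ?thesis by simp
  qed
  have Bb: "\<bar>B t\<bar> \<le> (LBINT r. \<bar>b r\<bar>)" for t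
    unfolding B_def real_norm_def[symmetric]
    by (rule Bochner_Integration.integral_norm_bound_integral)
       (use b in \<open>auto intro!: integrable_indicator_mult split: split_indicator\<close>)
  have indT: "integrable lborel (indicator {0<..<T} :: real \<Rightarrow> real)" using T by (intro integrable_real_indicator) auto
  define q where "q t = a t - B t * indicator {0<..<T} t" for t
  have iB: "integrable lborel (\<lambda>t. B t * indicator {0<..<T} t)"
    by (rule integrable_mult_bounded[where C="LBINT r. \<bar>b r\<bar>"]) (use indT Bb in auto)
  have q: "integrable lborel q" unfolding q_def using a iB by simp
  have q0: "q t = 0" if "t \<notin> {0<..<T}" for t using a0[OF that] that by (simp add: q_def)
  have [measurable]: "q \<in> borel_measurable borel" using q by auto
  have mbd: "\<bar>max 0 (s - t)\<bar> \<le> T" if "0 < t" "s < T" for s t :: real using that T by auto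
  have mq: "(LBINT t. (max 0 (s - t))\<^sup>2 * q t) = 0" and imq: "integrable lborel (\<lambda>t. (max 0 (s - t))\<^sup>2 * q t)"
    if s: "0 < s" "s < T" for s
  proof -
    have p: "\<bar>(max 0 (s - t)) ^ n\<bar> \<le> T ^ n" if "0 < t" for t n
      unfolding power_abs using mbd[OF that s(2)] by (intro power_mono) auto
    show "integrable lborel (\<lambda>t. (max 0 (s - t))\<^sup>2 * q t)"
      by (rule integrable_mult_bounded[OF _ q p]) (use q0 in force)+
    \<comment> \<open>\<open>h\<close> is minus the derivative of the truncated cube, restricted to
      \<open>{0<..<T}\<close>: its tail integral returns the cube, and
      \<open>integral_triangle\<close> then moves the integration onto \<open>b\<close>.\<close>
    define h where "h r = 3 * (max 0 (s - r))\<^sup>2 * indicator {0<..<T} r" for r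
    have h: "integrable lborel h"
      unfolding h_def by (rule integrable_mult_bounded[where C="3 * T\<^sup>2"]) (use indT p[of _ 2] in \<open>auto simp: abs_mult split: split_indicator_asm\<close>)
    have hi: "(LBINT r. h r * indicator {t<..} r) = (max 0 (s - t)) ^ 3" if "t \<in> {0<..<T}" for t
    proof (cases "t < s")
      case False
      then have "h r * indicator {t<..} r = 0" for r by (auto simp: h_def split: split_indicator)
      then have "(LBINT r. h r * indicator {t<..} r) = (\<integral>r. 0 \<partial>(lborel::real measure))" by (simp only:)
      then show ?thesis using False by simp
    next
      case True
      have "(LBINT r. h r * indicator {t<..} r) = (LBINT r. 3 * (s - r)\<^sup>2 * indicator {t..s} r)"
      proof (rule integral_cong_AE)
        show "AE r in lborel. h r * indicator {t<..} r = 3 * (s - r)\<^sup>2 * indicator {t..s} r"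
          using AE_lborel_singleton[of t]
          by eventually_elim (use that s True in \<open>auto simp: h_def split: split_indicator\<close>)
      qed (auto simp: h_def)
      also have "\<dots> = - ((s - s) ^ 3) - (- ((s - t) ^ 3))"
      proof (rule integral_FTC_Icc_real)
        show "((\<lambda>r. - ((s - r) ^ 3)) has_real_derivative 3 * (s - x)\<^sup>2) (at x)" for x
          by (auto intro!: derivative_eq_intros simp: power2_eq_square)
      qed (use True in \<open>auto intro!: continuous_intros\<close>)
      finally show ?thesis using True by simp
    qed
    have i1: "integrable lborel (\<lambda>t. (max 0 (s - t))\<^sup>2 * a t)"
      by (rule integrable_mult_bounded[OF _ a p]) (use a0 in force)+
    have i3: "integrable lborel (\<lambda>t. (max 0 (s - t))^3 * b t)"
      by (rule integrable_mult_bounded[OF _ b p]) (use b0 in force)+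
    have i2: "integrable lborel (\<lambda>t. (max 0 (s - t))\<^sup>2 * (B t * indicator {0<..<T} t))"
      by (rule integrable_mult_bounded[OF _ iB p]) (auto split: split_indicator_asm)
    have "(LBINT t. (max 0 (s - t)) ^ 3 * b t) = (LBINT t. b t * (LBINT r. h r * indicator {t<..} r))"
    proof (rule Bochner_Integration.integral_cong[OF refl])
      fix t show "(max 0 (s - t)) ^ 3 * b t = b t * (LBINT r. h r * indicator {t<..} r)"
        using hi[of t] b0[of t] by (cases "t \<in> {0<..<T}") auto
    qed
    also have "\<dots> = (LBINT r. h r * B r)" unfolding B_def by (rule integral_triangle[OF b h, symmetric])
    also have "\<dots> = (LBINT r. 3 * ((max 0 (s - r))\<^sup>2 * (B r * indicator {0<..<T} r)))"
      by (intro Bochner_Integration.integral_cong) (auto simp: h_def)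
    finally have e1: "(LBINT t. (max 0 (s - t)) ^ 3 * b t) = 3 * (LBINT r. (max 0 (s - r))\<^sup>2 * (B r * indicator {0<..<T} r))"
      by simp
    have "(LBINT t. - 3 * (max 0 (s - t))\<^sup>2 * a t + (max 0 (s - t)) ^ 3 * b t) =
      - 3 * (LBINT t. (max 0 (s - t))\<^sup>2 * a t) + (LBINT t. (max 0 (s - t)) ^ 3 * b t)"
      using i1 i3 by (simp add: mult.assoc)
    then have "(LBINT t. (max 0 (s - t))\<^sup>2 * a t) = (LBINT r. (max 0 (s - r))\<^sup>2 * (B r * indicator {0<..<T} r))"
      using eq[OF s] e1 by simp
    then show "(LBINT t. (max 0 (s - t))\<^sup>2 * q t) = 0"
      unfolding q_def right_diff_distrib using i1 i2 by simp
  qed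
  have lt: "(LBINT t. q t * indicator {..<s} t) = 0" if s: "0 < s" "s < T" for s
  proof -
    let ?k = "\<lambda>n::nat. \<lambda>t. spline_step (real (Suc n) * (s - t))"
    have [measurable]: "spline_step \<in> borel_measurable borel" unfolding spline_step_def by measurable
    have "(\<lambda>n. LBINT t. ?k n t * q t) \<longlonglongrightarrow> (LBINT t. q t * indicator {..<s} t)"
    proof (rule integral_dominated_convergence)
      show "integrable lborel (\<lambda>t. \<bar>q t\<bar>)" using q by simp
      show "AE t in lborel. norm (?k n t * q t) \<le> \<bar>q t\<bar>" for n
        using spline_step_bound by (auto simp: abs_mult mult_left_le_one_le)
      show "AE t in lborel. (\<lambda>n. ?k n t * q t) \<longlonglongrightarrow> q t * indicator {..<s} t"
      proof (rule AE_I2)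
        fix t
        show "(\<lambda>n. ?k n t * q t) \<longlonglongrightarrow> q t * indicator {..<s} t"
        proof (cases "t < s")
          case True
          obtain N :: nat where N: "2 / (s - t) \<le> real N" using real_arch_simple by blast
          have "eventually (\<lambda>n. ?k n t * q t = q t * indicator {..<s} t) sequentially"
            using eventually_ge_at_top[of N]
          proof eventually_elim
            case (elim n)
            then have "2 / (s - t) \<le> real (Suc n)" using N by linarith
            then have "2 \<le> real (Suc n) * (s - t)" using True by (simp add: field_simps del: of_nat_Suc)
            then show ?case using True spline_step_ge2 by simp
          qed
          then show ?thesis by (rule tendsto_eventually)
        next
          case False
          then have "?k n t = 0" for n by (intro spline_step_nonpos) (simp add: mult_nonneg_nonpos)
          then show ?thesis using False by simp
        qed
      qed
    qed measurable
    moreover have "eventually (\<lambda>n. (LBINT t. ?k n t * q t) = 0) sequentially"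
    proof -
      obtain N :: nat where N: "2 / s < real N" using reals_Archimedean2 by blast
      show ?thesis using eventually_ge_at_top[of N]
      proof eventually_elim
        case (elim n)
        define c where "c = real (Suc n)"
        have c: "c > 0" "2 / s < c" using elim N by (auto simp: c_def)
        then have sc: "2 / c < s" using s by (simp add: field_simps)
        have m: "(max 0 (c * x))\<^sup>2 = c\<^sup>2 * (max 0 x)\<^sup>2" for x
        proof -
          have "max 0 (c * x) = c * max 0 x" using c by (simp add: max_mult_distrib_left)
          then show ?thesis by (simp add: power_mult_distrib)
        qed
        \<comment> \<open>Up to the factor \<open>c^2 / 2\<close> this is the second difference with
          step \<open>1/c\<close> of the truncated square as a function of \<open>s\<close>. All
          three nodes lie between 0 and \<open>T\<close> once \<open>n\<close> is large, so
          \<open>mq\<close> applies to each term.\<close>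
        have k: "?k n t * q t = c\<^sup>2 / 2 * ((max 0 (s - t))\<^sup>2 * q t) - c\<^sup>2 * ((max 0 ((s - 1/c) - t))\<^sup>2 * q t)
           + c\<^sup>2 / 2 * ((max 0 ((s - 2/c) - t))\<^sup>2 * q t)" for t
        proof -
          have e: "c * (s - t) - 1 = c * ((s - 1/c) - t)" "c * (s - t) - 2 = c * ((s - 2/c) - t)"
            using c by (simp_all add: field_simps)
          show ?thesis unfolding spline_step_def c_def[symmetric] e m by (simp add: field_simps)
        qed
        have "0 < 2/c" "1/c < 2/c" using c by (auto simp: field_simps)
        then have s3: "0 < s - 1/c" "s - 1/c < T" "0 < s - 2/c" "s - 2/c < T" using s sc c by auto
        show ?case unfolding k
          using mq[OF s] mq[OF s3(1,2)] mq[OF s3(3,4)] imq[OF s] imq[OF s3(1,2)] imq[OF s3(3,4)] by simp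
      qed
    qed
    then have "(\<lambda>n. LBINT t. ?k n t * q t) \<longlonglongrightarrow> 0" by (rule tendsto_eventually)
    ultimately show ?thesis using LIMSEQ_unique by blast
  qed
  \<comment> \<open>The equation is tested with \<open>s < T\<close> only; the total integral is
    reached by letting \<open>s\<close> tend to \<open>T\<close>, and it is what converts integrals
    to the left of \<open>s\<close> into tail integrals.\<close>
  have tot: "(LBINT t. q t) = 0"
  proof -
    let ?s = "\<lambda>n::nat. T - T / real (n + 2)"
    have "(\<lambda>n. LBINT t. q t * indicator {..<?s n} t) \<longlonglongrightarrow> (LBINT t. q t)"
    proof (rule integral_dominated_convergence)
      show "integrable lborel (\<lambda>t. \<bar>q t\<bar>)" using q by simp
      show "AE t in lborel. norm (q t * indicator {..<?s n} t) \<le> \<bar>q t\<bar>" for n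
        by (auto split: split_indicator)
      have "?s \<longlonglongrightarrow> T"
        using tendsto_diff[OF tendsto_const[of T] LIMSEQ_ignore_initial_segment[OF lim_const_over_n[of T], of 2]] by simp
      show "AE t in lborel. (\<lambda>n. q t * indicator {..<?s n} t) \<longlonglongrightarrow> q t"
      proof (rule AE_I2)
        fix t
        show "(\<lambda>n. q t * indicator {..<?s n} t) \<longlonglongrightarrow> q t"
        proof (cases "t < T")
          case True
          have "eventually (\<lambda>n. q t * indicator {..<?s n} t = q t) sequentially"
            using order_tendstoD(1)[OF \<open>?s \<longlonglongrightarrow> T\<close> True] by eventually_elim simp
          then show ?thesis by (rule tendsto_eventually)
        qed (use q0[of t] in auto)
      qed
    qed measurable
    moreover have "(LBINT t. q t * indicator {..<?s n} t) = 0" for n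
      using T by (intro lt) (auto simp: field_simps add_pos_nonneg)
    ultimately show ?thesis by (simp add: LIMSEQ_const_iff)
  qed
  have "AE t in lborel. q t = 0"
  proof (rule AE_zero_if_tail_integrals_zero[OF q])
    fix s
    show "(LBINT t. q t * indicator {s<..} t) = 0"
    proof -
      consider "s \<le> 0" | "0 < s" "s < T" | "T \<le> s" by linarith
      then show ?thesis
      proof cases
        case 1
        then have "q t * indicator {s<..} t = q t" for t using q0[of t] by (auto split: split_indicator)
        then show ?thesis using tot by (simp only:)
      next
        case 2
        have "(LBINT t. q t * indicator {s<..} t) = (LBINT t. q t - q t * indicator {..<s} t)"
        proof (rule integral_cong_AE)
          show "AE t in lborel. q t * indicator {s<..} t = q t - q t * indicator {..<s} t"
            using AE_lborel_singleton[of s] by eventually_elim (auto split: split_indicator)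
        qed auto
        also have "\<dots> = 0" using tot lt[OF 2] q integrable_indicator_mult[OF q, of "{..<s}"] by simp
        finally show ?thesis .
      next
        case 3
        then have "q t * indicator {s<..} t = 0" for t using q0[of t] by (auto split: split_indicator)
        then have "(LBINT t. q t * indicator {s<..} t) = (\<integral>t. 0 \<partial>(lborel::real measure))" by (simp only:)
        then show ?thesis by simp
      qed
    qed
  qed
  then show ?thesis by eventually_elim (auto simp: q_def B_def)
qed

subsection \<open>The mollified equation\<close>

definition spacetime_L2 :: "(real \<Rightarrow> 'a::euclidean_space \<Rightarrow> real) \<Rightarrow> bool" where
  "spacetime_L2 v \<longleftrightarrow> L2 (\<lambda>z. v (fst z) (snd z))"

lemma spacetime_L2_measurable: "spacetime_L2 v \<Longrightarrow> (\<lambda>(t,x). v t x) \<in> borel_measurable (borel \<Otimes>\<^sub>M borel)"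
  by (simp add: spacetime_L2_def L2_def borel_prod case_prod_beta')

lemma spacetime_L2_integrable: "spacetime_L2 v \<Longrightarrow> integrable (lborel \<Otimes>\<^sub>M lborel) (\<lambda>(t,x). (v t x)\<^sup>2)"
  by (simp add: spacetime_L2_def L2_def lborel_prod case_prod_beta')

lemma spacetime_L2_mult_integrable:
  "spacetime_L2 v \<Longrightarrow> spacetime_L2 v' \<Longrightarrow> integrable (lborel \<Otimes>\<^sub>M lborel) (\<lambda>(t,x). v t x * v' t x)"
  unfolding spacetime_L2_def lborel_prod case_prod_beta' by (rule L2_mult_integrable)

lemma spacetime_L2_add: "spacetime_L2 v \<Longrightarrow> spacetime_L2 v' \<Longrightarrow> spacetime_L2 (\<lambda>t x. v t x + v' t x)"
  unfolding spacetime_L2_def by (rule L2_add)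

lemma spacetime_L2_diff: "spacetime_L2 v \<Longrightarrow> spacetime_L2 v' \<Longrightarrow> spacetime_L2 (\<lambda>t x. v t x - v' t x)"
  unfolding spacetime_L2_def by (rule L2_diff)

lemma spacetime_L2_cmult: "spacetime_L2 v \<Longrightarrow> spacetime_L2 (\<lambda>t x. c * v t x)"
  unfolding spacetime_L2_def by (rule L2_cmult)

lemma spacetime_L2_section: assumes "spacetime_L2 v" shows "AE t in lborel. L2 (v t)"
proof -
  note [measurable] = spacetime_L2_measurable[OF assms]
  have "AE t in lborel. integrable lborel (\<lambda>x. (v t x)\<^sup>2)"
    using lborel_pair.AE_integrable_fst'[OF spacetime_L2_integrable[OF assms]] by simp
  then show ?thesis by eventually_elim (auto simp: L2_def)
qed

lemma spacetime_L2_time_integrable: "spacetime_L2 v \<Longrightarrow> integrable lborel (\<lambda>t. LBINT x. (v t x)\<^sup>2)"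
  using lborel_pair.integrable_fst'[OF spacetime_L2_integrable] by fastforce

lemma spacetime_L2I:
  fixes v :: "real \<Rightarrow> 'a::euclidean_space \<Rightarrow> real"
  assumes m: "(\<lambda>(t,x). v t x) \<in> borel_measurable (borel \<Otimes>\<^sub>M borel)"
    and f: "(\<integral>\<^sup>+t. \<integral>\<^sup>+x. ennreal ((v t x)\<^sup>2) \<partial>lborel \<partial>lborel) < \<infinity>"
  shows "spacetime_L2 v"
proof -
  note [measurable] = m
  have "(\<integral>\<^sup>+z. ennreal ((v (fst z) (snd z))\<^sup>2) \<partial>(lborel \<Otimes>\<^sub>M lborel)) < \<infinity>"
    using f by (subst lborel.nn_integral_fst[symmetric]) auto
  moreover have "(\<lambda>z. v (fst z) (snd z)) \<in> borel_measurable borel"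
    using m by (simp add: borel_prod case_prod_beta')
  ultimately show ?thesis
    unfolding spacetime_L2_def L2_def by (auto intro!: integrableI_bounded simp: lborel_prod)
qed

lemma mollify_measurable_pair:
  fixes v :: "real \<Rightarrow> 'a::euclidean_space \<Rightarrow> real"
  assumes psi: "Cc \<psi>" and v: "(\<lambda>(t,x). v t x) \<in> borel_measurable (borel \<Otimes>\<^sub>M borel)"
  shows "(\<lambda>(t,y). mollify \<psi> (v t) y) \<in> borel_measurable (borel \<Otimes>\<^sub>M borel)"
proof -
  note [measurable] = Cc_measurable[OF psi] v
  show ?thesis unfolding mollify_def by measurable
qed

lemma spacetime_L2_mollify:
  fixes v :: "real \<Rightarrow> 'a::euclidean_space \<Rightarrow> real"
  assumes psi: "Cc \<psi>" and v: "spacetime_L2 v"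
  shows "spacetime_L2 (\<lambda>t. mollify \<psi> (v t))"
proof (rule spacetime_L2I[OF mollify_measurable_pair[OF psi spacetime_L2_measurable[OF v]]])
  let ?c = "(LBINT x. \<bar>\<psi> x\<bar>)\<^sup>2"
  have "(\<integral>\<^sup>+t. \<integral>\<^sup>+y. ennreal ((mollify \<psi> (v t) y)\<^sup>2) \<partial>lborel \<partial>lborel) \<le> (\<integral>\<^sup>+t. ennreal (?c * (LBINT x. (v t x)\<^sup>2)) \<partial>lborel)"
    by (rule nn_integral_mono_AE) (use spacetime_L2_section[OF v] in \<open>eventually_elim, simp add: young_L2[OF psi]\<close>)
  also have "\<dots> < \<infinity>"
    using spacetime_L2_time_integrable[OF v] by (subst nn_integral_eq_integral) auto
  finally show "(\<integral>\<^sup>+t. \<integral>\<^sup>+y. ennreal ((mollify \<psi> (v t) y)\<^sup>2) \<partial>lborel \<partial>lborel) < \<infinity>" .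
qed

lemma mollify_zero: "(\<And>x. f x = 0) \<Longrightarrow> mollify \<psi> f y = 0"
  by (simp add: mollify_def)

text \<open>Needed at every fixed point \<open>y\<close>, so that the equation can be read as an
  ordinary differential equation there. The dominating function contains a term constant in time,
  which is integrable because the time interval is bounded.\<close>

lemma mollify_time_integrable:
  fixes v :: "real \<Rightarrow> 'a::euclidean_space \<Rightarrow> real"
  assumes psi: "Cc \<psi>" and v: "spacetime_L2 v" and v0: "\<And>t x. t \<notin> {0<..<T} \<Longrightarrow> v t x = 0"
  shows "integrable lborel (\<lambda>t. mollify \<psi> (v t) y)"
proof (rule Bochner_Integration.integrable_bound)
  note [measurable] = mollify_measurable_pair[OF psi spacetime_L2_measurable[OF v]]
  let ?I = "LBINT x. (\<psi> x)\<^sup>2"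
  have "emeasure lborel {0<..<T} < \<infinity>" by (intro emeasure_bounded_finite) simp
  then show "integrable lborel (\<lambda>t. ?I * indicator {0<..<T} t + (LBINT x. (v t x)\<^sup>2))"
    using spacetime_L2_time_integrable[OF v]
    by (intro Bochner_Integration.integrable_add integrable_mult_right integrable_real_indicator)
       auto
  show "(\<lambda>t. mollify \<psi> (v t) y) \<in> borel_measurable lborel" by measurable
  show "AE t in lborel. norm (mollify \<psi> (v t) y) \<le> norm (?I * indicator {0<..<T} t + (LBINT x. (v t x)\<^sup>2))"
    using spacetime_L2_section[OF v]
  proof eventually_elim
    case (elim t)
    show ?case
    proof (cases "t \<in> {0<..<T}")
      case True
      then show ?thesis using mollify_abs_le[OF psi elim, of y] by simp
    next
      case False
      then show ?thesis using mollify_zero[of "v t" \<psi> y] v0[OF False] by simp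
    qed
  qed
qed

text \<open>With \<open>z\<close> the mollification of \<open>w\<close>, \<open>eqn\<close>
  expresses \<open>z' = \<nu> \<Delta> z - div (\<rho> * G)\<close> at the point \<open>y\<close>,
  with initial value 0. All derivatives sit on the kernel, and each one in \<open>y\<close> reverses
  the sign: the Laplacian is unaffected, while the divergence shows up with a plus. The flux
  \<open>(G1, G2)\<close> is an arbitrary square integrable source here; its relation to
  \<open>w\<close> enters only in the continuation argument.\<close>

locale mollified_equation =
  fixes \<nu> T :: real and \<rho> \<rho>1 \<rho>2 \<rho>11 \<rho>22 :: "real \<times> real \<Rightarrow> real"
    and w G1 G2 :: "real \<Rightarrow> real \<times> real \<Rightarrow> real"
  assumes nu: "\<nu> > 0" and T: "T > 0"
    and Cc: "Cc \<rho>" "Cc \<rho>1" "Cc \<rho>2" "Cc \<rho>11" "Cc \<rho>22"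
    and dd: "has_dir_deriv (1,0) \<rho> \<rho>1" "has_dir_deriv (0,1) \<rho> \<rho>2" "has_dir_deriv (1,0) \<rho>1 \<rho>11" "has_dir_deriv (0,1) \<rho>2 \<rho>22"
    and rho: "\<And>x. 0 \<le> \<rho> x" "(LBINT x. \<rho> x) = 1"
    and st: "spacetime_L2 w" "spacetime_L2 G1" "spacetime_L2 G2"
    and zero: "\<And>t x. t \<notin> {0<..<T} \<Longrightarrow> w t x = 0" "\<And>t x. t \<notin> {0<..<T} \<Longrightarrow> G1 t x = 0"
      "\<And>t x. t \<notin> {0<..<T} \<Longrightarrow> G2 t x = 0"
    and eqn: "\<And>s y. 0 < s \<Longrightarrow> s < T \<Longrightarrow>
       (LBINT t. - 3 * (max 0 (s - t))\<^sup>2 * mollify \<rho> (w t) y + (max 0 (s - t)) ^ 3 *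
          (\<nu> * (mollify \<rho>11 (w t) y + mollify \<rho>22 (w t) y) + (mollify \<rho>1 (G1 t) y + mollify \<rho>2 (G2 t) y))) = 0"
begin

definition z where "z t y = mollify \<rho> (w t) y"

definition rhs where
  "rhs t y = \<nu> * (mollify \<rho>11 (w t) y + mollify \<rho>22 (w t) y) + (mollify \<rho>1 (G1 t) y + mollify \<rho>2 (G2 t) y)"

definition dissip where
  "dissip t = (LBINT y. (mollify \<rho>1 (w t) y)\<^sup>2) + (LBINT y. (mollify \<rho>2 (w t) y)\<^sup>2)"

definition flux where
  "flux t = (LBINT y. (G1 t y)\<^sup>2) + (LBINT y. (G2 t y)\<^sup>2)"

lemma spacetime_L2_z: "spacetime_L2 z" unfolding z_def by (intro spacetime_L2_mollify Cc st)

lemma spacetime_L2_rhs: "spacetime_L2 rhs"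
  unfolding rhs_def by (intro spacetime_L2_add spacetime_L2_cmult spacetime_L2_mollify Cc st)

lemma dissip_nonneg: "0 \<le> dissip t" by (simp add: dissip_def)

lemma flux_nonneg: "0 \<le> flux t" by (simp add: flux_def)

lemma dissip_integrable: "integrable lborel dissip"
  unfolding dissip_def by (intro Bochner_Integration.integrable_add spacetime_L2_time_integrable spacetime_L2_mollify Cc st)

lemma flux_integrable: "integrable lborel flux"
  unfolding flux_def by (intro Bochner_Integration.integrable_add spacetime_L2_time_integrable st)

text \<open>Integration by parts leaves \<open>- \<nu> * dissip t\<close> and a pairing of the
  mollified flux with the gradient of \<open>z\<close>. Completing the square spends one half of the
  doubled dissipation on the pairing; the contraction property then replaces the mollified flux by
  the flux itself.\<close>

lemma power_estimate:
  "AE t in lborel. 2 * (LBINT y. rhs t y * z t y) \<le> flux t / \<nu> - \<nu> * dissip t"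
  using spacetime_L2_section[OF st(1)] spacetime_L2_section[OF st(2)] spacetime_L2_section[OF st(3)]
proof eventually_elim
  case (elim t)
  note L = elim
  let ?D1 = "mollify \<rho>1 (w t)" and ?D2 = "mollify \<rho>2 (w t)" and ?E1 = "mollify \<rho> (G1 t)" and ?E2 = "mollify \<rho> (G2 t)"
  have i: "integrable lborel (\<lambda>y. mollify \<psi> f y * mollify \<rho> (w t) y)" if "Cc \<psi>" "L2 f" for \<psi> f
    by (intro L2_mult_integrable L2_mollify that Cc L)
  have "(LBINT y. rhs t y * z t y) = (LBINT y. \<nu> * (mollify \<rho>11 (w t) y * mollify \<rho> (w t) y) + \<nu> * (mollify \<rho>22 (w t) y * mollify \<rho> (w t) y)
      + (mollify \<rho>1 (G1 t) y * mollify \<rho> (w t) y + mollify \<rho>2 (G2 t) y * mollify \<rho> (w t) y))"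
    by (intro Bochner_Integration.integral_cong) (auto simp: rhs_def z_def algebra_simps)
  also have "\<dots> = \<nu> * (LBINT y. mollify \<rho>11 (w t) y * mollify \<rho> (w t) y) + \<nu> * (LBINT y. mollify \<rho>22 (w t) y * mollify \<rho> (w t) y)
      + ((LBINT y. mollify \<rho>1 (G1 t) y * mollify \<rho> (w t) y) + (LBINT y. mollify \<rho>2 (G2 t) y * mollify \<rho> (w t) y))"
    using i[OF Cc(4) L(1)] i[OF Cc(5) L(1)] i[OF Cc(2) L(2)] i[OF Cc(3) L(3)] by simp
  also have "\<dots> = - \<nu> * dissip t - ((LBINT y. ?E1 y * ?D1 y) + (LBINT y. ?E2 y * ?D2 y))"
    unfolding integral_mollify_by_parts[OF Cc(2) Cc(4) dd(3) Cc(1) Cc(2) dd(1) L(1) L(1)]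
      integral_mollify_by_parts[OF Cc(3) Cc(5) dd(4) Cc(1) Cc(3) dd(2) L(1) L(1)]
      integral_mollify_by_parts[OF Cc(1) Cc(2) dd(1) Cc(1) Cc(2) dd(1) L(2) L(1)]
      integral_mollify_by_parts[OF Cc(1) Cc(3) dd(2) Cc(1) Cc(3) dd(2) L(3) L(1)]
    by (simp add: dissip_def power2_eq_square algebra_simps)
  finally have eq: "(LBINT y. rhs t y * z t y) = - \<nu> * dissip t - ((LBINT y. ?E1 y * ?D1 y) + (LBINT y. ?E2 y * ?D2 y))" .
  have ED: "- 2 * (LBINT y. mollify \<rho> G y * D y) \<le> \<nu> * (LBINT y. (D y)\<^sup>2) + (LBINT y. (G y)\<^sup>2) / \<nu>"
    if G: "L2 G" and D: "L2 D" for G D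
  proof -
    have E: "L2 (mollify \<rho> G)" by (intro L2_mollify Cc G)
    have "- 2 * (LBINT y. mollify \<rho> G y * D y) = (LBINT y. - 2 * (mollify \<rho> G y * D y))" by simp
    also have "\<dots> \<le> (LBINT y. \<nu> * (D y)\<^sup>2 + (mollify \<rho> G y)\<^sup>2 / \<nu>)"
    proof (rule integral_mono)
      show "integrable lborel (\<lambda>y. - 2 * (mollify \<rho> G y * D y))" using L2_mult_integrable[OF E D] by simp
      show "integrable lborel (\<lambda>y. \<nu> * (D y)\<^sup>2 + (mollify \<rho> G y)\<^sup>2 / \<nu>)" using L2_integrable[OF E] L2_integrable[OF D] by simp
      fix y
      have "0 \<le> (\<nu> * D y + mollify \<rho> G y)\<^sup>2 / \<nu>" using nu by simp
      also have "\<dots> = \<nu> * (D y)\<^sup>2 + (mollify \<rho> G y)\<^sup>2 / \<nu> + 2 * (mollify \<rho> G y * D y)"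
        using nu by (simp add: power2_eq_square field_simps)
      finally show "- 2 * (mollify \<rho> G y * D y) \<le> \<nu> * (D y)\<^sup>2 + (mollify \<rho> G y)\<^sup>2 / \<nu>" by simp
    qed
    also have "\<dots> = \<nu> * (LBINT y. (D y)\<^sup>2) + (LBINT y. (mollify \<rho> G y)\<^sup>2) / \<nu>"
      using L2_integrable[OF E] L2_integrable[OF D] by simp
    also have "\<dots> \<le> \<nu> * (LBINT y. (D y)\<^sup>2) + (LBINT y. (G y)\<^sup>2) / \<nu>"
      using integral_mollify_sq_le[OF Cc(1) G] rho nu by (simp add: divide_right_mono)
    finally show ?thesis .
  qed
  have "- 2 * (LBINT y. ?E1 y * ?D1 y) - 2 * (LBINT y. ?E2 y * ?D2 y) \<le> \<nu> * dissip t + flux t / \<nu>"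
    using ED[OF L(2) L2_mollify[OF Cc(2) L(1)]] ED[OF L(3) L2_mollify[OF Cc(3) L(1)]]
    by (simp add: dissip_def flux_def algebra_simps add_divide_distrib)
  then show ?case unfolding eq by simp
qed

lemma duhamel:
  "AE t in lborel. t \<in> {0<..<T} \<longrightarrow> z t y = (LBINT s. rhs s y * indicator {..<t} s)"
proof (rule weak_ode[OF T])
  show "integrable lborel (\<lambda>t. z t y)"
    unfolding z_def by (rule mollify_time_integrable[OF Cc(1) st(1) zero(1)])
  show "integrable lborel (\<lambda>t. rhs t y)"
    unfolding rhs_def
    by (intro Bochner_Integration.integrable_add integrable_mult_right
        mollify_time_integrable[OF _ st(1) zero(1)] mollify_time_integrable[OF _ st(2) zero(2)] mollify_time_integrable[OF _ st(3) zero(3)] Cc)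
  show "z t y = 0" if "t \<notin> {0<..<T}" for t
    unfolding z_def by (rule mollify_zero) (rule zero(1)[OF that])
  show "rhs t y = 0" if "t \<notin> {0<..<T}" for t
    unfolding rhs_def by (simp add: mollify_zero zero[OF that])
  show "(LBINT t. - 3 * (max 0 (s - t))\<^sup>2 * z t y + (max 0 (s - t)) ^ 3 * rhs t y) = 0" if "0 < s" "s < T" for s
    unfolding z_def rhs_def by (rule eqn[OF that])
qed

text \<open>At each point \<open>y\<close>, \<open>z\<close> agrees for almost every time with a
  primitive of \<open>rhs\<close>; \<open>primitive_square\<close> is applied pointwise and the
  result is integrated over \<open>y\<close>.\<close>

lemma energy_identity:
  "AE t in lborel. t \<in> {0<..<T} \<longrightarrow>
     (LBINT y. (z t y)\<^sup>2) = (LBINT s. 2 * (LBINT y. rhs s y * z s y) * indicator {..<t} s)"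
proof -
  note [measurable] = spacetime_L2_measurable[OF spacetime_L2_z] spacetime_L2_measurable[OF spacetime_L2_rhs]
  define B where "B t y = (LBINT s. rhs s y * (if s < t then 1 else 0))" for t y
  have [measurable]: "(\<lambda>(t,y). B t y) \<in> borel_measurable (borel \<Otimes>\<^sub>M borel)"
    unfolding B_def by measurable
  have B: "B t y = (LBINT s. rhs s y * indicator {..<t} s)" for t y
    unfolding B_def by (intro Bochner_Integration.integral_cong) (auto split: split_indicator)
  have zB: "AE t in lborel. t \<in> {0<..<T} \<longrightarrow> z t y = B t y" for y
    using duhamel[of y] by (simp add: B)
  have rhs0: "rhs t y = 0" if "t \<notin> {0<..<T}" for t y
    unfolding rhs_def by (simp add: mollify_zero zero[OF that])
  have irhs: "integrable lborel (\<lambda>t. rhs t y)" for y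
    unfolding rhs_def
    by (intro Bochner_Integration.integrable_add integrable_mult_right
        mollify_time_integrable[OF _ st(1) zero(1)] mollify_time_integrable[OF _ st(2) zero(2)] mollify_time_integrable[OF _ st(3) zero(3)] Cc)
  have sq: "(B t y)\<^sup>2 = (LBINT s. 2 * (rhs s y * z s y) * indicator {..<t} s)" for t y
  proof -
    have "(B t y)\<^sup>2 = 2 * (LBINT s. rhs s y * B s y * indicator {..<t} s)"
      unfolding B by (rule primitive_square[OF irhs])
    also have "(LBINT s. rhs s y * B s y * indicator {..<t} s) = (LBINT s. rhs s y * z s y * indicator {..<t} s)"
    proof (rule integral_cong_AE)
      show "AE s in lborel. rhs s y * B s y * indicator {..<t} s = rhs s y * z s y * indicator {..<t} s"
        using zB[of y]
      proof eventually_elim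
        case (elim s)
        then show ?case using rhs0[of s y] by (cases "s \<in> {0<..<T}") auto
      qed
    qed measurable
    finally show ?thesis by (simp add: mult.assoc)
  qed
  have "AE y in lborel. AE t in lborel. t \<in> {0<..<T} \<longrightarrow> z t y = B t y"
    using zB by simp
  \<comment> \<open>The exceptional times depend on \<open>y\<close>. Interchanging the two
    quantifiers gives equality at almost every point for almost every time, which suffices for the
    integral over \<open>y\<close>.\<close>
  then have "AE t in lborel. AE y in lborel. t \<in> {0<..<T} \<longrightarrow> z t y = B t y"
    by (rule iffD2[OF lborel_pair.AE_commute, rotated]) measurable
  then show ?thesis
  proof eventually_elim
    case (elim t)
    show ?case
    proof
      assume t: "t \<in> {0<..<T}"
      have "(LBINT y. (z t y)\<^sup>2) = (LBINT y. (B t y)\<^sup>2)"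
        by (rule integral_cong_AE) (use elim t in auto)
      also have "\<dots> = (LBINT y. LBINT s. 2 * (rhs s y * z s y) * indicator {..<t} s)"
        by (simp add: sq)
      also have "\<dots> = (LBINT s. LBINT y. 2 * (rhs s y * z s y) * indicator {..<t} s)"
      proof (rule lborel_pair.Fubini_integral)
        have "integrable (lborel \<Otimes>\<^sub>M lborel) (\<lambda>x. 2 * (case x of (s,y) \<Rightarrow> rhs s y * z s y))"
          using spacetime_L2_mult_integrable[OF spacetime_L2_rhs spacetime_L2_z] by simp
        then show "integrable (lborel \<Otimes>\<^sub>M lborel) (\<lambda>(s,y). 2 * (rhs s y * z s y) * indicator {..<t} s)"
          by (rule Bochner_Integration.integrable_bound) (auto split: split_indicator)
      qed
      finally show "(LBINT y. (z t y)\<^sup>2) = (LBINT s. 2 * (LBINT y. rhs s y * z s y) * indicator {..<t} s)"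
        by simp
    qed
  qed
qed

lemma energy_estimate:
  "AE t in lborel. t \<in> {0<..<T} \<longrightarrow>
     (LBINT y. (z t y)\<^sup>2) + \<nu> * (LBINT s. dissip s * indicator {..<t} s)
       \<le> (LBINT s. flux s * indicator {..<t} s) / \<nu>"
  using energy_identity
proof eventually_elim
  case (elim t)
  show ?case
  proof
    assume t: "t \<in> {0<..<T}"
    have i1: "integrable lborel (\<lambda>s. flux s * indicator {..<t} s)"
      by (rule integrable_indicator_mult[OF flux_integrable]) simp
    have i2: "integrable lborel (\<lambda>s. dissip s * indicator {..<t} s)"
      by (rule integrable_indicator_mult[OF dissip_integrable]) simp
    have i0: "integrable lborel (\<lambda>s. LBINT y. rhs s y * z s y)"
      using lborel_pair.integrable_fst'[OF spacetime_L2_mult_integrable[OF spacetime_L2_rhs spacetime_L2_z]] by simp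
    have "(LBINT s. 2 * (LBINT y. rhs s y * z s y) * indicator {..<t} s) \<le>
       (LBINT s. flux s * indicator {..<t} s / \<nu> - \<nu> * (dissip s * indicator {..<t} s))"
    proof (rule integral_mono_AE)
      show "integrable lborel (\<lambda>s. 2 * (LBINT y. rhs s y * z s y) * indicator {..<t} s)"
        using i0 by (intro integrable_indicator_mult) auto
      show "integrable lborel (\<lambda>s. flux s * indicator {..<t} s / \<nu> - \<nu> * (dissip s * indicator {..<t} s))"
        using i1 i2 by simp
      show "AE s in lborel. 2 * (LBINT y. rhs s y * z s y) * indicator {..<t} s \<le> flux s * indicator {..<t} s / \<nu> - \<nu> * (dissip s * indicator {..<t} s)"
        using power_estimate by eventually_elim (auto split: split_indicator)
    qed
    also have "\<dots> = (LBINT s. flux s * indicator {..<t} s) / \<nu> - \<nu> * (LBINT s. dissip s * indicator {..<t} s)"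
      using i1 i2 by simp
    finally show "(LBINT y. (z t y)\<^sup>2) + \<nu> * (LBINT s. dissip s * indicator {..<t} s)
       \<le> (LBINT s. flux s * indicator {..<t} s) / \<nu>"
      using elim t by simp
  qed
qed

text \<open>At each time the Ladyzhenskaya inequality gives
  \<open>2 * (LBINT y. (z t y)^2) * dissip t\<close>. With \<open>E\<close> the integral of
  \<open>flux\<close> up to \<open>\<tau>\<close>, the energy estimate bounds the square norm by
  \<open>E / \<nu>\<close> and the integrated dissipation by \<open>E / \<nu>^2\<close>; the product
  is the constant stated.\<close>

lemma L4_estimate:
  assumes \<tau>: "0 < \<tau>" "\<tau> \<le> T"
  shows "(\<integral>\<^sup>+t. (\<integral>\<^sup>+y. ennreal (z t y ^ 4) \<partial>lborel) * indicator {..<\<tau>} t \<partial>lborel)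
     \<le> ennreal (2 / \<nu> ^ 3 * (LBINT s. flux s * indicator {..<\<tau>} s)\<^sup>2)"
proof -
  let ?E = "LBINT s. flux s * indicator {..<\<tau>} s"
  let ?D = "\<lambda>t. LBINT s. dissip s * indicator {..<t} s"
  have E0: "0 \<le> ?E" by (intro Bochner_Integration.integral_nonneg) (simp add: flux_nonneg)
  have Dint: "integrable lborel (\<lambda>s. dissip s * indicator {..<t} s)" for t
    by (rule integrable_indicator_mult[OF dissip_integrable]) simp
  have Fint: "integrable lborel (\<lambda>s. flux s * indicator {..<t} s)" for t
    by (rule integrable_indicator_mult[OF flux_integrable]) simp
  have Fmono: "(LBINT s. flux s * indicator {..<t} s) \<le> ?E" if "t \<le> \<tau>" for t
    by (rule integral_mono[OF Fint Fint]) (use that flux_nonneg in \<open>auto split: split_indicator\<close>)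
  have AEz: "AE t in lborel. t \<in> {0<..<\<tau>} \<longrightarrow> (LBINT y. (z t y)\<^sup>2) \<le> ?E / \<nu> \<and> ?D t \<le> ?E / \<nu>\<^sup>2"
    using energy_estimate
  proof eventually_elim
    case (elim t)
    show ?case
    proof
      assume t: "t \<in> {0<..<\<tau>}"
      then have *: "(LBINT y. (z t y)\<^sup>2) + \<nu> * ?D t \<le> (LBINT s. flux s * indicator {..<t} s) / \<nu>"
        using elim \<tau> by auto
      also have "\<dots> \<le> ?E / \<nu>" using Fmono[of t] t nu by (simp add: divide_right_mono)
      finally have **: "(LBINT y. (z t y)\<^sup>2) + \<nu> * ?D t \<le> ?E / \<nu>" .
      have "0 \<le> ?D t" by (intro Bochner_Integration.integral_nonneg) (simp add: dissip_nonneg)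
      then have "0 \<le> \<nu> * ?D t" using nu by simp
      moreover have "0 \<le> (LBINT y. (z t y)\<^sup>2)" by simp
      ultimately have "(LBINT y. (z t y)\<^sup>2) \<le> ?E / \<nu>" "\<nu> * ?D t \<le> ?E / \<nu>" using ** by linarith+
      then show "(LBINT y. (z t y)\<^sup>2) \<le> ?E / \<nu> \<and> ?D t \<le> ?E / \<nu>\<^sup>2"
        using nu by (simp add: field_simps power2_eq_square)
    qed
  qed
  \<comment> \<open>The energy estimate holds for almost every time before \<open>\<tau>\<close> and
    may miss \<open>\<tau>\<close> itself. As \<open>?D\<close> is monotone and continuous from the
    left, a violation at \<open>\<tau>\<close> would persist on a whole interval before it.\<close>
  have Dtau: "?D \<tau> \<le> ?E / \<nu>\<^sup>2"
  proof (rule ccontr)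
    assume c: "\<not> ?thesis"
    have "(\<lambda>n. ?D (\<tau> - \<tau> / real (n + 2))) \<longlonglongrightarrow> ?D \<tau>"
    proof (rule integral_dominated_convergence[OF _ _ dissip_integrable])
      have lim: "(\<lambda>n. \<tau> - \<tau> / real (n + 2)) \<longlonglongrightarrow> \<tau>"
        using tendsto_diff[OF tendsto_const[of \<tau>] LIMSEQ_ignore_initial_segment[OF lim_const_over_n[of \<tau>], of 2]] by simp
      show "AE s in lborel. (\<lambda>n. dissip s * indicator {..<\<tau> - \<tau> / real (n + 2)} s) \<longlonglongrightarrow> dissip s * indicator {..<\<tau>} s"
      proof (rule AE_I2)
        fix s
        show "(\<lambda>n. dissip s * indicator {..<\<tau> - \<tau> / real (n + 2)} s) \<longlonglongrightarrow> dissip s * indicator {..<\<tau>} s"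
        proof (cases "s < \<tau>")
          case True
          have "eventually (\<lambda>n. dissip s * indicator {..<\<tau> - \<tau> / real (n + 2)} s = dissip s * indicator {..<\<tau>} s) sequentially"
            using order_tendstoD(1)[OF lim True] by eventually_elim (use True in simp)
          then show ?thesis by (rule tendsto_eventually)
        next
          case False
          have "\<tau> - \<tau> / real (n + 2) \<le> s" for n using False \<tau> by (smt (verit) divide_nonneg_nonneg of_nat_0_le_iff)
          then have "indicator {..<\<tau> - \<tau> / real (n + 2)} s = (0::real)" for n by (simp add: not_less)
          then show ?thesis using False by simp
        qed
      qed
    qed (use dissip_integrable dissip_nonneg in \<open>auto split: split_indicator intro!: borel_measurable_times\<close>)
    from order_tendstoD(1)[OF this, of "?E / \<nu>\<^sup>2"] c
    obtain n where n: "?D (\<tau> - \<tau> / real (n + 2)) > ?E / \<nu>\<^sup>2" by (auto simp: eventually_sequentially)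
    define t0 where "t0 = \<tau> - \<tau> / real (n + 2)"
    have t0: "0 < t0" "t0 < \<tau>" using \<tau> by (auto simp: t0_def field_simps add_pos_nonneg)
    have "\<not> (AE t in lborel. t \<notin> {t0<..<\<tau>})"
    proof
      assume "AE t in lborel. t \<notin> {t0<..<\<tau>}"
      then have "{t0<..<\<tau>} \<in> null_sets lborel" by (subst AE_iff_null_sets) simp_all
      then have "emeasure lborel {t0<..<\<tau>} = 0" by (rule null_setsD1)
      then show False using t0 by (simp add: emeasure_lborel_Ioo)
    qed
    moreover have "AE t in lborel. t \<notin> {t0<..<\<tau>}"
      using AEz
    proof eventually_elim
      case (elim t)
      show ?case
      proof
        assume t: "t \<in> {t0<..<\<tau>}"
        then have "?D t0 \<le> ?D t"
          by (intro integral_mono Dint) (use dissip_nonneg in \<open>auto split: split_indicator\<close>)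
        then show False using elim t t0 n by (auto simp: t0_def)
      qed
    qed
    ultimately show False by simp
  qed
  have "(\<integral>\<^sup>+t. (\<integral>\<^sup>+y. ennreal (z t y ^ 4) \<partial>lborel) * indicator {..<\<tau>} t \<partial>lborel)
     \<le> (\<integral>\<^sup>+t. ennreal (2 * ?E / \<nu>) * ennreal (dissip t * indicator {..<\<tau>} t) \<partial>lborel)"
  proof (rule nn_integral_mono_AE)
    show "AE t in lborel. (\<integral>\<^sup>+y. ennreal (z t y ^ 4) \<partial>lborel) * indicator {..<\<tau>} t \<le> ennreal (2 * ?E / \<nu>) * ennreal (dissip t * indicator {..<\<tau>} t)"
      using AEz spacetime_L2_section[OF st(1)]
    proof eventually_elim
      case (elim t)
      show ?case
      proof (cases "t \<in> {0<..<\<tau>}")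
        case True
        have zt: "z t = mollify \<rho> (w t)" by (simp add: z_def fun_eq_iff)
        have sqm: "(LBINT y. (- mollify \<psi> (w t) y)\<^sup>2) = (LBINT y. (mollify \<psi> (w t) y)\<^sup>2)" for \<psi> by simp
        have mL: "L2 (\<lambda>y. - mollify \<psi> (w t) y)" if "Cc \<psi>" for \<psi>
          using L2_cmult[OF L2_mollify[OF that elim(2)], of "-1"] by simp
        have "(\<integral>\<^sup>+y. ennreal (z t y ^ 4) \<partial>lborel) \<le> ennreal (2 * (LBINT y. (z t y)\<^sup>2) * dissip t)"
          using ladyzhenskaya[of "z t" "\<lambda>y. - mollify \<rho>1 (w t) y" "\<lambda>y. - mollify \<rho>2 (w t) y"]
          unfolding sqm dissip_def[symmetric]
          unfolding zt by (simp add: L2_mollify continuous_mollify has_dir_deriv_mollify dd Cc elim mL continuous_intros)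
        also have "\<dots> \<le> ennreal (2 * ?E / \<nu> * dissip t)"
          using elim(1) True dissip_nonneg[of t]
          by (intro ennreal_leI mult_right_mono) auto
        also have "\<dots> = ennreal (2 * ?E / \<nu>) * ennreal (dissip t)"
          using E0 nu dissip_nonneg by (intro ennreal_mult) auto
        finally show ?thesis using True by simp
      next
        case False
        then consider "t \<le> 0" | "\<tau> \<le> t" by fastforce
        then show ?thesis
        proof cases
          case 1
          then have "z t y = 0" for y unfolding z_def by (intro mollify_zero zero) auto
          then show ?thesis by simp
        qed simp
      qed
    qed
  qed
  also have "\<dots> = ennreal (2 * ?E / \<nu>) * ennreal (?D \<tau>)"
    using Dint[of \<tau>] dissip_nonneg
    by (subst nn_integral_cmult) (auto simp: nn_integral_eq_integral intro!: borel_measurable_integrable)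
  also have "\<dots> \<le> ennreal (2 * ?E / \<nu>) * ennreal (?E / \<nu>\<^sup>2)"
    by (intro mult_left_mono ennreal_leI Dtau) auto
  also have "\<dots> = ennreal (2 / \<nu> ^ 3 * ?E\<^sup>2)"
    using E0 nu by (simp add: ennreal_mult[symmetric] power2_eq_square power3_eq_cube)
  finally show ?thesis .
qed

end

subsection \<open>Vanishing by continuation in time\<close>

text \<open>Dominated convergence in time: almost every section converges, and by contraction its
  squared error is at most \<open>2 + 2 = 4\<close> times the squared norm of the section.\<close>

lemma spacetime_L2_mollify_tendsto:
  fixes w :: "real \<Rightarrow> 'a::euclidean_space \<Rightarrow> real"
  assumes rho: "\<And>n. Cc (\<rho> n)" "\<And>n x. 0 \<le> \<rho> n x" "\<And>n. (LBINT x. \<rho> n x) = 1"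
    and supp: "\<And>n x. r n < norm x \<Longrightarrow> \<rho> n x = 0" and r: "r \<longlonglongrightarrow> 0" "\<And>n. r n \<le> 1"
    and w: "spacetime_L2 w"
  shows "(\<lambda>n. \<integral>z. (mollify (\<rho> n) (w (fst z)) (snd z) - w (fst z) (snd z))\<^sup>2 \<partial>(lborel \<Otimes>\<^sub>M lborel)) \<longlonglongrightarrow> 0"
proof -
  have d: "spacetime_L2 (\<lambda>t y. mollify (\<rho> n) (w t) y - w t y)" for n
    by (intro spacetime_L2_diff w spacetime_L2_mollify[OF rho(1) w])
  have eq: "(\<integral>z. (mollify (\<rho> n) (w (fst z)) (snd z) - w (fst z) (snd z))\<^sup>2 \<partial>(lborel \<Otimes>\<^sub>M lborel)) =
      (LBINT t. LBINT y. (mollify (\<rho> n) (w t) y - w t y)\<^sup>2)" for n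
    using lborel_pair.integral_fst'[OF spacetime_L2_integrable[OF d[of n]]] by (simp add: case_prod_beta')
  have "(\<lambda>n. LBINT t. LBINT y. (mollify (\<rho> n) (w t) y - w t y)\<^sup>2) \<longlonglongrightarrow> (\<integral>t. 0 \<partial>(lborel::real measure))"
  proof (rule integral_dominated_convergence)
    show "integrable lborel (\<lambda>t. 4 * (LBINT x. (w t x)\<^sup>2))"
      using spacetime_L2_time_integrable[OF w] by simp
    show "(\<lambda>t. LBINT y. (mollify (\<rho> n) (w t) y - w t y)\<^sup>2) \<in> borel_measurable lborel" for n
      using spacetime_L2_time_integrable[OF d[of n]] by simp
    show "AE t in lborel. (\<lambda>n. LBINT y. (mollify (\<rho> n) (w t) y - w t y)\<^sup>2) \<longlonglongrightarrow> 0"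
      using spacetime_L2_section[OF w] by eventually_elim (rule mollify_tendsto_L2[OF rho supp r])
    fix n
    show "AE t in lborel. norm (LBINT y. (mollify (\<rho> n) (w t) y - w t y)\<^sup>2) \<le> 4 * (LBINT x. (w t x)\<^sup>2)"
      using spacetime_L2_section[OF w]
    proof eventually_elim
      case (elim t)
      have i1: "integrable lborel (\<lambda>y. (mollify (\<rho> n) (w t) y)\<^sup>2)" by (intro L2_integrable L2_mollify rho elim)
      have i2: "integrable lborel (\<lambda>y. (w t y)\<^sup>2)" by (intro L2_integrable elim)
      have "(LBINT y. (mollify (\<rho> n) (w t) y - w t y)\<^sup>2) \<le> (LBINT y. 2 * (mollify (\<rho> n) (w t) y)\<^sup>2 + 2 * (w t y)\<^sup>2)"
      proof (rule integral_mono)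
        show "integrable lborel (\<lambda>y. (mollify (\<rho> n) (w t) y - w t y)\<^sup>2)"
          by (intro L2_integrable L2_diff L2_mollify rho elim)
        show "integrable lborel (\<lambda>y. 2 * (mollify (\<rho> n) (w t) y)\<^sup>2 + 2 * (w t y)\<^sup>2)" using i1 i2 by simp
        fix y
        have "0 \<le> (mollify (\<rho> n) (w t) y + w t y)\<^sup>2" by simp
        then show "(mollify (\<rho> n) (w t) y - w t y)\<^sup>2 \<le> 2 * (mollify (\<rho> n) (w t) y)\<^sup>2 + 2 * (w t y)\<^sup>2"
          by (simp add: power2_eq_square algebra_simps)
      qed
      also have "\<dots> = 2 * (LBINT y. (mollify (\<rho> n) (w t) y)\<^sup>2) + 2 * (LBINT y. (w t y)\<^sup>2)"
        using i1 i2 by simp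
      also have "(LBINT y. (mollify (\<rho> n) (w t) y)\<^sup>2) \<le> (LBINT y. (w t y)\<^sup>2)"
        using integral_mollify_sq_le[OF rho(1) elim, of n] rho(2,3) by simp
      finally show ?case by simp
    qed
  qed simp
  then show ?thesis by (simp add: eq)
qed

text \<open>The intervals \<open>{a..<c}\<close> shrink to the null set \<open>{a}\<close>. This is
  the only source of smallness in the continuation.\<close>

lemma nn_integral_interval_shrink:
  fixes k :: "real \<Rightarrow> ennreal"
  assumes [measurable]: "k \<in> borel_measurable borel" and fin: "(\<integral>\<^sup>+t. k t \<partial>lborel) < \<infinity>"
    and e: "e > 0" and ab: "a < b"
  obtains c where "a < c" "c < b" "(\<integral>\<^sup>+t. k t * indicator {a..<c} t \<partial>lborel) < e"
proof -
  let ?c = "\<lambda>n::nat. a + (b - a) / real (n + 2)"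
  have pos: "0 < (b - a) / real (n + 2)" for n using ab by (intro divide_pos_pos) auto
  have "(\<lambda>n. \<integral>\<^sup>+t. k t * indicator {a..<?c n} t \<partial>lborel) \<longlonglongrightarrow> (\<integral>\<^sup>+t. k t * indicator {a} t \<partial>lborel)"
  proof (rule nn_integral_dominated_convergence[OF _ _ _ _ fin])
    show "AE t in lborel. k t * indicator {a..<?c n} t \<le> k t" for n
      by (auto split: split_indicator)
    show "AE t in lborel. (\<lambda>n. k t * indicator {a..<?c n} t) \<longlonglongrightarrow> k t * indicator {a} t"
    proof (rule AE_I2)
      fix t
      show "(\<lambda>n. k t * indicator {a..<?c n} t) \<longlonglongrightarrow> k t * indicator {a} t"
      proof (cases "t > a")
        case False
        have "?c n > a" for n using pos[of n] by linarith
        then have "indicator {a..<?c n} t = (indicator {a} t :: ennreal)" for n using False by (auto split: split_indicator)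
        then show ?thesis by simp
      next
        case True
        have lim: "?c \<longlonglongrightarrow> a"
          using tendsto_add[OF tendsto_const[of a] LIMSEQ_ignore_initial_segment[OF lim_const_over_n[of "b - a"], of 2]] by simp
        have "eventually (\<lambda>n. k t * indicator {a..<?c n} t = k t * indicator {a} t) sequentially"
          using order_tendstoD(2)[OF lim True] by eventually_elim (use True in simp)
        then show ?thesis by (rule tendsto_eventually)
      qed
    qed
  qed measurable
  also have "(\<integral>\<^sup>+t. k t * indicator {a} t \<partial>lborel) = 0"
    by (subst nn_integral_0_iff_AE) (auto intro!: eventually_mono[OF AE_lborel_singleton[of a]])
  finally have "eventually (\<lambda>n. (\<integral>\<^sup>+t. k t * indicator {a..<?c n} t \<partial>lborel) < e) sequentially"
    using e by (rule order_tendstoD(2))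
  then obtain n where n: "(\<integral>\<^sup>+t. k t * indicator {a..<?c n} t \<partial>lborel) < e"
    using eventually_happens'[OF sequentially_bot] by blast
  show thesis
  proof (rule that[OF _ _ n])
    show "a < ?c n" using pos[of n] by linarith
    have "(b - a) * 1 < (b - a) * real (n + 2)" using ab by (intro mult_strict_left_mono) auto
    then have "(b - a) / real (n + 2) < b - a" by (subst pos_divide_less_eq) auto
    then show "?c n < b" by linarith
  qed
qed

text \<open>The times up to which \<open>w\<close> vanishes have a greatest element, because
  vanishing before a time passes to suprema; a greatest element below \<open>T\<close> could be
  moved further by a step on which \<open>K1\<close> and \<open>K2\<close> are small.\<close>

theorem mollified_uniqueness:
  fixes w K1 K2 :: "real \<Rightarrow> real \<times> real \<Rightarrow> real"
  assumes moll: "\<And>n. mollified_equation \<nu> T (\<rho> n) (\<rho>1 n) (\<rho>2 n) (\<rho>11 n) (\<rho>22 n) w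
        (\<lambda>t x. K1 t x * w t x) (\<lambda>t x. K2 t x * w t x)"
    and supp: "\<And>n x. r n < norm x \<Longrightarrow> \<rho> n x = 0" and r: "r \<longlonglongrightarrow> 0" "\<And>n. r n \<le> 1"
    and K1: "(\<lambda>(t,x). K1 t x) \<in> borel_measurable (borel \<Otimes>\<^sub>M borel)"
    and K2: "(\<lambda>(t,x). K2 t x) \<in> borel_measurable (borel \<Otimes>\<^sub>M borel)"
    and w4: "(\<integral>\<^sup>+t. \<integral>\<^sup>+x. ennreal (w t x ^ 4) \<partial>lborel \<partial>lborel) < \<infinity>"
    and K4: "(\<integral>\<^sup>+t. \<integral>\<^sup>+x. ennreal (((K1 t x)\<^sup>2 + (K2 t x)\<^sup>2)\<^sup>2) * indicator {0<..<T} t \<partial>lborel \<partial>lborel) < \<infinity>"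
  shows "AE z in lborel \<Otimes>\<^sub>M lborel. w (fst z) (snd z) = 0"
proof -
  have nu: "\<nu> > 0" and T: "T > 0" using mollified_equation.nu[OF moll] mollified_equation.T[OF moll] by auto
  have rho: "\<And>n. Cc (\<rho> n)" "\<And>n x. 0 \<le> \<rho> n x" "\<And>n. (LBINT x. \<rho> n x) = 1"
    using mollified_equation.Cc(1)[OF moll] mollified_equation.rho[OF moll] by auto
  note st = mollified_equation.st[OF moll]
  have w0: "w t x = 0" if "t \<notin> {0<..<T}" for t x
    by (rule mollified_equation.zero(1)[OF moll that])
  note [measurable] = spacetime_L2_measurable[OF st(1)] K1 K2
  let ?M = "lborel \<Otimes>\<^sub>M (lborel :: (real \<times> real) measure)"
  define Q where "Q t x = (K1 t x)\<^sup>2 + (K2 t x)\<^sup>2" for t x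
  have [measurable]: "(\<lambda>(t,x). Q t x) \<in> borel_measurable (borel \<Otimes>\<^sub>M borel)" unfolding Q_def by measurable
  have Q0: "0 \<le> Q t x" for t x by (simp add: Q_def)
  define fl where "fl t = (LBINT y. (K1 t y * w t y)\<^sup>2) + (LBINT y. (K2 t y * w t y)\<^sup>2)" for t
  define E where "E \<tau> = (LBINT s. fl s * indicator {..<\<tau>} s)" for \<tau>
  define X where "X \<tau> = (\<integral>\<^sup>+z. ennreal (w (fst z) (snd z) ^ 4) * indicator {..<\<tau>} (fst z) \<partial>?M)" for \<tau>
  \<comment> \<open>Convergence in mean square gives convergence almost everywhere along a
    subsequence, which is enough for Fatou's lemma. The bound is the same for all \<open>n\<close>,
    since \<open>E\<close> involves the flux before mollification.\<close>
  have step1: "X \<tau> \<le> ennreal (2 / \<nu> ^ 3 * (E \<tau>)\<^sup>2)" if \<tau>: "0 < \<tau>" "\<tau> \<le> T" for \<tau>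
  proof -
    note zmeas = mollify_measurable_pair[OF rho(1) spacetime_L2_measurable[OF st(1)]]
    let ?z = "\<lambda>n z. mollify (\<rho> n) (w (fst z)) (snd z)"
    have zm[measurable]: "?z n \<in> borel_measurable ?M" for n
      using zmeas[of n] by (simp add: case_prod_beta')
    have id: "integrable ?M (\<lambda>z. (?z n z - w (fst z) (snd z))\<^sup>2)" for n
      using spacetime_L2_integrable[OF spacetime_L2_diff[OF spacetime_L2_mollify[OF rho(1) st(1)] st(1)], of n] by (simp add: case_prod_beta')
    have "(\<lambda>n. \<integral>z. norm ((?z n z - w (fst z) (snd z))\<^sup>2) \<partial>?M) \<longlonglongrightarrow> 0"
      using spacetime_L2_mollify_tendsto[OF rho supp r st(1)] by simp
    from tendsto_L1_AE_subseq[OF id this] obtain q :: "nat \<Rightarrow> nat"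
      where q: "AE z in ?M. (\<lambda>n. (?z (q n) z - w (fst z) (snd z))\<^sup>2) \<longlonglongrightarrow> 0" by auto
    have "X \<tau> \<le> (\<integral>\<^sup>+z. liminf (\<lambda>n. ennreal (?z (q n) z ^ 4) * indicator {..<\<tau>} (fst z)) \<partial>?M)"
      unfolding X_def
    proof (rule nn_integral_mono_AE, use q in eventually_elim)
      case (elim z)
      have "(\<lambda>n. ?z (q n) z - w (fst z) (snd z)) \<longlonglongrightarrow> 0"
        using tendsto_real_sqrt[OF elim] by (simp add: tendsto_rabs_zero_iff)
      then have "(\<lambda>n. ?z (q n) z) \<longlonglongrightarrow> w (fst z) (snd z)" by (simp add: LIM_zero_iff)
      then have "(\<lambda>n. ennreal (?z (q n) z ^ 4)) \<longlonglongrightarrow> ennreal (w (fst z) (snd z) ^ 4)"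
        by (intro tendsto_ennrealI tendsto_power)
      then have "(\<lambda>n. ennreal (?z (q n) z ^ 4) * indicator {..<\<tau>} (fst z)) \<longlonglongrightarrow> ennreal (w (fst z) (snd z) ^ 4) * indicator {..<\<tau>} (fst z)"
        by (cases "fst z < \<tau>") auto
      then show ?case by (simp add: lim_imp_Liminf)
    qed
    also have "\<dots> \<le> liminf (\<lambda>n. \<integral>\<^sup>+z. ennreal (?z (q n) z ^ 4) * indicator {..<\<tau>} (fst z) \<partial>?M)"
      by (rule nn_integral_liminf) measurable
    also have "\<dots> \<le> ennreal (2 / \<nu> ^ 3 * (E \<tau>)\<^sup>2)"
    proof (rule Liminf_le, simp, rule always_eventually, rule allI)
      fix n
      interpret mollified_equation \<nu> T "\<rho> (q n)" "\<rho>1 (q n)" "\<rho>2 (q n)" "\<rho>11 (q n)" "\<rho>22 (q n)" w "\<lambda>t x. K1 t x * w t x" "\<lambda>t x. K2 t x * w t x"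
        by (rule moll)
      note [measurable] = zmeas[of "q n"]
      have "(\<integral>\<^sup>+z. ennreal (?z (q n) z ^ 4) * indicator {..<\<tau>} (fst z) \<partial>?M) =
        (\<integral>\<^sup>+t. (\<integral>\<^sup>+y. ennreal (z t y ^ 4) \<partial>lborel) * indicator {..<\<tau>} t \<partial>lborel)"
        unfolding z_def
        by (subst lborel.nn_integral_fst[symmetric]) (auto simp: nn_integral_multc)
      also have "\<dots> \<le> ennreal (2 / \<nu> ^ 3 * (E \<tau>)\<^sup>2)"
        using L4_estimate[OF \<tau>] unfolding E_def fl_def flux_def .
      finally show "(\<integral>\<^sup>+z. ennreal (?z (q n) z ^ 4) * indicator {..<\<tau>} (fst z) \<partial>?M) \<le> ennreal (2 / \<nu> ^ 3 * (E \<tau>)\<^sup>2)" .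
    qed
    finally show ?thesis .
  qed
  have E_nn: "ennreal (E \<tau>) = (\<integral>\<^sup>+z. ennreal (Q (fst z) (snd z) * (w (fst z) (snd z))\<^sup>2) * indicator {..<\<tau>} (fst z) \<partial>?M)" for \<tau>
  proof -
    have i: "integrable lborel fl"
      unfolding fl_def by (intro Bochner_Integration.integrable_add spacetime_L2_time_integrable st)
    have f0: "0 \<le> fl t" for t by (simp add: fl_def)
    have "ennreal (E \<tau>) = (\<integral>\<^sup>+s. ennreal (fl s * indicator {..<\<tau>} s) \<partial>lborel)"
      unfolding E_def by (intro nn_integral_eq_integral[symmetric] integrable_indicator_mult[OF i]) (auto simp: f0)
    also have "\<dots> = (\<integral>\<^sup>+t. \<integral>\<^sup>+x. ennreal (Q t x * (w t x)\<^sup>2) * indicator {..<\<tau>} t \<partial>lborel \<partial>lborel)"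
    proof (rule nn_integral_cong_AE)
      show "AE t in lborel. ennreal (fl t * indicator {..<\<tau>} t) = (\<integral>\<^sup>+x. ennreal (Q t x * (w t x)\<^sup>2) * indicator {..<\<tau>} t \<partial>lborel)"
        using spacetime_L2_section[OF st(2)] spacetime_L2_section[OF st(3)]
      proof eventually_elim
        case (elim t)
        have "(\<integral>\<^sup>+x. ennreal (Q t x * (w t x)\<^sup>2) \<partial>lborel) = (\<integral>\<^sup>+x. ennreal ((K1 t x * w t x)\<^sup>2) + ennreal ((K2 t x * w t x)\<^sup>2) \<partial>lborel)"
          by (intro nn_integral_cong) (simp add: Q_def power_mult_distrib distrib_right flip: ennreal_plus)
        also have "\<dots> = ennreal (LBINT x. (K1 t x * w t x)\<^sup>2) + ennreal (LBINT x. (K2 t x * w t x)\<^sup>2)"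
          using L2_measurable[OF elim(1)] L2_measurable[OF elim(2)]
          by (subst nn_integral_add) (simp_all add: nn_integral_L2[OF elim(1)] nn_integral_L2[OF elim(2)])
        also have "\<dots> = ennreal (fl t)" by (simp add: fl_def flip: ennreal_plus)
        finally have *: "(\<integral>\<^sup>+x. ennreal (Q t x * (w t x)\<^sup>2) \<partial>lborel) = ennreal (fl t)" .
        show ?case using * by (cases "t < \<tau>") auto
      qed
    qed
    also have "\<dots> = (\<integral>\<^sup>+z. ennreal (Q (fst z) (snd z) * (w (fst z) (snd z))\<^sup>2) * indicator {..<\<tau>} (fst z) \<partial>?M)"
      by (subst lborel.nn_integral_fst[symmetric]) simp_all
    finally show ?thesis .
  qed
  define k where "k t = (\<integral>\<^sup>+x. ennreal ((Q t x)\<^sup>2) * indicator {0<..<T} t \<partial>lborel)" for t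
  have [measurable]: "k \<in> borel_measurable borel" unfolding k_def by measurable
  have kfin: "(\<integral>\<^sup>+t. k t \<partial>lborel) < \<infinity>" using K4 unfolding k_def Q_def .
  define N where "N \<tau> \<longleftrightarrow> (AE z in ?M. fst z < \<tau> \<longrightarrow> w (fst z) (snd z) = 0)" for \<tau>
  \<comment> \<open>The threshold \<open>\<nu> ^ 3 / 2\<close> is the reciprocal of the constant in
    \<open>step1\<close>: below it \<open>X \<tau>\<close> is at most a factor less than 1 times
    itself, and being finite it vanishes.\<close>
  have step: "N \<tau>" if "N \<alpha>" "0 \<le> \<alpha>" "\<alpha> < \<tau>" "\<tau> < T" and small: "(\<integral>\<^sup>+t. k t * indicator {\<alpha>..<\<tau>} t \<partial>lborel) < ennreal (\<nu> ^ 3 / 2)" for \<alpha> \<tau>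
  proof -
    let ?\<kappa> = "\<integral>\<^sup>+t. k t * indicator {\<alpha>..<\<tau>} t \<partial>lborel"
    \<comment> \<open>Since \<open>w\<close> vanishes before \<open>\<alpha>\<close> and outside
      \<open>{0<..<T}\<close>, restricting \<open>Q\<close> to this window does not change
      \<open>E \<tau>\<close>, and the Cauchy-Schwarz inequality then meets only the small part of
      \<open>Q\<close>.\<close>
    let ?f = "\<lambda>z. ennreal (Q (fst z) (snd z)) * indicator {\<alpha>..<\<tau>} (fst z) * indicator {0<..<T} (fst z)"
    let ?g = "\<lambda>z. ennreal ((w (fst z) (snd z))\<^sup>2) * indicator {..<\<tau>} (fst z)"
    have "ennreal (E \<tau>) = (\<integral>\<^sup>+z. ?f z * ?g z \<partial>?M)"
      unfolding E_nn
    proof (rule nn_integral_cong_AE)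
      show "AE z in ?M. ennreal (Q (fst z) (snd z) * (w (fst z) (snd z))\<^sup>2) * indicator {..<\<tau>} (fst z) = ?f z * ?g z"
        using that(1) unfolding N_def
      proof eventually_elim
        case (elim z)
        show ?case
        proof (cases "w (fst z) (snd z) = 0")
          case False
          then have "fst z \<in> {0<..<T}" "\<alpha> \<le> fst z" using w0[of "fst z" "snd z"] elim by auto
          then show ?thesis using Q0 by (simp add: ennreal_mult split: split_indicator)
        qed simp
      qed
    qed
    then have "(ennreal (E \<tau>))\<^sup>2 \<le> (\<integral>\<^sup>+z. (?f z)\<^sup>2 \<partial>?M) * (\<integral>\<^sup>+z. (?g z)\<^sup>2 \<partial>?M)"
      by (simp only:) (rule Cauchy_Schwarz_nn_integral; measurable)
    also have "(\<integral>\<^sup>+z. (?g z)\<^sup>2 \<partial>?M) = X \<tau>"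
      unfolding X_def by (intro nn_integral_cong) (auto simp: ennreal_power split: split_indicator simp flip: power_mult)
    also have "(\<integral>\<^sup>+z. (?f z)\<^sup>2 \<partial>?M) = (\<integral>\<^sup>+z. ennreal ((Q (fst z) (snd z))\<^sup>2) * indicator {0<..<T} (fst z) * indicator {\<alpha>..<\<tau>} (fst z) \<partial>?M)"
      using Q0 by (intro nn_integral_cong) (auto simp: ennreal_power split: split_indicator)
    also have "\<dots> = ?\<kappa>"
      unfolding k_def by (subst lborel.nn_integral_fst[symmetric]) (simp_all add: nn_integral_multc)
    finally have E2: "(ennreal (E \<tau>))\<^sup>2 \<le> ?\<kappa> * X \<tau>" .
    have E0: "0 \<le> E \<tau>"
      unfolding E_def by (intro Bochner_Integration.integral_nonneg) (simp add: fl_def)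
    have "X \<tau> \<le> ennreal (2 / \<nu> ^ 3 * (E \<tau>)\<^sup>2)" using step1[of \<tau>] that by simp
    also have "\<dots> = ennreal (2 / \<nu> ^ 3) * (ennreal (E \<tau>))\<^sup>2"
      using E0 nu by (simp add: ennreal_mult[symmetric] ennreal_power)
    also have "\<dots> \<le> ennreal (2 / \<nu> ^ 3) * (?\<kappa> * X \<tau>)" by (intro mult_left_mono E2) auto
    finally have XX: "X \<tau> \<le> ennreal (2 / \<nu> ^ 3) * (?\<kappa> * X \<tau>)" .
    have "X \<tau> \<le> (\<integral>\<^sup>+z. ennreal (w (fst z) (snd z) ^ 4) \<partial>?M)"
      unfolding X_def by (intro nn_integral_mono) (auto split: split_indicator)
    also have "\<dots> < \<infinity>" using w4 by (subst lborel.nn_integral_fst[symmetric]) simp_all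
    finally obtain x where x: "X \<tau> = ennreal x" "0 \<le> x" by (cases "X \<tau>") auto
    obtain \<kappa> where k: "?\<kappa> = ennreal \<kappa>" "0 \<le> \<kappa>" using small by (cases ?\<kappa>) auto
    have "\<kappa> < \<nu> ^ 3 / 2" using small k by (simp add: ennreal_less_iff)
    then have c: "2 / \<nu> ^ 3 * \<kappa> < 1" using nu by (simp add: field_simps)
    have "ennreal x \<le> ennreal (2 / \<nu> ^ 3 * (\<kappa> * x))"
      using XX nu x(2) k(2) unfolding x(1) k(1) by (simp add: ennreal_mult[symmetric])
    then have "x \<le> (2 / \<nu> ^ 3 * \<kappa>) * x" using x k nu by (simp add: mult.assoc)
    then have "(1 - 2 / \<nu> ^ 3 * \<kappa>) * x \<le> 0" by (simp add: left_diff_distrib)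
    then have "x = 0" using c x(2) by (auto simp: mult_le_0_iff)
    then have "(\<integral>\<^sup>+z. ennreal (w (fst z) (snd z) ^ 4) * indicator {..<\<tau>} (fst z) \<partial>?M) = 0"
      using x unfolding X_def by simp
    then have "AE z in ?M. ennreal (w (fst z) (snd z) ^ 4) * indicator {..<\<tau>} (fst z) = 0"
      by (subst (asm) nn_integral_0_iff_AE) simp_all
    then show ?thesis
      unfolding N_def by eventually_elim (auto simp: ennreal_eq_0_iff split: split_indicator_asm)
  qed
  define S where "S = {\<tau>. 0 \<le> \<tau> \<and> \<tau> \<le> T \<and> N \<tau>}"
  have S0: "0 \<in> S" using T w0 by (auto simp: S_def N_def)
  have bdd: "bdd_above S" by (auto simp: S_def bdd_above_def)
  define \<alpha> where "\<alpha> = Sup S"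
  have "0 \<le> \<alpha>" unfolding \<alpha>_def by (rule cSup_upper[OF S0 bdd])
  moreover have "\<alpha> \<le> T" unfolding \<alpha>_def by (rule cSup_least) (use S0 in \<open>auto simp: S_def\<close>)
  ultimately have \<alpha>: "0 \<le> \<alpha>" "\<alpha> \<le> T" by auto
  \<comment> \<open>A sequence in \<open>S\<close> approaching the supremum covers all times before
    it, and countably many null sets have a null union.\<close>
  have N\<alpha>: "N \<alpha>"
  proof -
    have "\<exists>\<tau>\<in>S. \<alpha> - 1 / real (Suc n) < \<tau>" for n
      using iffD1[OF less_cSup_iff[of S "\<alpha> - 1 / real (Suc n)"]] S0 bdd unfolding \<alpha>_def by fastforce
    then obtain f where f: "\<And>n. f n \<in> S" "\<And>n. \<alpha> - 1 / real (Suc n) < f n" by metis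
    have "AE z in ?M. \<forall>n. fst z < f n \<longrightarrow> w (fst z) (snd z) = 0"
      using f(1) by (subst AE_all_countable) (auto simp: S_def N_def)
    then show ?thesis
      unfolding N_def
    proof eventually_elim
      case (elim z)
      show ?case
      proof
        assume "fst z < \<alpha>"
        then obtain n where n: "1 / real (Suc n) < \<alpha> - fst z"
          using reals_Archimedean[of "\<alpha> - fst z"] by (auto simp: inverse_eq_divide)
        then have "fst z < f n" using f(2)[of n] by linarith
        then show "w (fst z) (snd z) = 0" using elim by blast
      qed
    qed
  qed
  have "\<alpha> = T"
  proof (rule ccontr)
    assume "\<alpha> \<noteq> T"
    then have "\<alpha> < T" using \<alpha> by simp
    obtain c where c: "\<alpha> < c" "c < T" "(\<integral>\<^sup>+t. k t * indicator {\<alpha>..<c} t \<partial>lborel) < ennreal (\<nu> ^ 3 / 2)"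
      using nn_integral_interval_shrink[of k "ennreal (\<nu> ^ 3 / 2)" \<alpha> T] kfin \<open>\<alpha> < T\<close> nu by auto
    then have "N c" using step[OF N\<alpha> \<alpha>(1)] by blast
    then have "c \<in> S" using c \<alpha> by (auto simp: S_def)
    then have "c \<le> \<alpha>" unfolding \<alpha>_def using bdd by (rule cSup_upper)
    then show False using c by simp
  qed
  then have "AE z in ?M. fst z < T \<longrightarrow> w (fst z) (snd z) = 0" using N\<alpha> by (simp add: N_def)
  then show ?thesis
  proof eventually_elim
    case (elim z)
    then show ?case using w0[of "fst z" "snd z"] by (cases "fst z < T") auto
  qed
qed

subsection \<open>Mollifiers and test functions\<close>

lemma DERIV_shift_zero:
  fixes k :: "real \<Rightarrow> real"
  assumes "\<And>x. (k has_real_derivative k' x) (at x)"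
  shows "((\<lambda>s. k (x + s)) has_real_derivative k' x) (at 0)"
  using assms[of x] DERIV_shift[of k "k' x" 0 x] by (simp add: add.commute)

lemma DERIV_translate:
  fixes k :: "real \<Rightarrow> real"
  assumes "\<And>x. (k has_real_derivative k' x) (at x)"
  shows "((\<lambda>s. k (s - y)) has_real_derivative k' (x - y)) (at x)"
proof -
  have "((\<lambda>s. k (s - y)) has_real_derivative k' (x - y) * 1) (at x)"
    by (rule DERIV_chain2[where g="\<lambda>s. s - y"]) (auto intro!: derivative_eq_intros assms)
  then show ?thesis by simp
qed

text \<open>Only the point 0 is delicate; there the difference quotient is at most
  \<open>|h| ^ Suc n\<close>, which tends to 0 because the exponent is at least 2.\<close>

lemma DERIV_max_power:
  "((\<lambda>u::real. (max 0 u) ^ Suc (Suc n)) has_real_derivative real (Suc (Suc n)) * (max 0 u) ^ Suc n) (at u)"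
proof -
  consider "u > 0" | "u < 0" | "u = 0" by linarith
  then show ?thesis
  proof cases
    case 1
    have "((\<lambda>u. u ^ Suc (Suc n)) has_real_derivative real (Suc (Suc n)) * (max 0 u) ^ Suc n) (at u)"
      using DERIV_pow[of "Suc (Suc n)" u] 1 by simp
    then show ?thesis
      by (rule has_field_derivative_transform_within_open[where S="{0<..}"]) (use 1 in auto)
  next
    case 2
    have "((\<lambda>u. 0) has_real_derivative real (Suc (Suc n)) * (max 0 u) ^ Suc n) (at u)"
      using 2 by simp
    then show ?thesis
      by (rule has_field_derivative_transform_within_open[where S="{..<0}"]) (use 2 in auto)
  next
    case 3
    have "(\<lambda>h::real. (max 0 h) ^ Suc (Suc n) / h) \<midarrow>0\<rightarrow> 0"
    proof (rule Lim_null_comparison)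
      show "eventually (\<lambda>h. norm ((max 0 h) ^ Suc (Suc n) / h) \<le> \<bar>h\<bar> ^ Suc n) (at (0::real))"
      proof (rule always_eventually, rule allI)
        fix h :: real
        show "norm ((max 0 h) ^ Suc (Suc n) / h) \<le> \<bar>h\<bar> ^ Suc n"
        proof (cases "h > 0")
          case False
          then have "(max 0 h) ^ Suc (Suc n) = 0" by simp
          then show ?thesis by (simp del: power_Suc)
        qed auto
      qed
      show "((\<lambda>h::real. \<bar>h\<bar> ^ Suc n) \<longlongrightarrow> 0) (at 0)"
        by (auto intro!: tendsto_eq_intros)
    qed
    then show ?thesis using 3 by (simp add: has_field_derivative_iff)
  qed
qed

section \<open>Regularity of tensor products of functions of one variable\<close>

fun Ck_real :: "nat \<Rightarrow> (real \<Rightarrow> real) \<Rightarrow> bool" where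
  "Ck_real 0 f = continuous_on UNIV f"
| "Ck_real (Suc k) f = (\<exists>f'. (\<forall>x. (f has_real_derivative f' x) (at x)) \<and> Ck_real k f')"

lemma Ck_real_continuous: "Ck_real k f \<Longrightarrow> continuous_on UNIV f"
  by (cases k) (auto intro!: continuous_at_imp_continuous_on intro: DERIV_isCont)

lemma Ck_real_2I:
  assumes "\<And>x. (f has_real_derivative f' x) (at x)" "\<And>x. (f' has_real_derivative f'' x) (at x)" "continuous_on UNIV f''"
  shows "Ck_real 2 f"
proof -
  have "Ck_real (Suc (Suc 0)) f" unfolding Ck_real.simps using assms by blast
  then show ?thesis by (simp only: numeral_2_eq_2)
qed

lemma Ck_real_Suc: "Ck_real (Suc k) f \<Longrightarrow> Ck_real k f"
proof (induction k arbitrary: f)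
  case 0
  then show ?case using Ck_real_continuous[of "Suc 0" f] by simp
next
  case (Suc k)
  then show ?case by (metis Ck_real.simps(2))
qed

definition tensor3 :: "(real \<Rightarrow> real) \<Rightarrow> (real \<Rightarrow> real) \<Rightarrow> (real \<Rightarrow> real) \<Rightarrow> real \<times> (real \<times> real) \<Rightarrow> real" where
  "tensor3 f g h z = f (fst z) * g (fst (snd z)) * h (snd (snd z))"

lemma tensor3_partial:
  assumes "\<And>x. (f has_real_derivative f' x) (at x)" "\<And>x. (g has_real_derivative g' x) (at x)" "\<And>x. (h has_real_derivative h' x) (at x)"
  shows "partial (tensor3 f g h) (1, 0) = tensor3 f' g h"
    and "partial (tensor3 f g h) (0, (1, 0)) = tensor3 f g' h"
    and "partial (tensor3 f g h) (0, (0, 1)) = tensor3 f g h'"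
proof -
  show "partial (tensor3 f g h) (1, 0) = tensor3 f' g h"
  proof
    fix z
    have "((\<lambda>s. f (fst z + s) * g (fst (snd z)) * h (snd (snd z))) has_real_derivative f' (fst z) * g (fst (snd z)) * h (snd (snd z))) (at 0)"
      by (intro DERIV_cmult_right DERIV_shift_zero[OF assms(1)])
    then show "partial (tensor3 f g h) (1, 0) z = tensor3 f' g h z"
      by (auto simp: partial_def tensor3_def intro!: DERIV_imp_deriv)
  qed
  show "partial (tensor3 f g h) (0, (1, 0)) = tensor3 f g' h"
  proof
    fix z
    have "((\<lambda>s. f (fst z) * g (fst (snd z) + s) * h (snd (snd z))) has_real_derivative f (fst z) * g' (fst (snd z)) * h (snd (snd z))) (at 0)"
      by (intro DERIV_cmult_right DERIV_cmult DERIV_shift_zero[OF assms(2)])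
    then show "partial (tensor3 f g h) (0, (1, 0)) z = tensor3 f g' h z"
      by (auto simp: partial_def tensor3_def intro!: DERIV_imp_deriv)
  qed
  show "partial (tensor3 f g h) (0, (0, 1)) = tensor3 f g h'"
  proof
    fix z
    have "((\<lambda>s. f (fst z) * g (fst (snd z)) * h (snd (snd z) + s)) has_real_derivative f (fst z) * g (fst (snd z)) * h' (snd (snd z))) (at 0)"
      by (intro DERIV_cmult DERIV_shift_zero[OF assms(3)])
    then show "partial (tensor3 f g h) (0, (0, 1)) z = tensor3 f g h' z"
      by (auto simp: partial_def tensor3_def intro!: DERIV_imp_deriv)
  qed
qed

lemma Basis_real3: "(Basis :: (real \<times> (real \<times> real)) set) = {(1, 0), (0, (1, 0)), (0, (0, 1))}"
  by (auto simp: Basis_prod_def zero_prod_def)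

lemma Basis_real2: "(Basis :: (real \<times> real) set) = {(1, 0), (0, 1)}"
  by (auto simp: Basis_prod_def)

text \<open>A partial derivative of a tensor product differentiates one factor and leaves a tensor
  product, so the induction closes; \<open>Ck_real_Suc\<close> lowers the order of the two factors
  that are not differentiated.\<close>

lemma Ck_tensor3: "Ck_real k f \<Longrightarrow> Ck_real k g \<Longrightarrow> Ck_real k h \<Longrightarrow> Ck k (tensor3 f g h)"
proof (induction k arbitrary: f g h)
  case 0
  then have c: "continuous_on UNIV f" "continuous_on UNIV g" "continuous_on UNIV h" by auto
  have "continuous_on UNIV (\<lambda>z::real \<times> real \<times> real. f (fst z) * g (fst (snd z)) * h (snd (snd z)))"
    by (intro continuous_intros continuous_on_compose2[OF c(1)] continuous_on_compose2[OF c(2)] continuous_on_compose2[OF c(3)]) auto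
  then show ?case unfolding tensor3_def by simp
next
  case (Suc k)
  obtain f' g' h' where d: "\<And>x. (f has_real_derivative f' x) (at x)" "\<And>x. (g has_real_derivative g' x) (at x)" "\<And>x. (h has_real_derivative h' x) (at x)"
    and D: "Ck_real k f'" "Ck_real k g'" "Ck_real k h'"
    using Suc.prems by auto
  have diff: "tensor3 f g h differentiable (at z)" for z
  proof -
    have fd: "f differentiable at x" "g differentiable at x" "h differentiable at x" for x
      using d real_differentiable_def by blast+
    have l: "(fst :: real \<times> real \<times> real \<Rightarrow> real) differentiable (at z)"
      "(\<lambda>z. fst (snd z) :: real) differentiable (at z)"
      "(\<lambda>z. snd (snd z) :: real) differentiable (at z)"
      by (intro bounded_linear_imp_differentiable bounded_linear_intros)+
    show ?thesis
      unfolding tensor3_def[abs_def]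
      by (intro differentiable_mult differentiable_compose[of f fst] differentiable_compose[of g "\<lambda>z. fst (snd z)"]
          differentiable_compose[of h "\<lambda>z. snd (snd z)"] fd l)
  qed
  show ?case
    using diff Suc.IH D Ck_real_Suc[OF Suc.prems(1)] Ck_real_Suc[OF Suc.prems(2)] Ck_real_Suc[OF Suc.prems(3)]
    by (simp add: Basis_real3 tensor3_partial[OF d])
qed

text \<open>The cube is the smallest integer power of the truncated parabola with two continuous
  derivatives, as the class of test functions demands, and its derivatives are explicit.\<close>

definition bump :: "real \<Rightarrow> real" where "bump x = (max 0 (1 - x\<^sup>2)) ^ 3"
definition bump' :: "real \<Rightarrow> real" where "bump' x = - 6 * x * (max 0 (1 - x\<^sup>2))\<^sup>2"
definition bump'' :: "real \<Rightarrow> real" where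
  "bump'' x = - 6 * (max 0 (1 - x\<^sup>2))\<^sup>2 + 24 * x\<^sup>2 * max 0 (1 - x\<^sup>2)"

lemma DERIV_bump: "(bump has_real_derivative bump' x) (at x)"
proof -
  have "((\<lambda>x. (max 0 (1 - x\<^sup>2)) ^ Suc (Suc 1)) has_real_derivative (real (Suc (Suc 1)) * (max 0 (1 - x\<^sup>2)) ^ Suc 1) * (- 2 * x)) (at x)"
    by (rule DERIV_chain2[OF DERIV_max_power]) (auto intro!: derivative_eq_intros)
  then show ?thesis by (simp add: bump_def[abs_def] bump'_def numeral_3_eq_3 numeral_2_eq_2 mult_ac)
qed

lemma DERIV_bump': "(bump' has_real_derivative bump'' x) (at x)"
proof -
  have d: "((\<lambda>x. (max 0 (1 - x\<^sup>2)) ^ Suc (Suc 0)) has_real_derivative (real (Suc (Suc 0)) * (max 0 (1 - x\<^sup>2)) ^ Suc 0) * (- 2 * x)) (at x)"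
    by (rule DERIV_chain2[OF DERIV_max_power]) (auto intro!: derivative_eq_intros)
  have "((\<lambda>x. (- 6 * x) * (max 0 (1 - x\<^sup>2)) ^ Suc (Suc 0)) has_real_derivative
     (- 6) * (max 0 (1 - x\<^sup>2)) ^ Suc (Suc 0) + ((real (Suc (Suc 0)) * (max 0 (1 - x\<^sup>2)) ^ Suc 0) * (- 2 * x)) * (- 6 * x)) (at x)"
    by (rule DERIV_mult[OF _ d]) (auto intro!: derivative_eq_intros)
  then show ?thesis
    by (simp add: bump'_def[abs_def] bump''_def power2_eq_square mult_ac)
qed

lemma continuous_bump'': "continuous_on UNIV bump''"
  unfolding bump''_def[abs_def] by (intro continuous_intros)

lemma bump_nonneg: "0 \<le> bump x" by (simp add: bump_def)

lemma bump_zero: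
  assumes "\<bar>x\<bar> > 1" shows "bump x = 0" "bump' x = 0" "bump'' x = 0"
proof -
  have "1 < \<bar>x\<bar>\<^sup>2" using assms one_less_power[of "\<bar>x\<bar>" 2] by simp
  then show "bump x = 0" "bump' x = 0" "bump'' x = 0" by (simp_all add: bump_def bump'_def bump''_def)
qed

text \<open>Dividing by the mass of the profile already rescaled avoids a change of variables. The
  support radius is \<open>1 / c\<close>.\<close>

definition bump_mass :: "real \<Rightarrow> real" where "bump_mass c = (LBINT s. bump (c * s))"
definition mollifier :: "real \<Rightarrow> real \<Rightarrow> real" where "mollifier c s = bump (c * s) / bump_mass c"
definition mollifier' :: "real \<Rightarrow> real \<Rightarrow> real" where "mollifier' c s = c * bump' (c * s) / bump_mass c"
definition mollifier'' :: "real \<Rightarrow> real \<Rightarrow> real" where "mollifier'' c s = c\<^sup>2 * bump'' (c * s) / bump_mass c"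

lemma DERIV_mollifier: "(mollifier c has_real_derivative mollifier' c s) (at s)"
proof -
  have "((\<lambda>s. bump (c * s) / bump_mass c) has_real_derivative (bump' (c * s) * c) / bump_mass c) (at s)"
    by (intro DERIV_cdivide DERIV_chain2[OF DERIV_bump]) (auto intro!: derivative_eq_intros)
  then show ?thesis by (simp add: mollifier_def[abs_def] mollifier'_def mult.commute)
qed

lemma DERIV_mollifier': "(mollifier' c has_real_derivative mollifier'' c s) (at s)"
proof -
  have "((\<lambda>s. c * bump' (c * s) / bump_mass c) has_real_derivative (c * (bump'' (c * s) * c)) / bump_mass c) (at s)"
    by (intro DERIV_cdivide DERIV_cmult DERIV_chain2[OF DERIV_bump']) (auto intro!: derivative_eq_intros)
  then show ?thesis by (simp add: mollifier'_def[abs_def] mollifier''_def power2_eq_square mult_ac)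
qed

lemma continuous_mollifier'': "continuous_on UNIV (mollifier'' c)"
  unfolding mollifier''_def[abs_def] divide_inverse
  by (intro continuous_intros continuous_on_compose2[OF continuous_bump'']) auto

lemma continuous_mollifier: "continuous_on UNIV (mollifier c)" and continuous_mollifier': "continuous_on UNIV (mollifier' c)"
  by (rule DERIV_continuous_on, rule has_field_derivative_at_within, rule DERIV_mollifier,
      rule DERIV_continuous_on, rule has_field_derivative_at_within, rule DERIV_mollifier')

lemma Ck_real_mollifier: "Ck_real 2 (\<lambda>s. mollifier c (s - y))"
proof -
  have "continuous_on UNIV (\<lambda>s. mollifier'' c (s - y))"
    by (rule continuous_on_compose2[OF continuous_mollifier'']) (auto intro!: continuous_intros)
  then show ?thesis
    by (rule Ck_real_2I[OF DERIV_translate[OF DERIV_mollifier] DERIV_translate[OF DERIV_mollifier']])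
qed

lemma mollifier_zero:
  assumes "c > 0" "\<bar>s\<bar> > 1 / c" shows "mollifier c s = 0" "mollifier' c s = 0" "mollifier'' c s = 0"
proof -
  have "\<bar>c * s\<bar> > 1" using assms by (simp add: abs_mult field_simps)
  from bump_zero[OF this] show "mollifier c s = 0" "mollifier' c s = 0" "mollifier'' c s = 0"
    by (simp_all add: mollifier_def mollifier'_def mollifier''_def)
qed

lemma Cc_bump_scaled:
  assumes "c > 0" shows "Cc (\<lambda>s. bump (c * s))"
  unfolding Cc_def
proof
  have "continuous_on UNIV bump"
    by (rule DERIV_continuous_on, rule has_field_derivative_at_within, rule DERIV_bump)
  then show "continuous_on UNIV (\<lambda>s. bump (c * s))"
    by (rule continuous_on_compose2) (auto intro!: continuous_intros)
  have "bump (c * s) = 0" if "1 / c < norm s" for s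
    using that assms by (intro bump_zero) (simp add: abs_mult field_simps)
  then show "\<exists>R. \<forall>s. R < norm s \<longrightarrow> bump (c * s) = 0" by blast
qed

lemma bump_mass_pos:
  assumes "c > 0" shows "bump_mass c > 0"
proof -
  let ?A = "{0 .. 1 / (2 * c)}"
  \<comment> \<open>On \<open>?A\<close> the argument of \<open>bump\<close> is at most 1/2, so the
    value is at least \<open>(3/4)^3 = 27/64\<close>.\<close>
  have "0 < (27 / 64) * (1 / (2 * c))" using assms by simp
  also have "\<dots> = (LBINT s. (27 / 64) * indicator ?A s)" using assms by simp
  also have "\<dots> \<le> bump_mass c"
    unfolding bump_mass_def
  proof (rule integral_mono)
    show "integrable lborel (\<lambda>s. bump (c * s))" by (rule Cc_integrable[OF Cc_bump_scaled[OF assms]])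
    show "integrable lborel (\<lambda>s. (27 / 64) * indicator ?A s :: real)"
      using assms by (intro integrable_mult_right integrable_real_indicator) auto
    fix s :: real
    show "(27 / 64) * indicator ?A s \<le> bump (c * s)"
    proof (cases "s \<in> ?A")
      case True
      then have "0 \<le> c * s" "c * s \<le> 1 / 2" using assms by (auto simp: field_simps)
      then have "(c * s)\<^sup>2 \<le> (1 / 2)\<^sup>2" by (intro power_mono)
      then have "3 / 4 \<le> 1 - (c * s)\<^sup>2" by (simp add: power_divide)
      then have "3 / 4 \<le> max 0 (1 - (c * s)\<^sup>2)" by (rule order_trans[OF _ max.cobounded2])
      then have "(3 / 4) ^ 3 \<le> bump (c * s)" unfolding bump_def by (rule power_mono) simp
      then show ?thesis using True by (simp add: power3_eq_cube)
    qed (simp add: bump_nonneg)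
  qed
  finally show ?thesis .
qed

section \<open>Planar mollifiers and the time profile\<close>

definition tensor2 :: "(real \<Rightarrow> real) \<Rightarrow> (real \<Rightarrow> real) \<Rightarrow> real \<times> real \<Rightarrow> real" where
  "tensor2 f g x = f (fst x) * g (snd x)"

lemma norm_real2_le: "norm (x :: real \<times> real) \<le> \<bar>fst x\<bar> + \<bar>snd x\<bar>"
  by (cases x) (simp add: norm_Pair sqrt_sum_squares_le_sum_abs)

lemma tensor2_zero:
  assumes "\<And>s. d < \<bar>s\<bar> \<Longrightarrow> f s = 0" "\<And>s. d < \<bar>s\<bar> \<Longrightarrow> g s = 0" "2 * d < norm x"
  shows "tensor2 f g x = 0"
proof -
  have "d < \<bar>fst x\<bar> \<or> d < \<bar>snd x\<bar>" using norm_real2_le[of x] assms(3) by linarith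
  then show ?thesis using assms(1,2) by (auto simp: tensor2_def)
qed

lemma Cc_tensor2:
  assumes "continuous_on UNIV f" "continuous_on UNIV g"
    and "\<And>s. d < \<bar>s\<bar> \<Longrightarrow> f s = 0" "\<And>s. d < \<bar>s\<bar> \<Longrightarrow> g s = 0"
  shows "Cc (tensor2 f g)"
  unfolding Cc_def
proof
  show "continuous_on UNIV (tensor2 f g)"
    unfolding tensor2_def[abs_def]
    by (intro continuous_intros continuous_on_compose2[OF assms(1)] continuous_on_compose2[OF assms(2)]) auto
  show "\<exists>R. \<forall>x. R < norm x \<longrightarrow> tensor2 f g x = 0"
    using tensor2_zero[of d f g] assms(3,4) by blast
qed

lemma has_dir_deriv_tensor2:
  assumes "\<And>s. (f has_real_derivative f' s) (at s)" "\<And>s. (g has_real_derivative g' s) (at s)"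
  shows "has_dir_deriv (1,0) (tensor2 f g) (tensor2 f' g)" "has_dir_deriv (0,1) (tensor2 f g) (tensor2 f g')"
proof -
  show "has_dir_deriv (1,0) (tensor2 f g) (tensor2 f' g)" "has_dir_deriv (0,1) (tensor2 f g) (tensor2 f g')"
    unfolding has_dir_deriv_def tensor2_def
    by (auto intro!: DERIV_cmult_right DERIV_cmult DERIV_shift_zero assms)
qed

lemma integral_mollifier_tensor2:
  assumes "c > 0"
  shows "(LBINT x. tensor2 (mollifier c) (mollifier c) x) = 1"
proof -
  have m: "integrable lborel (mollifier c)" "(LBINT s. mollifier c s) = 1"
    using Cc_integrable[OF Cc_bump_scaled[OF assms]] bump_mass_pos[OF assms]
    by (simp_all add: mollifier_def[abs_def] bump_mass_def)
  have p: "0 \<le> mollifier c s" for s using bump_mass_pos[OF assms] by (simp add: mollifier_def bump_nonneg)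
  have [measurable]: "mollifier c \<in> borel_measurable borel"
    using continuous_mollifier by (rule borel_measurable_continuous_onI)
  have i: "integrable lborel (tensor2 (mollifier c) (mollifier c))"
    by (intro Cc_integrable Cc_tensor2[where d="1/c"] continuous_mollifier mollifier_zero[OF assms])
  have "ennreal (LBINT x. tensor2 (mollifier c) (mollifier c) x) = (\<integral>\<^sup>+x. ennreal (tensor2 (mollifier c) (mollifier c) x) \<partial>lborel)"
    using p by (intro nn_integral_eq_integral[symmetric] i) (simp add: tensor2_def)
  also have "\<dots> = (\<integral>\<^sup>+x. ennreal (mollifier c (fst x)) * ennreal (mollifier c (snd x)) \<partial>lborel)"
    by (simp add: tensor2_def ennreal_mult p)
  also have "\<dots> = (\<integral>\<^sup>+s. ennreal (mollifier c s) \<partial>lborel) * (\<integral>\<^sup>+s. ennreal (mollifier c s) \<partial>lborel)"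
    by (rule nn_integral_product_real2) measurable
  also have "\<dots> = 1" using m p by (simp add: nn_integral_eq_integral)
  finally have "ennreal (LBINT x. tensor2 (mollifier c) (mollifier c) x) = ennreal 1" by simp
  moreover have "0 \<le> (LBINT x. tensor2 (mollifier c) (mollifier c) x)"
    using p by (intro Bochner_Integration.integral_nonneg) (simp add: tensor2_def)
  ultimately show ?thesis by (simp add: ennreal_inj del: ennreal_1)
qed

text \<open>The exponent 3 makes the time factor twice continuously differentiable with second
  derivative \<open>6 * max 0 (s - t)\<close>; it vanishes from time \<open>s\<close> on and so
  stays away from the final time.\<close>

lemma Ck_real_time: "Ck_real 2 (\<lambda>t. (max 0 (s - t)) ^ 3)"
  and DERIV_time: "((\<lambda>t. (max 0 (s - t)) ^ 3) has_real_derivative - 3 * (max 0 (s - t))\<^sup>2) (at t)"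
proof -
  have d3: "((\<lambda>t. (max 0 (s - t)) ^ Suc (Suc 1)) has_real_derivative (real (Suc (Suc 1)) * (max 0 (s - t)) ^ Suc 1) * (- 1)) (at t)" for t
    by (rule DERIV_chain2[OF DERIV_max_power]) (auto intro!: derivative_eq_intros)
  then show d: "((\<lambda>t. (max 0 (s - t)) ^ 3) has_real_derivative - 3 * (max 0 (s - t))\<^sup>2) (at t)" for t
    by (simp add: numeral_3_eq_3 numeral_2_eq_2)
  have d2: "((\<lambda>t. (max 0 (s - t)) ^ Suc (Suc 0)) has_real_derivative (real (Suc (Suc 0)) * (max 0 (s - t)) ^ Suc 0) * (- 1)) (at t)" for t
    by (rule DERIV_chain2[OF DERIV_max_power]) (auto intro!: derivative_eq_intros)
  have d': "((\<lambda>t. - 3 * (max 0 (s - t))\<^sup>2) has_real_derivative 6 * max 0 (s - t)) (at t)" for t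
    using DERIV_cmult[OF d2, of "-3"] by (simp add: numeral_2_eq_2)
  have "continuous_on UNIV (\<lambda>t. 6 * max 0 (s - t))" by (intro continuous_intros)
  then show "Ck_real 2 (\<lambda>t. (max 0 (s - t)) ^ 3)"
    by (rule Ck_real_2I[OF d d'])
qed

subsection \<open>Integrability of the data\<close>

lemma norm_biot_savart: "norm (biot_savart x) = 1 / (2 * pi * norm x)"
proof -
  have "norm (- snd x, fst x) = norm x" by (cases x) (simp add: norm_Pair add.commute)
  then have "norm (biot_savart x) = \<bar>1 / (2 * pi * (norm x)\<^sup>2)\<bar> * norm x"
    by (simp only: biot_savart_def norm_scaleR)
  then show ?thesis by (simp add: power2_eq_square)
qed

lemma biot_savart_measurable [measurable]: "biot_savart \<in> borel_measurable borel"
  unfolding biot_savart_def[abs_def] by measurable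

lemma K_measurable:
  assumes "(\<lambda>(t,x). u t x) \<in> borel_measurable (borel \<Otimes>\<^sub>M borel)"
  shows "(\<lambda>(t,x). K u t x) \<in> borel_measurable (borel \<Otimes>\<^sub>M borel)"
proof -
  note [measurable] = assms
  show ?thesis unfolding K_def by measurable
qed

text \<open>The kernel is at most \<open>1 / norm x\<close>, so \<open>K u t\<close> is dominated by
  the Riesz potential of \<open>|u t|\<close>, and the inequality above applies with
  \<open>F ^ 3 = |u t|\<close>, \<open>F ^ 4 = |u t| powr (4/3)\<close>. The exponents match: 1/4 =
  3/4 - 1/2.\<close>

lemma nn_integral_K_le:
  fixes u :: "real \<Rightarrow> real \<times> real \<Rightarrow> real"
  assumes [measurable]: "u t \<in> borel_measurable borel"
    and fin: "(\<integral>\<^sup>+x. ennreal (\<bar>u t x\<bar> powr (4/3)) \<partial>lborel) \<le> ennreal a" and a: "0 \<le> a"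
  shows "(\<integral>\<^sup>+x. ennreal (norm (K u t x) ^ 4) \<partial>lborel) \<le> ennreal (16 * riesz_const ^ 4 * (1 + a) ^ 3)"
proof -
  define F where "F y = \<bar>u t y\<bar> powr (1/3)" for y
  have [measurable]: "F \<in> borel_measurable borel" unfolding F_def by measurable
  have F3: "F y ^ 3 = \<bar>u t y\<bar>" and F4: "F y ^ 4 = \<bar>u t y\<bar> powr (4/3)" for y

    by (cases "u t y = 0"; simp add: F_def powr_powr flip: powr_realpow)+
  \<comment> \<open>The summand 1 keeps \<open>\<beta> = sqrt (1 + a)\<close> positive even if
    \<open>u t\<close> vanishes.\<close>
  have bs: "(\<integral>\<^sup>+y. ennreal (F y ^ 4) \<partial>lborel) \<le> ennreal ((sqrt (1 + a))\<^sup>2)"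
    using fin a by (auto simp: F4 intro: order_trans ennreal_leI)
  have le: "ennreal (norm (K u t x)) \<le> (\<integral>\<^sup>+y. ennreal (F y ^ 3 / norm (x - y)) \<partial>lborel)" for x
  proof (cases "integrable lborel (\<lambda>y. u t y *\<^sub>R biot_savart (x - y))")
    case True
    have "ennreal (norm (K u t x)) \<le> (\<integral>\<^sup>+y. ennreal (norm (u t y *\<^sub>R biot_savart (x - y))) \<partial>lborel)"
      unfolding K_def by (rule integral_norm_bound_ennreal[OF True])
    also have "\<dots> \<le> (\<integral>\<^sup>+y. ennreal (F y ^ 3 / norm (x - y)) \<partial>lborel)"
    proof (intro nn_integral_mono ennreal_leI)
      fix y
      have "norm (u t y *\<^sub>R biot_savart (x - y)) = (\<bar>u t y\<bar> / norm (x - y)) * (1 / (2 * pi))"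
        by (simp add: norm_biot_savart)
      also have "\<dots> \<le> (\<bar>u t y\<bar> / norm (x - y)) * 1"
        using pi_ge_two by (intro mult_left_mono) (auto simp: divide_le_eq)
      finally show "norm (u t y *\<^sub>R biot_savart (x - y)) \<le> F y ^ 3 / norm (x - y)" by (simp add: F3)
    qed
    finally show ?thesis .
  next
    \<comment> \<open>Where the singular integral does not converge absolutely, the Bochner integral
      is 0 by convention.\<close>
    case False
    then show ?thesis by (simp add: K_def not_integrable_integral_eq)
  qed
  have "(\<integral>\<^sup>+x. ennreal (norm (K u t x) ^ 4) \<partial>lborel) \<le> (\<integral>\<^sup>+x. (\<integral>\<^sup>+y. ennreal (F y ^ 3 / norm (x - y)) \<partial>lborel) ^ 4 \<partial>lborel)"
    using le by (intro nn_integral_mono) (simp add: ennreal_power[symmetric] power_mono)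
  also have "\<dots> \<le> ennreal (16 * riesz_const ^ 4 * sqrt (1 + a) ^ 6)"
    by (rule hardy_littlewood_sobolev[OF _ _ bs]) (use a in \<open>auto simp: F_def\<close>)
  also have "sqrt (1 + a) ^ 6 = (1 + a) ^ 3"
    using a power_mult[of "sqrt (1 + a)" 2 3] by simp
  finally show ?thesis .
qed

lemma LpLq_measurable:
  "LpLq p q T v \<Longrightarrow> (\<lambda>(t,x). v t x) \<in> borel_measurable (borel \<Otimes>\<^sub>M borel)"
  by (simp add: LpLq_def borel_prod case_prod_beta')

text \<open>\<open>enn2real\<close> sends infinity to 0, so the outer integral alone says nothing
  about times at which the inner one is infinite; the clause on finiteness almost everywhere
  excludes them.\<close>

lemma LpLq_4_4:
  assumes "LpLq 4 4 T v"
  shows "(\<integral>\<^sup>+t. (\<integral>\<^sup>+x. ennreal (v t x ^ 4) \<partial>lborel) * indicator {0<..<T} t \<partial>lborel) < \<infinity>"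
proof -
  have p4: "\<bar>r\<bar> powr 4 = r ^ 4" for r :: real by (cases "r = 0") auto
  have fin: "AE t in lborel. t \<in> {0<..<T} \<longrightarrow> (\<integral>\<^sup>+x. ennreal (v t x ^ 4) \<partial>lborel) < \<infinity>"
    and i: "(\<integral>\<^sup>+t \<in> {0<..<T}. ennreal ((enn2real (\<integral>\<^sup>+x. ennreal (v t x ^ 4) \<partial>lborel)) powr 1) \<partial>lborel) < \<infinity>"
    using assms by (auto simp: LpLq_def p4)
  have "(\<integral>\<^sup>+t. (\<integral>\<^sup>+x. ennreal (v t x ^ 4) \<partial>lborel) * indicator {0<..<T} t \<partial>lborel) =
    (\<integral>\<^sup>+t \<in> {0<..<T}. ennreal ((enn2real (\<integral>\<^sup>+x. ennreal (v t x ^ 4) \<partial>lborel)) powr 1) \<partial>lborel)"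
    by (rule nn_integral_cong_AE) (use fin in \<open>eventually_elim, auto split: split_indicator\<close>)
  then show ?thesis using i by simp
qed

text \<open>The quotient of the exponents is 3: the fourth power of the \<open>L^(4/3)\<close>-norm
  is \<open>A t ^ 3\<close>. The form \<open>(1 + A t) ^ 3\<close> is that of
  \<open>nn_integral_K_le\<close>, and the bounded time interval pays for the 1.\<close>

lemma LpLq_4_43:
  assumes "LpLq 4 (4/3) T v"
  defines "A \<equiv> \<lambda>t. enn2real (\<integral>\<^sup>+x. ennreal (\<bar>v t x\<bar> powr (4/3)) \<partial>lborel)"
  shows "AE t in lborel. t \<in> {0<..<T} \<longrightarrow> (\<integral>\<^sup>+x. ennreal (\<bar>v t x\<bar> powr (4/3)) \<partial>lborel) = ennreal (A t)"
    and "(\<integral>\<^sup>+t. ennreal ((1 + A t) ^ 3) * indicator {0<..<T} t \<partial>lborel) < \<infinity>"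
proof -
  note [measurable] = LpLq_measurable[OF assms(1)]
  have [measurable]: "A \<in> borel_measurable borel" unfolding A_def by measurable
  have A0: "0 \<le> A t" for t by (simp add: A_def)
  have fin: "AE t in lborel. t \<in> {0<..<T} \<longrightarrow> (\<integral>\<^sup>+x. ennreal (\<bar>v t x\<bar> powr (4/3)) \<partial>lborel) < \<infinity>"
    and i: "(\<integral>\<^sup>+t \<in> {0<..<T}. ennreal (A t powr 3) \<partial>lborel) < \<infinity>"
    using assms by (auto simp: LpLq_def)
  show "AE t in lborel. t \<in> {0<..<T} \<longrightarrow> (\<integral>\<^sup>+x. ennreal (\<bar>v t x\<bar> powr (4/3)) \<partial>lborel) = ennreal (A t)"
    using fin by eventually_elim (auto simp: A_def)
  have p3: "A t powr 3 = A t ^ 3" for t using A0[of t] by (cases "A t = 0") auto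
  \<comment> \<open>Convexity of the cube; the two sides differ by
    \<open>3 * (1 + x) * (1 - x)^2\<close>.\<close>
  have le: "(1 + x) ^ 3 \<le> 4 * (1 + x ^ 3)" if "0 \<le> x" for x :: real
  proof -
    have "0 \<le> 3 * ((1 + x) * (1 - x)\<^sup>2)" using that by simp
    also have "\<dots> = 4 * (1 + x ^ 3) - (1 + x) ^ 3" by (simp add: power2_eq_square power3_eq_cube algebra_simps)
    finally show ?thesis by simp
  qed
  have "(\<integral>\<^sup>+t. ennreal ((1 + A t) ^ 3) * indicator {0<..<T} t \<partial>lborel) \<le>
    (\<integral>\<^sup>+t. 4 * indicator {0<..<T} t + 4 * (ennreal (A t powr 3) * indicator {0<..<T} t) \<partial>lborel)"
  proof (rule nn_integral_mono)
    fix t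
    have "ennreal ((1 + A t) ^ 3) \<le> ennreal (4 * (1 + A t ^ 3))" by (intro ennreal_leI le A0)
    also have "\<dots> = 4 + 4 * ennreal (A t powr 3)"
      using A0[of t] by (simp add: p3 distrib_left ennreal_mult)
    finally show "ennreal ((1 + A t) ^ 3) * indicator {0<..<T} t \<le> 4 * indicator {0<..<T} t + 4 * (ennreal (A t powr 3) * indicator {0<..<T} t)"
      by (auto split: split_indicator)
  qed
  also have "\<dots> = 4 * emeasure lborel {0<..<T} + 4 * (\<integral>\<^sup>+t \<in> {0<..<T}. ennreal (A t powr 3) \<partial>lborel)"
    by (subst nn_integral_add) (auto simp: nn_integral_cmult)
  also have "\<dots> < \<infinity>"
  proof -
    have "emeasure lborel {0<..<T} < \<infinity>" by (intro emeasure_bounded_finite) simp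
    then show ?thesis using i by (simp add: ennreal_mult_less_top)
  qed
  finally show "(\<integral>\<^sup>+t. ennreal ((1 + A t) ^ 3) * indicator {0<..<T} t \<partial>lborel) < \<infinity>" .
qed

lemma square_le_powr_add_power4: "r\<^sup>2 \<le> \<bar>r\<bar> powr (4/3) + r ^ 4" for r :: real
proof (cases "\<bar>r\<bar> \<le> 1")
  case True
  have "r\<^sup>2 \<le> \<bar>r\<bar> powr (4/3)"
  proof (cases "r = 0")
    case False
    then have "\<bar>r\<bar> powr 2 \<le> \<bar>r\<bar> powr (4/3)" using True by (intro powr_mono') auto
    then show ?thesis using False by simp
  qed simp
  then show ?thesis by (simp add: add_increasing2)
next
  case False
  then have "1 \<le> \<bar>r\<bar>\<^sup>2" using one_le_power[of "\<bar>r\<bar>" 2] by linarith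
  then have "r\<^sup>2 * 1 \<le> r\<^sup>2 * r\<^sup>2" by (intro mult_left_mono) auto
  then have "r\<^sup>2 \<le> r ^ 4" by (simp add: power2_eq_square power4_eq_xxxx mult.assoc)
  then show ?thesis by (simp add: add_increasing)
qed

text \<open>The exponent 2 lies between 4/3 and 4, which gives a pointwise bound; in time,
  \<open>A t \<le> (1 + A t) ^ 3\<close> reduces the first term to the cubic integral already
  controlled.\<close>

lemma spacetime_L2_LpLq:
  assumes v4: "LpLq 4 4 T v" and v43: "LpLq 4 (4/3) T v"
  shows "spacetime_L2 (\<lambda>t x. v t x * indicator {0<..<T} t)"
proof (rule spacetime_L2I)
  note [measurable] = LpLq_measurable[OF v4]
  show "(\<lambda>(t,x). v t x * indicator {0<..<T} t) \<in> borel_measurable (borel \<Otimes>\<^sub>M borel)" by measurable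
  define A where "A t = enn2real (\<integral>\<^sup>+x. ennreal (\<bar>v t x\<bar> powr (4/3)) \<partial>lborel)" for t
  note A = LpLq_4_43[OF v43, folded A_def]
  have A0: "0 \<le> A t" for t by (simp add: A_def)
  have [measurable]: "A \<in> borel_measurable borel" unfolding A_def by measurable
  have "(\<integral>\<^sup>+t. \<integral>\<^sup>+x. ennreal ((v t x * indicator {0<..<T} t)\<^sup>2) \<partial>lborel \<partial>lborel) \<le>
    (\<integral>\<^sup>+t. ennreal ((1 + A t) ^ 3) * indicator {0<..<T} t + (\<integral>\<^sup>+x. ennreal (v t x ^ 4) \<partial>lborel) * indicator {0<..<T} t \<partial>lborel)"
  proof (rule nn_integral_mono_AE, use A(1) in eventually_elim)
    case (elim t)
    show ?case
    proof (cases "t \<in> {0<..<T}")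
      case True
      have "(\<integral>\<^sup>+x. ennreal ((v t x)\<^sup>2) \<partial>lborel) \<le> (\<integral>\<^sup>+x. ennreal (\<bar>v t x\<bar> powr (4/3)) + ennreal (v t x ^ 4) \<partial>lborel)"
        using square_le_powr_add_power4 by (intro nn_integral_mono) (simp flip: ennreal_plus add: ennreal_leI)
      also have "\<dots> = ennreal (A t) + (\<integral>\<^sup>+x. ennreal (v t x ^ 4) \<partial>lborel)"
        using elim True by (subst nn_integral_add) auto
      also have "ennreal (A t) \<le> ennreal ((1 + A t) ^ 3)"
        using A0[of t] self_le_power[of "1 + A t" 3] by (intro ennreal_leI) simp
      finally show ?thesis using True by simp
    qed simp
  qed
  also have "\<dots> = (\<integral>\<^sup>+t. ennreal ((1 + A t) ^ 3) * indicator {0<..<T} t \<partial>lborel) + (\<integral>\<^sup>+t. (\<integral>\<^sup>+x. ennreal (v t x ^ 4) \<partial>lborel) * indicator {0<..<T} t \<partial>lborel)"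
    by (rule nn_integral_add) measurable
  also have "\<dots> < \<infinity>" using A(2) LpLq_4_4[OF v4] by simp
  finally show "(\<integral>\<^sup>+t. \<integral>\<^sup>+x. ennreal ((v t x * indicator {0<..<T} t)\<^sup>2) \<partial>lborel \<partial>lborel) < \<infinity>" .
qed

lemma K_L4:
  assumes u: "LpLq 4 (4/3) T u"
  shows "(\<integral>\<^sup>+t. (\<integral>\<^sup>+x. ennreal (norm (K u t x) ^ 4) \<partial>lborel) * indicator {0<..<T} t \<partial>lborel) < \<infinity>"
proof -
  note [measurable] = LpLq_measurable[OF u]
  define A where "A t = enn2real (\<integral>\<^sup>+x. ennreal (\<bar>u t x\<bar> powr (4/3)) \<partial>lborel)" for t
  note A = LpLq_4_43[OF u, folded A_def]
  have A0: "0 \<le> A t" for t by (simp add: A_def)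
  have [measurable]: "A \<in> borel_measurable borel" unfolding A_def by measurable
  have "(\<integral>\<^sup>+t. (\<integral>\<^sup>+x. ennreal (norm (K u t x) ^ 4) \<partial>lborel) * indicator {0<..<T} t \<partial>lborel) \<le>
    (\<integral>\<^sup>+t. ennreal (16 * riesz_const ^ 4) * (ennreal ((1 + A t) ^ 3) * indicator {0<..<T} t) \<partial>lborel)"
  proof (rule nn_integral_mono_AE, use A(1) in eventually_elim)
    case (elim t)
    show ?case
    proof (cases "t \<in> {0<..<T}")
      case True
      have "(\<integral>\<^sup>+x. ennreal (norm (K u t x) ^ 4) \<partial>lborel) \<le> ennreal (16 * riesz_const ^ 4 * (1 + A t) ^ 3)"
        by (rule nn_integral_K_le) (use elim True A0 in auto)
      also have "\<dots> = ennreal (16 * riesz_const ^ 4) * ennreal ((1 + A t) ^ 3)"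
        using A0[of t] by (intro ennreal_mult) auto
      finally show ?thesis using True by simp
    qed simp
  qed
  also have "\<dots> = ennreal (16 * riesz_const ^ 4) * (\<integral>\<^sup>+t. ennreal ((1 + A t) ^ 3) * indicator {0<..<T} t \<partial>lborel)"
    by (rule nn_integral_cmult) measurable
  also have "\<dots> < \<infinity>" using A(2) by (simp add: ennreal_mult_less_top)
  finally show ?thesis .
qed

lemma spacetime_L2_K_mult:
  fixes Ki :: "real \<Rightarrow> real \<times> real \<Rightarrow> real"
  assumes u: "LpLq 4 (4/3) T u" and v: "LpLq 4 4 T v"
    and Ki[measurable]: "(\<lambda>(t,x). Ki t x) \<in> borel_measurable (borel \<Otimes>\<^sub>M borel)" and le: "\<And>t x. \<bar>Ki t x\<bar> \<le> norm (K u t x)"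
  shows "spacetime_L2 (\<lambda>t x. Ki t x * (v t x * indicator {0<..<T} t))"
proof (rule spacetime_L2I)
  note [measurable] = LpLq_measurable[OF v] K_measurable[OF LpLq_measurable[OF u]]
  show "(\<lambda>(t,x). Ki t x * (v t x * indicator {0<..<T} t)) \<in> borel_measurable (borel \<Otimes>\<^sub>M borel)" by measurable
  have "(\<integral>\<^sup>+t. \<integral>\<^sup>+x. ennreal ((Ki t x * (v t x * indicator {0<..<T} t))\<^sup>2) \<partial>lborel \<partial>lborel) \<le>
     (\<integral>\<^sup>+t. (\<integral>\<^sup>+x. ennreal (norm (K u t x) ^ 4) + ennreal (v t x ^ 4) \<partial>lborel) * indicator {0<..<T} t \<partial>lborel)"
  proof (intro nn_integral_mono)
    fix t
    have "(\<integral>\<^sup>+x. ennreal ((Ki t x * v t x)\<^sup>2) \<partial>lborel) \<le> (\<integral>\<^sup>+x. ennreal (norm (K u t x) ^ 4) + ennreal (v t x ^ 4) \<partial>lborel)"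
    proof (intro nn_integral_mono)
      fix x
      have "(Ki t x)\<^sup>2 \<le> (norm (K u t x))\<^sup>2" using power_mono[OF le[of t x], of 2] by simp
      then have "(Ki t x * v t x)\<^sup>2 \<le> (norm (K u t x))\<^sup>2 * (v t x)\<^sup>2"
        unfolding power_mult_distrib by (intro mult_right_mono) auto
      also have "\<dots> \<le> norm (K u t x) ^ 4 + v t x ^ 4"
      proof -
        have "a * b \<le> a\<^sup>2 + b\<^sup>2" if "0 \<le> a" "0 \<le> b" for a b :: real
          using sum_squares_bound[of a b] mult_nonneg_nonneg[OF that] by linarith
        from this[of "(norm (K u t x))\<^sup>2" "(v t x)\<^sup>2"] show ?thesis by (simp flip: power_mult)
      qed
      finally show "ennreal ((Ki t x * v t x)\<^sup>2) \<le> ennreal (norm (K u t x) ^ 4) + ennreal (v t x ^ 4)"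
        by (simp flip: ennreal_plus add: ennreal_leI)
    qed
    then show "(\<integral>\<^sup>+x. ennreal ((Ki t x * (v t x * indicator {0<..<T} t))\<^sup>2) \<partial>lborel) \<le>
      (\<integral>\<^sup>+x. ennreal (norm (K u t x) ^ 4) + ennreal (v t x ^ 4) \<partial>lborel) * indicator {0<..<T} t"
      by (cases "t \<in> {0<..<T}") auto
  qed
  also have "\<dots> = (\<integral>\<^sup>+t. (\<integral>\<^sup>+x. ennreal (norm (K u t x) ^ 4) \<partial>lborel) * indicator {0<..<T} t + (\<integral>\<^sup>+x. ennreal (v t x ^ 4) \<partial>lborel) * indicator {0<..<T} t \<partial>lborel)"
    by (simp add: nn_integral_add distrib_right)
  also have "\<dots> = (\<integral>\<^sup>+t. (\<integral>\<^sup>+x. ennreal (norm (K u t x) ^ 4) \<partial>lborel) * indicator {0<..<T} t \<partial>lborel) + (\<integral>\<^sup>+t. (\<integral>\<^sup>+x. ennreal (v t x ^ 4) \<partial>lborel) * indicator {0<..<T} t \<partial>lborel)"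
    by (rule nn_integral_add) measurable
  also have "\<dots> < \<infinity>" using K_L4[OF u] LpLq_4_4[OF v] by simp
  finally show "(\<integral>\<^sup>+t. \<integral>\<^sup>+x. ennreal ((Ki t x * (v t x * indicator {0<..<T} t))\<^sup>2) \<partial>lborel \<partial>lborel) < \<infinity>" .
qed

lemma abs_fst_le_norm: "\<bar>fst z\<bar> \<le> norm z" and abs_snd_le_norm: "\<bar>snd z\<bar> \<le> norm z" for z :: "real \<times> real"
  using norm_fst_le[of "fst z" "snd z"] norm_snd_le[of "snd z" "fst z"] by auto

text \<open>The weak equation is tested with the truncated cube in time times the mollifier centred
  at \<open>y\<close>. The right side collects the values at time 0 and does not depend on
  \<open>v\<close>, so it cancels when two solutions are subtracted.\<close>

lemma weak_sol_tensor:
  fixes c s :: real and y :: "real \<times> real"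
  assumes ws: "weak_sol \<nu> T u mp mm v" and c: "c > 0" and s: "0 < s" "s < T"
    and u: "LpLq 4 (4/3) T u" and v4: "LpLq 4 4 T v" and v43: "LpLq 4 (4/3) T v"
  defines "V \<equiv> \<lambda>t x. v t x * indicator {0<..<T} t"
  shows "(LBINT t. - 3 * (max 0 (s - t))\<^sup>2 * mollify (tensor2 (mollifier c) (mollifier c)) (V t) y + (max 0 (s - t)) ^ 3 *
          (\<nu> * (mollify (tensor2 (mollifier'' c) (mollifier c)) (V t) y + mollify (tensor2 (mollifier c) (mollifier'' c)) (V t) y)
           + (mollify (tensor2 (mollifier' c) (mollifier c)) (\<lambda>x. fst (K u t x) * V t x) y
              + mollify (tensor2 (mollifier c) (mollifier' c)) (\<lambda>x. snd (K u t x) * V t x) y))) =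
     (\<integral>x. s ^ 3 * tensor2 (mollifier c) (mollifier c) (x - y) \<partial>mm) - (\<integral>x. s ^ 3 * tensor2 (mollifier c) (mollifier c) (x - y) \<partial>mp)"
proof -
  define f where "f t = (max 0 (s - t)) ^ 3" for t
  define f' where "f' t = - 3 * (max 0 (s - t))\<^sup>2" for t
  define g where "g k a = k c (a - fst y)" for k :: "real \<Rightarrow> real \<Rightarrow> real" and a
  define h where "h k b = k c (b - snd y)" for k :: "real \<Rightarrow> real \<Rightarrow> real" and b
  have df: "(f has_real_derivative f' t) (at t)" for t
    unfolding f_def f'_def by (rule DERIV_time)
  have dg: "(g mollifier has_real_derivative g mollifier' a) (at a)" "(g mollifier' has_real_derivative g mollifier'' a) (at a)" for a
    unfolding g_def[abs_def] by (intro DERIV_translate DERIV_mollifier DERIV_mollifier')+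
  have dh: "(h mollifier has_real_derivative h mollifier' a) (at a)" "(h mollifier' has_real_derivative h mollifier'' a) (at a)" for a
    unfolding h_def[abs_def] by (intro DERIV_translate DERIV_mollifier DERIV_mollifier')+
  define \<phi> where "\<phi> = tensor3 f (g mollifier) (h mollifier)"
  have t3: "tensor3 F (g k) (h l) (t, x) = F t * tensor2 (k c) (l c) (x - y)" for F k l t x
    by (simp add: tensor3_def tensor2_def g_def h_def)
  have p: "partial \<phi> (1, 0) = tensor3 f' (g mollifier) (h mollifier)"
      "partial \<phi> (0, (1, 0)) = tensor3 f (g mollifier') (h mollifier)"
      "partial \<phi> (0, (0, 1)) = tensor3 f (g mollifier) (h mollifier')"
    unfolding \<phi>_def by (rule tensor3_partial[OF df dg(1) dh(1)])+
  have lap: "lap_x \<phi> z = tensor3 f (g mollifier'') (h mollifier) z + tensor3 f (g mollifier) (h mollifier'') z" for z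
    by (simp add: lap_x_def Basis_real2 p tensor3_partial[OF df dg(2) dh(1)] tensor3_partial[OF df dg(1) dh(2)])
  have test: "st_test T \<phi>"
    unfolding st_test_def
  proof
    show "Ck 2 \<phi>"
      unfolding \<phi>_def f_def g_def[abs_def] h_def[abs_def] by (intro Ck_tensor3 Ck_real_mollifier Ck_real_time)
    \<comment> \<open>The kernel lives within \<open>2 / c\<close> of \<open>y\<close>; the extra 1
      makes the inequality on the norm strict.\<close>
    have "\<phi> (t, x) = 0" if *: "s \<le> t \<or> 2 / c + 1 + norm y \<le> norm x" for t x
    proof (cases "s \<le> t")
      case True
      then show ?thesis by (simp add: \<phi>_def t3 f_def)
    next
      case False
      then have "2 * (1 / c) < norm (x - y)" using * norm_triangle_ineq2[of x y] by simp
      then show ?thesis using tensor2_zero[of "1/c" "mollifier c" "mollifier c"] mollifier_zero[OF c] by (simp add: \<phi>_def t3)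
    qed
    then show "\<exists>T'<T. \<exists>R. \<forall>t x. 0 \<le> t \<and> t \<le> T \<and> (T' \<le> t \<or> R \<le> norm x) \<longrightarrow> \<phi> (t, x) = 0"
      using s(2) by blast
  qed
  let ?R = "\<lambda>k l. tensor2 (k c) (l c) :: real \<times> real \<Rightarrow> real"
  have ccR: "Cc (?R mollifier mollifier)" "Cc (?R mollifier' mollifier)" "Cc (?R mollifier mollifier')" "Cc (?R mollifier'' mollifier)" "Cc (?R mollifier mollifier'')"
    by (intro Cc_tensor2[where d="1/c"] continuous_mollifier continuous_mollifier' continuous_mollifier'' mollifier_zero[OF c]; assumption)+
  note [measurable] = ccR[THEN Cc_measurable] LpLq_measurable[OF v4] K_measurable[OF LpLq_measurable[OF u]]
  have [measurable]: "f \<in> borel_measurable borel" "f' \<in> borel_measurable borel"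
    unfolding f_def f'_def by measurable
  have K1m: "(\<lambda>(t,x). fst (K u t x)) \<in> borel_measurable (borel \<Otimes>\<^sub>M borel)" by measurable
  have K2m: "(\<lambda>(t,x). snd (K u t x)) \<in> borel_measurable (borel \<Otimes>\<^sub>M borel)" by measurable
  have stV: "spacetime_L2 V" unfolding V_def by (rule spacetime_L2_LpLq[OF v4 v43])
  have st1: "spacetime_L2 (\<lambda>t x. fst (K u t x) * V t x)"
    unfolding V_def by (rule spacetime_L2_K_mult[OF u v4 K1m]) (rule abs_fst_le_norm)
  have st2: "spacetime_L2 (\<lambda>t x. snd (K u t x) * V t x)"
    unfolding V_def by (rule spacetime_L2_K_mult[OF u v4 K2m]) (rule abs_snd_le_norm)
  let ?I = "\<lambda>t x. f' t * ?R mollifier mollifier (x - y) + \<nu> * (f t * ?R mollifier'' mollifier (x - y) + f t * ?R mollifier mollifier'' (x - y))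
      + (fst (K u t x) * (f t * ?R mollifier' mollifier (x - y)) + snd (K u t x) * (f t * ?R mollifier mollifier' (x - y)))"
  let ?rhs = "\<lambda>t. f' t * mollify (?R mollifier mollifier) (V t) y + f t *
          (\<nu> * (mollify (?R mollifier'' mollifier) (V t) y + mollify (?R mollifier mollifier'') (V t) y)
           + (mollify (?R mollifier' mollifier) (\<lambda>x. fst (K u t x) * V t x) y + mollify (?R mollifier mollifier') (\<lambda>x. snd (K u t x) * V t x) y))"
  have "(LINT t:{0<..<T}|lborel. (LBINT x. (partial \<phi> (1, 0) (t, x) + \<nu> * lap_x \<phi> (t, x)
              + (\<Sum>j\<in>Basis. (K u t x \<bullet> j) * partial \<phi> (0, j) (t, x))) * v t x))
     = (LINT t:{0<..<T}|lborel. (LBINT x. ?I t x * v t x))"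
    by (simp add: p lap t3 Basis_real2 inner_prod_def)
  also have "\<dots> = (LBINT t. ?rhs t)"
    unfolding set_lebesgue_integral_def
  proof (rule integral_cong_AE)
    note [measurable] = mollify_measurable_pair[OF ccR(1) spacetime_L2_measurable[OF stV]] mollify_measurable_pair[OF ccR(4) spacetime_L2_measurable[OF stV]]
      mollify_measurable_pair[OF ccR(5) spacetime_L2_measurable[OF stV]] mollify_measurable_pair[OF ccR(2) spacetime_L2_measurable[OF st1]] mollify_measurable_pair[OF ccR(3) spacetime_L2_measurable[OF st2]]
    show "(\<lambda>t. indicator {0<..<T} t *\<^sub>R (LBINT x. ?I t x * v t x)) \<in> borel_measurable lborel" by measurable
    show "?rhs \<in> borel_measurable lborel" by measurable
    show "AE t in lborel. indicator {0<..<T} t *\<^sub>R (LBINT x. ?I t x * v t x) = ?rhs t"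
      using spacetime_L2_section[OF stV] spacetime_L2_section[OF st1] spacetime_L2_section[OF st2]
    proof eventually_elim
      case (elim t)
      show ?case
      proof (cases "t \<in> {0<..<T}")
        case False
        then have "V t = (\<lambda>x. 0)" by (auto simp: V_def)
        then show ?thesis using False by (simp add: mollify_zero)
      next
        case True
        then have Vt: "V t x = v t x" for x by (simp add: V_def)
        note i = mollify_integrable[OF ccR(1) elim(1), of y] mollify_integrable[OF ccR(4) elim(1), of y] mollify_integrable[OF ccR(5) elim(1), of y]
          mollify_integrable[OF ccR(2) elim(2), of y] mollify_integrable[OF ccR(3) elim(3), of y]
        have "(LBINT x. ?I t x * v t x) = (LBINT x. f' t * (?R mollifier mollifier (x - y) * V t x)
            + f t * (\<nu> * (?R mollifier'' mollifier (x - y) * V t x + ?R mollifier mollifier'' (x - y) * V t x)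
            + (?R mollifier' mollifier (x - y) * (fst (K u t x) * V t x) + ?R mollifier mollifier' (x - y) * (snd (K u t x) * V t x))))"
          by (intro Bochner_Integration.integral_cong) (simp_all add: Vt algebra_simps)
        also have "\<dots> = ?rhs t" unfolding mollify_def using i by simp
        finally show ?thesis using True by simp
      qed
    qed
  qed
  finally have eq: "(LINT t:{0<..<T}|lborel. (LBINT x. (partial \<phi> (1, 0) (t, x) + \<nu> * lap_x \<phi> (t, x)
              + (\<Sum>j\<in>Basis. (K u t x \<bullet> j) * partial \<phi> (0, j) (t, x))) * v t x)) = (LBINT t. ?rhs t)" .
  have "(LBINT t. ?rhs t) + ((\<integral>x. \<phi> (0, x) \<partial>mp) - (\<integral>x. \<phi> (0, x) \<partial>mm)) = 0"
    using ws test unfolding weak_sol_def eq[symmetric] by blast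
  moreover have "\<phi> (0, x) = s ^ 3 * ?R mollifier mollifier (x - y)" for x
    using s by (simp add: \<phi>_def t3 f_def)
  ultimately show ?thesis unfolding f_def f'_def by simp
qed

subsection \<open>Uniqueness\<close>

text \<open>The Bochner integral is additive only on integrable functions; this is what allows the
  equations of two solutions to be subtracted.\<close>

lemma mollified_integrand_integrable:
  fixes V G1 G2 :: "real \<Rightarrow> 'a::euclidean_space \<Rightarrow> real"
  assumes Cc: "Cc \<rho>" "Cc \<rho>1" "Cc \<rho>2" "Cc \<rho>11" "Cc \<rho>22"
    and st: "spacetime_L2 V" "spacetime_L2 G1" "spacetime_L2 G2"
    and zero: "\<And>t x. t \<notin> {0<..<T} \<Longrightarrow> V t x = 0" "\<And>t x. t \<notin> {0<..<T} \<Longrightarrow> G1 t x = 0"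
      "\<And>t x. t \<notin> {0<..<T} \<Longrightarrow> G2 t x = 0"
    and s: "s < T"
  shows "integrable lborel (\<lambda>t. - 3 * (max 0 (s - t))\<^sup>2 * mollify \<rho> (V t) y + (max 0 (s - t)) ^ 3 *
          (\<nu> * (mollify \<rho>11 (V t) y + mollify \<rho>22 (V t) y) + (mollify \<rho>1 (G1 t) y + mollify \<rho>2 (G2 t) y)))"
proof -
  let ?b = "\<lambda>t. \<nu> * (mollify \<rho>11 (V t) y + mollify \<rho>22 (V t) y) + (mollify \<rho>1 (G1 t) y + mollify \<rho>2 (G2 t) y)"
  have p: "\<bar>max 0 (s - t)\<bar> ^ n \<le> T ^ n" if "t \<in> {0<..<T}" for t n
    using that s by (intro power_mono) auto
  have b: "integrable lborel ?b"
    by (intro Bochner_Integration.integrable_add integrable_mult_right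
        mollify_time_integrable[OF _ st(1) zero(1)] mollify_time_integrable[OF _ st(2) zero(2)] mollify_time_integrable[OF _ st(3) zero(3)] Cc)
  have b0: "?b t = 0" if "t \<notin> {0<..<T}" for t
    using zero[OF that] by (simp add: mollify_zero)
  have a0: "mollify \<rho> (V t) y = 0" if "t \<notin> {0<..<T}" for t
    using zero(1)[OF that] by (simp add: mollify_zero)
  have "integrable lborel (\<lambda>t. (- 3 * (max 0 (s - t))\<^sup>2) * mollify \<rho> (V t) y)"
  proof (rule integrable_mult_bounded)
    show "integrable lborel (\<lambda>t. mollify \<rho> (V t) y)" by (rule mollify_time_integrable[OF Cc(1) st(1) zero(1)])
    show "\<bar>- 3 * (max 0 (s - t))\<^sup>2\<bar> \<le> 3 * T\<^sup>2" if "mollify \<rho> (V t) y \<noteq> 0" for t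
    proof -
      have "t \<in> {0<..<T}" using a0[of t] that by blast
      from p[OF this, of 2] show ?thesis by (simp add: abs_mult power_abs)
    qed
  qed simp
  moreover have "integrable lborel (\<lambda>t. (max 0 (s - t)) ^ 3 * ?b t)"
  proof (rule integrable_mult_bounded[OF _ b])
    show "\<bar>(max 0 (s - t)) ^ 3\<bar> \<le> T ^ 3" if "?b t \<noteq> 0" for t
    proof -
      have "t \<in> {0<..<T}" using b0[of t] that by blast
      then show ?thesis using p[of t 3] by (simp add: power_abs)
    qed
  qed simp
  ultimately show ?thesis by (rule Bochner_Integration.integrable_add)
qed

theorem theorem4p2:
  fixes \<nu> T :: real
    and mp mm :: "(real \<times> real) measure"
    and u u1 u2 :: "real \<Rightarrow> real \<times> real \<Rightarrow> real"
  assumes "\<nu> > 0" and "T > 0"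
    and "sets mp = sets borel" and "finite_measure mp"
    and "sets mm = sets borel" and "finite_measure mm"
    and "LpLq 4 (4/3) T u"
    and "LpLq 4 4 T u1" and "LpLq 4 (4/3) T u1"
    and "LpLq 4 4 T u2" and "LpLq 4 (4/3) T u2"
    and "Linf_Hminus1 T (\<lambda>t x. u1 t x - u2 t x)"
    and "AE t in lborel. t \<in> {0<..<T} \<longrightarrow> integrable lborel (\<lambda>x. u1 t x - u2 t x)"
    and "\<And>\<phi>. test_fun \<phi> \<Longrightarrow>
           ((\<lambda>t. esssup (restrict_space lborel {0<..<t})
                   (\<lambda>s. ereal (\<integral>x. (u1 s x - u2 s x) * \<phi> x \<partial>lborel))) \<longlongrightarrow> 0) (at_right 0)"
    and "weak_sol \<nu> T u mp mm u1"
    and "weak_sol \<nu> T u mp mm u2"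
  shows "AE z in lborel. fst z \<in> {0<..<T} \<longrightarrow> u1 (fst z) (snd z) = u2 (fst z) (snd z)"
proof -
  note u = assms(7) and u1 = assms(8,9) and u2 = assms(10,11) and ws = assms(15,16)
  \<comment> \<open>Extension by zero lets every time integral run over the whole line, as
    \<open>mollified_equation\<close> expects.\<close>
  define V where "V v t x = v t x * indicator {0<..<T} t" for v :: "real \<Rightarrow> real \<times> real \<Rightarrow> real" and t x
  define w where "w t x = V u1 t x - V u2 t x" for t x
  define K1 where "K1 t x = fst (K u t x)" for t x
  define K2 where "K2 t x = snd (K u t x)" for t x
  note [measurable] = LpLq_measurable[OF u1(1)] LpLq_measurable[OF u2(1)] K_measurable[OF LpLq_measurable[OF u]]
  have K1m[measurable]: "(\<lambda>(t,x). K1 t x) \<in> borel_measurable (borel \<Otimes>\<^sub>M borel)" unfolding K1_def by measurable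
  have K2m[measurable]: "(\<lambda>(t,x). K2 t x) \<in> borel_measurable (borel \<Otimes>\<^sub>M borel)" unfolding K2_def by measurable
  have V0: "V v t x = 0" if "t \<notin> {0<..<T}" for v t x using that by (simp add: V_def)
  have stV: "spacetime_L2 (V v)" if "LpLq 4 4 T v" "LpLq 4 (4/3) T v" for v
    using spacetime_L2_LpLq[OF that] by (simp add: V_def[abs_def])
  have stK: "spacetime_L2 (\<lambda>t x. K1 t x * V v t x)" "spacetime_L2 (\<lambda>t x. K2 t x * V v t x)" if "LpLq 4 4 T v" for v
    unfolding V_def by (rule spacetime_L2_K_mult[OF u that K1m] spacetime_L2_K_mult[OF u that K2m], simp add: K1_def K2_def abs_fst_le_norm abs_snd_le_norm)+
  have Kw: "K1 t x * w t x = K1 t x * V u1 t x - K1 t x * V u2 t x" "K2 t x * w t x = K2 t x * V u1 t x - K2 t x * V u2 t x" for t x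
    by (simp_all add: w_def right_diff_distrib)
  have stw: "spacetime_L2 w" "spacetime_L2 (\<lambda>t x. K1 t x * w t x)" "spacetime_L2 (\<lambda>t x. K2 t x * w t x)"
    unfolding Kw by (simp_all add: w_def[abs_def] spacetime_L2_diff stV stK u1 u2)
  have w0: "w t x = 0" if "t \<notin> {0<..<T}" for t x using V0[OF that] by (simp add: w_def)
  \<comment> \<open>The offset 2 keeps the support radius \<open>2 / c n\<close> at most 1, as the
    approximation lemmas require.\<close>
  define c where "c n = real n + 2" for n :: nat
  have c: "c n > 0" for n by (simp add: c_def)
  have moll: "mollified_equation \<nu> T (tensor2 (mollifier (c n)) (mollifier (c n))) (tensor2 (mollifier' (c n)) (mollifier (c n))) (tensor2 (mollifier (c n)) (mollifier' (c n)))
     (tensor2 (mollifier'' (c n)) (mollifier (c n))) (tensor2 (mollifier (c n)) (mollifier'' (c n))) w (\<lambda>t x. K1 t x * w t x) (\<lambda>t x. K2 t x * w t x)" for n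
  proof
    let ?p = "mollifier (c n)" and ?p' = "mollifier' (c n)" and ?p'' = "mollifier'' (c n)"
    note [simp] = continuous_mollifier continuous_mollifier' continuous_mollifier'' mollifier_zero[OF c]
    show ccR: "Cc (tensor2 ?p ?p)" "Cc (tensor2 ?p' ?p)" "Cc (tensor2 ?p ?p')" "Cc (tensor2 ?p'' ?p)" "Cc (tensor2 ?p ?p'')"
      by (rule Cc_tensor2[where d="1/c n"]; simp)+
    show "has_dir_deriv (1,0) (tensor2 ?p ?p) (tensor2 ?p' ?p)" "has_dir_deriv (0,1) (tensor2 ?p ?p) (tensor2 ?p ?p')"
      by (rule has_dir_deriv_tensor2[OF DERIV_mollifier DERIV_mollifier])+
    show "has_dir_deriv (1,0) (tensor2 ?p' ?p) (tensor2 ?p'' ?p)" by (rule has_dir_deriv_tensor2(1)[OF DERIV_mollifier' DERIV_mollifier])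
    show "has_dir_deriv (0,1) (tensor2 ?p ?p') (tensor2 ?p ?p'')" by (rule has_dir_deriv_tensor2(2)[OF DERIV_mollifier DERIV_mollifier'])
    show "0 \<le> tensor2 ?p ?p x" for x
      using bump_mass_pos[OF c] by (simp add: tensor2_def mollifier_def bump_nonneg)
    show "(LBINT x. tensor2 ?p ?p x) = 1" by (rule integral_mollifier_tensor2[OF c])
    show "w t x = 0" "K1 t x * w t x = 0" "K2 t x * w t x = 0" if "t \<notin> {0<..<T}" for t x
      using w0[OF that] by auto
    fix s :: real and y :: "real \<times> real"
    assume s: "0 < s" "s < T"
    define F where "F z g1 g2 t = - 3 * (max 0 (s - t))\<^sup>2 * mollify (tensor2 ?p ?p) (z t) y + (max 0 (s - t)) ^ 3 *
          (\<nu> * (mollify (tensor2 ?p'' ?p) (z t) y + mollify (tensor2 ?p ?p'') (z t) y) + (mollify (tensor2 ?p' ?p) (g1 t) y + mollify (tensor2 ?p ?p') (g2 t) y))"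
      for z g1 g2 :: "real \<Rightarrow> real \<times> real \<Rightarrow> real" and t
    have i: "integrable lborel (F (V v) (\<lambda>t x. K1 t x * V v t x) (\<lambda>t x. K2 t x * V v t x))"
      if "LpLq 4 4 T v" "LpLq 4 (4/3) T v" for v
      unfolding F_def by (rule mollified_integrand_integrable[OF ccR stV[OF that] stK[OF that(1)] _ _ _ s(2)]) (simp_all add: V0)
    have eq: "(LBINT t. F (V v) (\<lambda>t x. K1 t x * V v t x) (\<lambda>t x. K2 t x * V v t x) t) =
       (\<integral>x. s ^ 3 * tensor2 ?p ?p (x - y) \<partial>mm) - (\<integral>x. s ^ 3 * tensor2 ?p ?p (x - y) \<partial>mp)"
      if "weak_sol \<nu> T u mp mm v" "LpLq 4 4 T v" "LpLq 4 (4/3) T v" for v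
      unfolding F_def V_def K1_def K2_def by (rule weak_sol_tensor[OF that(1) c s u that(2,3)])
    have "(LBINT t. F w (\<lambda>t x. K1 t x * w t x) (\<lambda>t x. K2 t x * w t x) t) =
      (LBINT t. F (V u1) (\<lambda>t x. K1 t x * V u1 t x) (\<lambda>t x. K2 t x * V u1 t x) t - F (V u2) (\<lambda>t x. K1 t x * V u2 t x) (\<lambda>t x. K2 t x * V u2 t x) t)"
    proof (rule integral_cong_AE)
      show "F w (\<lambda>t x. K1 t x * w t x) (\<lambda>t x. K2 t x * w t x) \<in> borel_measurable lborel"
        unfolding F_def
        by (rule borel_measurable_integrable, rule mollified_integrand_integrable[OF ccR stw _ _ _ s(2)]) (simp_all add: w0)
      show "(\<lambda>t. F (V u1) (\<lambda>t x. K1 t x * V u1 t x) (\<lambda>t x. K2 t x * V u1 t x) t - F (V u2) (\<lambda>t x. K1 t x * V u2 t x) (\<lambda>t x. K2 t x * V u2 t x) t) \<in> borel_measurable lborel"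
        using i[OF u1] i[OF u2] by simp
      \<comment> \<open>Linearity of the mollification is available for square integrable sections,
        hence only at almost every time.\<close>
      show "AE t in lborel. F w (\<lambda>t x. K1 t x * w t x) (\<lambda>t x. K2 t x * w t x) t =
         F (V u1) (\<lambda>t x. K1 t x * V u1 t x) (\<lambda>t x. K2 t x * V u1 t x) t - F (V u2) (\<lambda>t x. K1 t x * V u2 t x) (\<lambda>t x. K2 t x * V u2 t x) t"
        using spacetime_L2_section[OF stV[OF u1]] spacetime_L2_section[OF stV[OF u2]] spacetime_L2_section[OF stK(1)[OF u1(1)]] spacetime_L2_section[OF stK(1)[OF u2(1)]]
          spacetime_L2_section[OF stK(2)[OF u1(1)]] spacetime_L2_section[OF stK(2)[OF u2(1)]]
      proof eventually_elim
        case (elim t)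
        have w': "w t = (\<lambda>x. V u1 t x - V u2 t x)" by (simp add: w_def fun_eq_iff)
        show ?case
          unfolding F_def Kw w' using elim ccR by (simp add: mollify_diff algebra_simps)
      qed
    qed
    also have "\<dots> = 0" using i[OF u1] i[OF u2] eq[OF ws(1) u1] eq[OF ws(2) u2] by simp
    finally show "(LBINT t. - 3 * (max 0 (s - t))\<^sup>2 * mollify (tensor2 ?p ?p) (w t) y + (max 0 (s - t)) ^ 3 *
          (\<nu> * (mollify (tensor2 ?p'' ?p) (w t) y + mollify (tensor2 ?p ?p'') (w t) y) + (mollify (tensor2 ?p' ?p) (\<lambda>x. K1 t x * w t x) y + mollify (tensor2 ?p ?p') (\<lambda>x. K2 t x * w t x) y))) = 0"
      unfolding F_def .
  qed (rule assms(1) assms(2) stw)+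
  have w4: "(\<integral>\<^sup>+t. \<integral>\<^sup>+x. ennreal (w t x ^ 4) \<partial>lborel \<partial>lborel) < \<infinity>"
  proof -
    \<comment> \<open>The convexity constant \<open>2^3\<close>, obtained by using
      \<open>(p - q)^2 \<le> 2 * (p^2 + q^2)\<close> and then
      \<open>(p + q)^2 \<le> 2 * (p^2 + q^2)\<close>.\<close>
    have le: "(a - b) ^ 4 \<le> 8 * (a ^ 4 + b ^ 4)" for a b :: real
    proof -
      have "(a - b)\<^sup>2 \<le> 2 * (a\<^sup>2 + b\<^sup>2)" using zero_le_power2[of "a + b"] by (simp add: power2_eq_square algebra_simps)
      then have "((a - b)\<^sup>2)\<^sup>2 \<le> (2 * (a\<^sup>2 + b\<^sup>2))\<^sup>2" by (rule power_mono) simp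
      also have "\<dots> \<le> 8 * ((a\<^sup>2)\<^sup>2 + (b\<^sup>2)\<^sup>2)" using zero_le_power2[of "a\<^sup>2 - b\<^sup>2"] by (simp add: power2_eq_square algebra_simps)
      finally show ?thesis by (simp flip: power_mult)
    qed
    let ?g = "\<lambda>v t. (\<integral>\<^sup>+x. ennreal (v t x ^ 4) \<partial>lborel) * indicator {0<..<T} t"
    have "(\<integral>\<^sup>+t. \<integral>\<^sup>+x. ennreal (w t x ^ 4) \<partial>lborel \<partial>lborel) \<le> (\<integral>\<^sup>+t. 8 * (?g u1 t + ?g u2 t) \<partial>lborel)"
    proof (rule nn_integral_mono)
      fix t
      show "(\<integral>\<^sup>+x. ennreal (w t x ^ 4) \<partial>lborel) \<le> 8 * (?g u1 t + ?g u2 t)"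
      proof (cases "t \<in> {0<..<T}")
        case True
        have "(\<integral>\<^sup>+x. ennreal (w t x ^ 4) \<partial>lborel) \<le> (\<integral>\<^sup>+x. 8 * (ennreal (u1 t x ^ 4) + ennreal (u2 t x ^ 4)) \<partial>lborel)"
        proof (rule nn_integral_mono)
          fix x
          have "ennreal (w t x ^ 4) \<le> ennreal (8 * (u1 t x ^ 4 + u2 t x ^ 4))"
            using le[of "u1 t x" "u2 t x"] True by (intro ennreal_leI) (simp add: w_def V_def)
          also have "\<dots> = 8 * (ennreal (u1 t x ^ 4) + ennreal (u2 t x ^ 4))"
            by (subst ennreal_mult) (auto simp: ennreal_plus)
          finally show "ennreal (w t x ^ 4) \<le> 8 * (ennreal (u1 t x ^ 4) + ennreal (u2 t x ^ 4))" .
        qed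
        also have "\<dots> = 8 * ((\<integral>\<^sup>+x. ennreal (u1 t x ^ 4) \<partial>lborel) + (\<integral>\<^sup>+x. ennreal (u2 t x ^ 4) \<partial>lborel))"
          by (simp add: nn_integral_cmult nn_integral_add)
        finally show ?thesis using True by simp
      qed (simp add: w0)
    qed
    also have "\<dots> = 8 * ((\<integral>\<^sup>+t. ?g u1 t \<partial>lborel) + (\<integral>\<^sup>+t. ?g u2 t \<partial>lborel))"
      by (simp add: nn_integral_cmult nn_integral_add)
    also have "\<dots> < \<infinity>" using LpLq_4_4[OF u1(1)] LpLq_4_4[OF u2(1)] by (simp add: ennreal_mult_less_top)
    finally show ?thesis .
  qed
  have K4: "(\<integral>\<^sup>+t. \<integral>\<^sup>+x. ennreal (((K1 t x)\<^sup>2 + (K2 t x)\<^sup>2)\<^sup>2) * indicator {0<..<T} t \<partial>lborel \<partial>lborel) < \<infinity>"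
  proof -
    have "((K1 t x)\<^sup>2 + (K2 t x)\<^sup>2)\<^sup>2 = norm (K u t x) ^ 4" for t x
    proof -
      have "(norm (K u t x))\<^sup>2 = (K1 t x)\<^sup>2 + (K2 t x)\<^sup>2" by (simp add: K1_def K2_def norm_prod_def)
      then show ?thesis by (metis power_mult mult_2 numeral_Bit0)
    qed
    then show ?thesis using K_L4[OF u] by (simp add: nn_integral_multc)
  qed
  have lim: "(\<lambda>n. 2 / c n) \<longlonglongrightarrow> 0"
    using LIMSEQ_ignore_initial_segment[OF lim_const_over_n[of 2], of 2] by (simp add: c_def add.commute)
  have "AE z in lborel \<Otimes>\<^sub>M lborel. w (fst z) (snd z) = 0"
  proof (rule mollified_uniqueness[OF moll _ lim _ K1m K2m w4 K4])
    show "2 / c n \<le> 1" for n by (simp add: c_def)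
    show "tensor2 (mollifier (c n)) (mollifier (c n)) x = 0" if "2 / c n < norm x" for n x
      using tensor2_zero[of "1 / c n" "mollifier (c n)" "mollifier (c n)" x] mollifier_zero[OF c] that by simp
  qed
  then show ?thesis
    unfolding lborel_prod by eventually_elim (auto simp: w_def V_def)
qed

end
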